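(* There are universal constants $c,C>0$ such that the following holds. Let $\|\cdot\|$ be a norm on $\mathbb{R}^d$ induced by an inner product $\langle\cdot,\cdot\rangle$, let $\mathcal{U}\subseteq\mathbb{R}^d$, and let $Y_1,\dots,Y_N$ be i.i.d. random vectors in $\mathbb{R}^d$ with finite second moments, mean $\mu=\mathbb{E}Y_1\in\mathcal{U}$ and non-degenerate covariance matrix. Let $X_1,\dots,X_N$ be the observed $\varepsilon$-contaminated version of $Y_1,\dots,Y_N$. Then for any $\delta\in[e^{-cN},1/2]$ there exists an estimator $\widehat{\mu}_\delta$ (a function of $X_1,\dots,X_N$) such that, with probability at least $1-\delta$, $$\|\widehat{\mu}_\delta-\mu\|\le C\,R\left(\sqrt{\frac{\mathrm{VC}(\mathcal{B}_0^*(\mathcal{U}))}{N}}+\sqrt{\frac{\log(1/\delta)}{N}}+\sqrt{\varepsilon}\right),$$ where $R^2=\sup_{v\in\mathcal{B}_0^*(\mathcal{U})}\mathbb{E}\left(\langle Y_1-\mu,v\rangle^2\right)$.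
   Context: Contamination: $X_1,\dots,X_N$ is $\varepsilon$-contaminated if there is a (possibly random) set $\mathcal{O}\subseteq\{1,\dots,N\}$ with $|\mathcal{O}|\le\lfloor\varepsilon N\rfloor$ such that $X_i=Y_i$ for all $i\notin\mathcal{O}$; the contamination may be adversarial, the adversary knowing both the clean sample and the estimator. Dual sets: $\mathcal{B}^*$ is the unit ball of the dual norm of $\|\cdot\|$, dual elements being identified with vectors through $x^*(y)=\langle y,x^*\rangle$. For $\mathcal{U}=\mathbb{R}^d$, $\mathcal{B}_0^*(\mathcal{U})=\mathcal{B}_0^*$ is the set of extreme points of $\mathcal{B}^*$; for general $\mathcal{U}$, $\mathcal{B}_0^*(\mathcal{U})$ is a subset of $\mathcal{B}^*$ with $\|v\|=\sup_{x^*\in\mathcal{B}_0^*(\mathcal{U})}x^*(v)$ for all $v\in\mathcal{U}-\mathcal{U}$. VC dimension: for a class $\mathcal{F}$ of $\{0,1\}$-valued functions on a set $\mathcal{X}$, $\mathrm{VC}(\mathcal{F})=\sup\{n:\max_{x_1,\dots,x_n\in\mathcal{X}}\#\{(f(x_1),\dots,f(x_n)):f\in\mathcal{F}\}=2^n\}$. For a set $A$ of vectors in a Euclidean space $E$, $\mathrm{VC}(A)=\mathrm{VC}(\{x\in E\mapsto\mathbf{1}_{\langle x,v\rangle\ge0}:v\in A\})$. The estimator proposed for this result is a median-of-means estimator: divide the sample into $K$ blocks $B_1,\dots,B_K$ of equal size $m=N/K$ (discarding some data if $K$ does not divide $N$), put $\bar X_k=\frac1m\sum_{i\in B_k}X_i$,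 and for $\eta>0$ take any point of $\mathbb{S}(\eta)=\bigcap_{x^*\in\mathcal{B}_0^*(\mathcal{U})}\{y\in\mathcal{U}:|\mathrm{Med}(x^*(\bar X_k):k=1,\dots,K)-x^*(y)|\le\eta\}$, where $\mathrm{Med}$ is the univariate median: $\mathrm{Med}(x_k)=x_i$ with $\#\{j:x_j\le x_i\}\ge K/2$ and $\#\{j:x_j\ge x_i\}\ge K/2$ (the smallest such one if there are several).
   Formalization: Two conditions are added, with c the universal constant: the contamination level satisfies ε ≤ c, and VC(B_0^*(U)) ≤ cN is required unless U is all of R^d; without them the bound fails for estimators not depending on the law of Y. *)

theory Defs
  imports "HOL-Probability.Probability" "HOL-Library.Extended_Nat"
begin

text \<open>
  The dimension is a natural number that is quantified inside the theorem, after the universal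
  constants; with vectors of type \<^typ>\<open>real^'n\<close> the constants could depend on the dimension.
  So \<open>\<real>\<^sup>d\<close> is the library's \<^term>\<open>Euclidean_space d\<close>, whose points are the functions
  \<open>nat \<Rightarrow> real\<close> vanishing at all indices \<open>\<ge> d\<close>. Its Borel sets are the traces of
  \<^term>\<open>borel :: (nat \<Rightarrow> real) measure\<close>.
\<close>

abbreviation Rd :: "nat \<Rightarrow> (nat \<Rightarrow> real) set" where
  "Rd d \<equiv> topspace (Euclidean_space d)"

abbreviation vminus :: "(nat \<Rightarrow> real) \<Rightarrow> (nat \<Rightarrow> real) \<Rightarrow> (nat \<Rightarrow> real)" where
  "vminus x y \<equiv> (\<lambda>j. x j - y j)"

definition inner_product_on :: "nat \<Rightarrow> ((nat \<Rightarrow> real) \<Rightarrow> (nat \<Rightarrow> real) \<Rightarrow> real) \<Rightarrow> bool" where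
  "inner_product_on d ip \<longleftrightarrow>
     (\<forall>x\<in>Rd d. \<forall>y\<in>Rd d. ip x y = ip y x) \<and>
     (\<forall>x\<in>Rd d. \<forall>y\<in>Rd d. \<forall>z\<in>Rd d. ip (\<lambda>j. x j + y j) z = ip x z + ip y z) \<and>
     (\<forall>a. \<forall>x\<in>Rd d. \<forall>y\<in>Rd d. ip (\<lambda>j. a * x j) y = a * ip x y) \<and>
     (\<forall>x\<in>Rd d. x \<noteq> (\<lambda>j. 0) \<longrightarrow> 0 < ip x x)"

definition ip_norm :: "((nat \<Rightarrow> real) \<Rightarrow> (nat \<Rightarrow> real) \<Rightarrow> real) \<Rightarrow> (nat \<Rightarrow> real) \<Rightarrow> real" where
  "ip_norm ip x = sqrt (ip x x)"

text \<open>A dual element \<open>x\<^sup>*\<close> is identified with the vector \<open>x\<close> such that \<open>x\<^sup>*(y) = ip y x\<close>.\<close>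

definition dual_norm ::
  "nat \<Rightarrow> ((nat \<Rightarrow> real) \<Rightarrow> (nat \<Rightarrow> real) \<Rightarrow> real) \<Rightarrow> (nat \<Rightarrow> real) \<Rightarrow> real" where
  "dual_norm d ip x = (SUP y\<in>{y\<in>Rd d. ip_norm ip y \<le> 1}. \<bar>ip y x\<bar>)"

definition dual_ball ::
  "nat \<Rightarrow> ((nat \<Rightarrow> real) \<Rightarrow> (nat \<Rightarrow> real) \<Rightarrow> real) \<Rightarrow> (nat \<Rightarrow> real) set" where
  "dual_ball d ip = {x\<in>Rd d. dual_norm d ip x \<le> 1}"

text \<open>
  Same definition as \<^const>\<open>extreme_point_of\<close>, which is not available here because
  \<open>nat \<Rightarrow> real\<close> is not an instance of \<^class>\<open>real_vector\<close>.
\<close>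

definition extreme_points :: "(nat \<Rightarrow> real) set \<Rightarrow> (nat \<Rightarrow> real) set" where
  "extreme_points S = {x\<in>S. \<not> (\<exists>y\<in>S. \<exists>z\<in>S. y \<noteq> z \<and>
     (\<exists>t. 0 < t \<and> t < 1 \<and> x = (\<lambda>j. (1 - t) * y j + t * z j)))}"

definition norming_for ::
  "((nat \<Rightarrow> real) \<Rightarrow> (nat \<Rightarrow> real) \<Rightarrow> real) \<Rightarrow> (nat \<Rightarrow> real) set \<Rightarrow> (nat \<Rightarrow> real) set \<Rightarrow> bool" where
  "norming_for ip U B \<longleftrightarrow> B \<noteq> {} \<and>
     (\<forall>u\<in>U. \<forall>w\<in>U. ip_norm ip (vminus u w) = (SUP x\<in>B. ip (vminus u w) x))"

definition is_dual_set ::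
  "nat \<Rightarrow> ((nat \<Rightarrow> real) \<Rightarrow> (nat \<Rightarrow> real) \<Rightarrow> real) \<Rightarrow> (nat \<Rightarrow> real) set \<Rightarrow> (nat \<Rightarrow> real) set \<Rightarrow> bool" where
  "is_dual_set d ip U B \<longleftrightarrow>
     (if U = Rd d then B = extreme_points (dual_ball d ip)
      else B \<subseteq> dual_ball d ip \<and> norming_for ip U B)"

text \<open>
  \<open>{0,1}\<close>-valued functions are rendered as predicates. A set of patterns on \<open>n\<close> points has at most
  \<open>2 ^ n\<close> elements, so the maximum over all point tuples is \<open>2 ^ n\<close> iff some tuple attains it.
\<close>

definition VC :: "'x set \<Rightarrow> ('x \<Rightarrow> bool) set \<Rightarrow> enat" where
  "VC X F = Sup {enat n |n. \<exists>xs. length xs = n \<and> set xs \<subseteq> X \<and>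
                               card ((\<lambda>f. map f xs) ` F) = 2 ^ n}"

definition VC_vectors ::
  "nat \<Rightarrow> ((nat \<Rightarrow> real) \<Rightarrow> (nat \<Rightarrow> real) \<Rightarrow> real) \<Rightarrow> (nat \<Rightarrow> real) set \<Rightarrow> enat" where
  "VC_vectors d ip A = VC (Rd d) ((\<lambda>v x. ip x v \<ge> 0) ` A)"

text \<open>
  \<^const>\<open>VC_vectors\<close> is at most \<open>d\<close> for \<open>A \<subseteq> \<real>\<^sup>d\<close> (homogeneous half-spaces), so nothing is lost
  in passing to a real number.
\<close>

definition VC_real ::
  "nat \<Rightarrow> ((nat \<Rightarrow> real) \<Rightarrow> (nat \<Rightarrow> real) \<Rightarrow> real) \<Rightarrow> (nat \<Rightarrow> real) set \<Rightarrow> real" where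
  "VC_real d ip A = real (the_enat (VC_vectors d ip A))"

definition mean_vec :: "'w measure \<Rightarrow> ('w \<Rightarrow> nat \<Rightarrow> real) \<Rightarrow> (nat \<Rightarrow> real)" where
  "mean_vec M Y = (\<lambda>j. \<integral>\<omega>. Y \<omega> j \<partial>M)"

definition cov_mat :: "'w measure \<Rightarrow> ('w \<Rightarrow> nat \<Rightarrow> real) \<Rightarrow> nat \<Rightarrow> nat \<Rightarrow> real" where
  "cov_mat M Y j k = (\<integral>\<omega>. (Y \<omega> j - mean_vec M Y j) * (Y \<omega> k - mean_vec M Y k) \<partial>M)"

definition nondegenerate_mat :: "nat \<Rightarrow> (nat \<Rightarrow> nat \<Rightarrow> real) \<Rightarrow> bool" where
  "nondegenerate_mat d A \<longleftrightarrow>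
     (\<forall>x\<in>Rd d. (\<forall>j<d. (\<Sum>k<d. A j k * x k) = 0) \<longrightarrow> x = (\<lambda>j. 0))"

definition iid_vectors :: "'w measure \<Rightarrow> nat \<Rightarrow> nat \<Rightarrow> (nat \<Rightarrow> 'w \<Rightarrow> nat \<Rightarrow> real) \<Rightarrow> bool" where
  "iid_vectors M d N Y \<longleftrightarrow>
     (\<forall>i<N. \<forall>\<omega>\<in>space M. Y i \<omega> \<in> Rd d) \<and>
     prob_space.indep_vars M (\<lambda>_. borel) Y {..<N} \<and>
     (\<forall>i<N. distr M borel (Y i) = distr M borel (Y 0))"

definition finite_second_moments :: "'w measure \<Rightarrow> nat \<Rightarrow> ('w \<Rightarrow> nat \<Rightarrow> real) \<Rightarrow> bool" where
  "finite_second_moments M d Y \<longleftrightarrow> (\<forall>j<d. integrable M (\<lambda>\<omega>. (Y \<omega> j)\<^sup>2))"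

text \<open>
  The corrupted index set \<open>S \<omega>\<close> and the values observed there are arbitrary functions of the
  outcome; they need not be measurable.
\<close>

definition contaminated ::
  "'w measure \<Rightarrow> nat \<Rightarrow> nat \<Rightarrow> real \<Rightarrow> (nat \<Rightarrow> 'w \<Rightarrow> nat \<Rightarrow> real) \<Rightarrow> (nat \<Rightarrow> 'w \<Rightarrow> nat \<Rightarrow> real) \<Rightarrow> bool" where
  "contaminated M d N \<epsilon> Y X \<longleftrightarrow>
     (\<forall>i<N. \<forall>\<omega>\<in>space M. X i \<omega> \<in> Rd d) \<and>
     (\<exists>S :: 'w \<Rightarrow> nat set. \<forall>\<omega>\<in>space M. S \<omega> \<subseteq> {..<N} \<and>
        int (card (S \<omega>)) \<le> \<lfloor>\<epsilon> * real N\<rfloor> \<and> (\<forall>i\<in>{..<N} - S \<omega>. X i \<omega> = Y i \<omega>))"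

definition weak_sd ::
  "'w measure \<Rightarrow> ((nat \<Rightarrow> real) \<Rightarrow> (nat \<Rightarrow> real) \<Rightarrow> real) \<Rightarrow> (nat \<Rightarrow> real) set \<Rightarrow> ('w \<Rightarrow> nat \<Rightarrow> real) \<Rightarrow> real" where
  "weak_sd M ip B Y = sqrt (SUP v\<in>B. \<integral>\<omega>. (ip (vminus (Y \<omega>) (mean_vec M Y)) v)\<^sup>2 \<partial>M)"

text \<open>
  Inner-measure form, since the estimator and the contamination need not be measurable: for
  measurable events it is \<open>prob {\<omega>. P \<omega>} \<ge> p\<close>.
\<close>

definition with_prob_at_least :: "'w measure \<Rightarrow> real \<Rightarrow> ('w \<Rightarrow> bool) \<Rightarrow> bool" where
  "with_prob_at_least M p P \<longleftrightarrow> (\<exists>A\<in>sets M. measure M A \<ge> p \<and> (\<forall>\<omega>\<in>A. P \<omega>))"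

end

theory Submission
  imports Defs
begin

text \<open>
  Call a radius \<open>\<eta>\<close> good for a point \<open>u \<in> U\<close> if for every functional \<open>v \<in> B\<close> fewer than half of the
  \<open>K\<close> block means lie farther than \<open>\<eta>\<close> from \<open>u\<close> in the direction \<open>v\<close>. Two points with good radii
  \<open>\<eta>\<close> and \<open>\<theta>\<close> share, for each \<open>v\<close>, a block mean that is close to both; since \<open>B\<close> is norming on
  \<open>U - U\<close>, their distance is at most \<open>\<eta> + \<theta>\<close>. Hence a point that has almost the least good radius is
  within three times any good radius of its owner, and this point is a function of the data alone
  (\<open>median_of_means_estimator\<close>): neither the scale \<open>R\<close> nor the distribution enters. It remains to show
  that a radius of the order of the claimed rate is good for the mean \<open>\<mu>\<close> with high probability.

  Low complexity, \<open>VC \<le> c N\<close>. Take \<open>K\<close> proportional to \<open>VC + log (1/\<delta>) + \<epsilon> N\<close>. By Chebyshev's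
  inequality a clean block mean violates the bound \<open>8 R / sqrt (N / K)\<close> in a fixed direction with
  probability at most \<open>1/64\<close>. That simultaneously in all directions at most a quarter of the blocks
  violate it is a uniform law for a class of half-spaces \<open>{x. r < \<langle>x, v\<rangle>}\<close>. Its VC dimension is at most
  twice that of the homogeneous half-spaces plus one, because differences of paired points no
  longer see the threshold (\<open>vc_le_threshold\<close>). As \<open>K\<close> dominates the VC dimension, the classical
  argument suffices, without chaining: compare with a ghost sample, swap the two at random, and take
  a union bound over the few traces that the Sauer--Shelah lemma leaves (\<open>vc_tail\<close>). The adversary
  spoils at most \<open>\<epsilon> N \<le> K / 8\<close> further blocks.

  High dimension, \<open>U = \<real>\<^sup>d\<close> and \<open>VC > c N\<close>. Now the VC dimension is \<open>d\<close>, and no number of blocks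
  between it and \<open>N\<close> is available. Instead an orthonormal system of coordinates is cut into about \<open>d / n\<close>
  groups of size \<open>n\<close>, a small multiple of \<open>N\<close>, and the estimator above is applied in each group with
  \<open>K = N\<close>. A group contributes a squared error of order \<open>R\<^sup>2\<close>, so by Pythagoras the total is of order
  \<open>R\<^sup>2 d / N\<close>, as required. As \<open>d\<close> may exceed \<open>e\<^sup>N\<close>, some groups can fail, each with probability
  exponentially small in \<open>N\<close>. But even then the squared error in a group is at most of the order of
  a high order statistic of the energies of the observations in that group. This order statistic is
  bounded by a sum over pairs of independent energies, so that it has a finite second moment, of
  order \<open>(n R\<^sup>2)\<^sup>2\<close>; the expected contribution of the failing groups is exponentially small compared
  to \<open>R\<^sup>2 d / N\<close>, and Markov's inequality finishes the proof (\<open>means_are_central_in_groups\<close>).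
\<close>

section \<open>Counting the traces of a class of finite VC dimension\<close>

definition shatters :: "'a set set \<Rightarrow> 'a set \<Rightarrow> bool" where
  "shatters F A \<longleftrightarrow> (\<forall>S\<subseteq>A. \<exists>B\<in>F. B \<inter> A = S)"

text \<open>
  Pajor's form of the Sauer--Shelah lemma. Removing a point \<open>x\<close> from the ground set splits \<open>F\<close> into the
  members \<open>G\<close> that avoid \<open>x\<close> and the traces \<open>H\<close> of those that contain it, and
  \<open>card F = card (G \<union> H) + card (G \<inter> H)\<close>. Sets shattered by \<open>G \<union> H\<close> are shattered by \<open>F\<close>, and those
  shattered by \<open>G \<inter> H\<close> remain so after \<open>x\<close> is added, which gives two disjoint kinds of shattered sets.
\<close>

lemma card_le_shattered:
  assumes "finite X" "F \<subseteq> Pow X"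
  shows "card F \<le> card {A. A \<subseteq> X \<and> shatters F A}"
  using assms
proof (induction X arbitrary: F rule: finite_induct)
  case empty
  show ?case
  proof (cases "F = {}")
    case False
    then have F: "F = {{}}" using empty by auto
    have "{A. A \<subseteq> {} \<and> shatters F A} = {{}}"
      by (auto simp: shatters_def F)
    then show ?thesis by (simp add: F)
  qed simp
next
  case (insert x X)
  define G where "G = {B\<in>F. x \<notin> B}"
  define H where "H = (\<lambda>B. B - {x}) ` {B\<in>F. x \<in> B}"
  define sh where "sh F = {A. A \<subseteq> X \<and> shatters F A}" for F
  have finF: "finite F" using insert.prems insert.hyps(1)
    by (meson finite_Pow_iff finite_insert finite_subset)
  have fin: "finite G" "finite H" using finF by (auto simp: G_def H_def)
  have sub: "G \<subseteq> Pow X" "H \<subseteq> Pow X" using insert.prems by (auto simp: G_def H_def)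
  have Hm: "C \<in> H \<longleftrightarrow> x \<notin> C \<and> insert x C \<in> F" for C
    unfolding H_def by (auto simp: insert_absorb intro!: rev_image_eqI[of "insert x C"])
  have cH: "card H = card {B\<in>F. x \<in> B}"
    unfolding H_def by (rule card_image) (auto simp: inj_on_def)
  have "card F = card (G \<union> {B\<in>F. x \<in> B})" by (rule arg_cong[where f=card]) (auto simp: G_def)
  also have "\<dots> = card G + card H"
    unfolding cH by (rule card_Un_disjoint) (use finF in \<open>auto simp: G_def\<close>)
  also have "\<dots> = card (G \<union> H) + card (G \<inter> H)"
    using card_Un_Int fin by blast
  also have "\<dots> \<le> card (sh (G \<union> H)) + card (sh (G \<inter> H))"
    unfolding sh_def using sub by (intro add_mono insert.IH) auto
  also have "card (sh (G \<inter> H)) = card (Set.insert x ` sh (G \<inter> H))"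
    by (rule card_image[symmetric]) (use insert.hyps in \<open>auto simp: inj_on_def sh_def\<close>)
  also have "card (sh (G \<union> H)) + \<dots> = card (sh (G \<union> H) \<union> Set.insert x ` sh (G \<inter> H))"
    by (rule card_Un_disjoint[symmetric])
       (use insert.hyps in \<open>auto simp: sh_def intro: finite_subset[of _ "Pow X"]\<close>)
  also have "\<dots> \<le> card {A. A \<subseteq> Set.insert x X \<and> shatters F A}"
  proof (rule card_mono)
    show "finite {A. A \<subseteq> Set.insert x X \<and> shatters F A}"
      by (rule finite_subset[of _ "Pow (Set.insert x X)"]) (use insert.hyps in auto)
    have 1: "shatters F A" if A: "A \<subseteq> X" "shatters (G \<union> H) A" for A
      unfolding shatters_def
    proof (intro allI impI)
      fix S assume "S \<subseteq> A"
      then obtain B where B: "B \<in> G \<union> H" "B \<inter> A = S"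
        using A(2) unfolding shatters_def by blast
      have "x \<notin> A" using that insert.hyps by auto
      show "\<exists>B\<in>F. B \<inter> A = S"
      proof (cases "B \<in> G")
        case False
        then have "Set.insert x B \<in> F" using B Hm by auto
        moreover have "Set.insert x B \<inter> A = S" using B \<open>x \<notin> A\<close> by auto
        ultimately show ?thesis by blast
      qed (use B in \<open>auto simp: G_def\<close>)
    qed
    have 2: "shatters F (Set.insert x A)" if A: "A \<subseteq> X" "shatters (G \<inter> H) A" for A
      unfolding shatters_def
    proof (intro allI impI)
      fix S assume S: "S \<subseteq> Set.insert x A"
      have "x \<notin> A" using that insert.hyps by auto
      have "S - {x} \<subseteq> A" using S by auto
      then obtain B where B: "B \<in> G \<inter> H" "B \<inter> A = S - {x}"
        using A(2) unfolding shatters_def by blast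
      have x: "x \<notin> B" "B \<in> F" "Set.insert x B \<in> F" using B Hm by (auto simp: G_def)
      show "\<exists>B\<in>F. B \<inter> Set.insert x A = S"
      proof (cases "x \<in> S")
        case True
        then have "Set.insert x B \<inter> Set.insert x A = S" using B by auto
        then show ?thesis using x by blast
      next
        case False
        then have "B \<inter> Set.insert x A = S" using B x by auto
        then show ?thesis using x by blast
      qed
    qed
    show "sh (G \<union> H) \<union> Set.insert x ` sh (G \<inter> H) \<subseteq> {A. A \<subseteq> Set.insert x X \<and> shatters F A}"
      using 1 2 by (auto simp: sh_def)
  qed
  finally show ?case .
qed

text \<open>
  Weighting a shattered set \<open>A\<close> by \<open>x ^ card A \<ge> x ^ D\<close> and summing over all subsets replaces the usual
  sum of binomial coefficients by a bound that is already exponential in \<open>card X\<close> with a rate close to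
  \<open>0\<close> for small \<open>x\<close>.
\<close>

lemma sauer_shelah:
  fixes x :: real
  assumes "finite X" "F \<subseteq> Pow X" and x: "0 < x" "x \<le> 1"
    and D: "\<And>A. A \<subseteq> X \<Longrightarrow> shatters F A \<Longrightarrow> card A \<le> D"
  shows "real (card F) \<le> (1 + x) ^ card X / x ^ D"
proof -
  let ?Sh = "{A. A \<subseteq> X \<and> shatters F A}"
  have fin: "finite ?Sh" by (rule finite_subset[of _ "Pow X"]) (use assms in auto)
  have "real (card F) * x ^ D \<le> real (card ?Sh) * x ^ D"
    using card_le_shattered[OF assms(1,2)] x by (intro mult_right_mono) auto
  also have "\<dots> = (\<Sum>A\<in>?Sh. x ^ D)" by simp
  also have "\<dots> \<le> (\<Sum>A\<in>?Sh. x ^ card A)"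
    using D x by (intro sum_mono power_decreasing) auto
  also have "\<dots> \<le> (\<Sum>A\<in>Pow X. x ^ card A)"
    using assms by (intro sum_mono2) auto
  also have "\<dots> = (\<Sum>A\<in>Pow X. (\<Prod>i\<in>A. x) * (\<Prod>i\<in>X-A. 1))" by simp
  also have "\<dots> = (\<Prod>i\<in>X. x + 1)"
    using prod_add[OF \<open>finite X\<close>, of "\<lambda>_. x" "\<lambda>_. 1"] by simp
  also have "\<dots> = (1 + x) ^ card X" by (simp add: add.commute)
  finally show ?thesis using x by (simp add: field_simps)
qed

text \<open>
  The case of a fair sign in Hoeffding's lemma, applied to a two-point distribution at distance \<open>2 v\<close>.
\<close>

lemma cosh_le_exp: "exp u + exp (- u) \<le> 2 * exp (u\<^sup>2 / 2)" for u :: real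
proof -
  have pos: "exp v + exp (- v) \<le> 2 * exp (v\<^sup>2 / 2)" if "v \<ge> 0" for v :: real
  proof -
    have "- (2 * v) * (1 / 2) + ln (1 + 1 / 2 * (exp (2 * v) - 1)) \<le> (2 * v)\<^sup>2 / 8"
      using Hoeffdings_lemma_aux[of "2 * v" "1/2"] that by simp
    then have "ln ((1 + exp (2 * v)) / 2) \<le> v + v\<^sup>2 / 2"
      by (simp add: field_simps power2_eq_square)
    moreover have "0 < (1 + exp (2 * v)) / 2" by (simp add: add_pos_pos)
    ultimately have "(1 + exp (2 * v)) / 2 \<le> exp (v + v\<^sup>2 / 2)"
      by (metis exp_le_cancel_iff exp_ln)
    then have "(1 + exp (2 * v)) / 2 * exp (- v) \<le> exp (v + v\<^sup>2 / 2) * exp (- v)"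
      by (intro mult_right_mono) auto
    then show ?thesis
      by (simp add: field_simps flip: exp_add)
  qed
  show ?thesis
    using pos[of u] pos[of "- u"] by (cases "u \<ge> 0") auto
qed

text \<open>
  Hoeffding's inequality for fair signs, in counting form: the exponential moment with parameter \<open>a\<close>,
  which is the optimal one for the level \<open>a K\<close>, factorizes when the sum over all sets \<open>s\<close> is read as an
  expanded product.
\<close>

lemma card_sign_flips:
  fixes c :: "nat \<Rightarrow> real"
  assumes c: "\<And>k. k < K \<Longrightarrow> \<bar>c k\<bar> \<le> 1" and a: "0 \<le> a"
  shows "real (card {s\<in>Pow {..<K}. a * K \<le> (\<Sum>k<K. if k \<in> s then - c k else c k)})
     \<le> 2 ^ K * exp (- (a\<^sup>2 * K / 2))"
proof -
  let ?S = "{s\<in>Pow {..<K}. a * K \<le> (\<Sum>k<K. if k \<in> s then - c k else c k)}"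
  have e: "exp (a * (\<Sum>k<K. if k \<in> s then - c k else c k)) =
      (\<Prod>k\<in>s. exp (a * - c k)) * (\<Prod>k\<in>{..<K} - s. exp (a * c k))" if "s \<in> Pow {..<K}" for s
  proof -
    have "{..<K} = s \<union> ({..<K} - s)" "finite s" using that finite_subset by auto
    then have "(\<Sum>k<K. if k \<in> s then - c k else c k) = (\<Sum>k\<in>s. - c k) + (\<Sum>k\<in>{..<K}-s. c k)"
      by (subst \<open>{..<K} = _\<close>, subst sum.union_disjoint) (auto intro!: sum.cong)
    then show ?thesis
      using \<open>finite s\<close> by (simp add: distrib_left exp_add sum_distrib_left exp_sum flip: sum_negf)
  qed
  have "real (card ?S) * exp (a * (a * K)) = (\<Sum>s\<in>?S. exp (a * (a * K)))" by simp
  also have "\<dots> \<le> (\<Sum>s\<in>?S. exp (a * (\<Sum>k<K. if k \<in> s then - c k else c k)))"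
    using a by (intro sum_mono) (auto intro!: mult_left_mono)
  also have "\<dots> \<le> (\<Sum>s\<in>Pow {..<K}. exp (a * (\<Sum>k<K. if k \<in> s then - c k else c k)))"
    by (rule sum_mono2) auto
  also have "\<dots> = (\<Prod>k<K. exp (a * - c k) + exp (a * c k))"
    by (subst prod_add) (auto simp: e)
  also have "\<dots> \<le> (\<Prod>k<K. 2 * exp (a\<^sup>2 / 2))"
  proof (intro prod_mono conjI)
    fix k assume "k \<in> {..<K}"
    then have "\<bar>a * c k\<bar> \<le> \<bar>a\<bar>" using c[of k] a by (simp add: abs_mult mult_left_le)
    then have "(a * c k)\<^sup>2 \<le> a\<^sup>2" by (metis abs_le_square_iff)
    then show "exp (a * - c k) + exp (a * c k) \<le> 2 * exp (a\<^sup>2 / 2)"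
      using cosh_le_exp[of "a * c k"] by (smt (verit) exp_le_cancel_iff divide_right_mono mult_minus_right)
  qed (auto intro: add_nonneg_nonneg)
  also have "\<dots> = 2 ^ K * exp (a\<^sup>2 * K / 2)"
    by (simp add: power_mult_distrib mult.commute flip: exp_of_nat_mult)
  finally have "real (card ?S) \<le> 2 ^ K * exp (a\<^sup>2 * K / 2) / exp (a * (a * K))"
    by (simp add: field_simps)
  also have "\<dots> = 2 ^ K * exp (a\<^sup>2 * K / 2 - a * (a * K))" by (simp add: exp_diff)
  also have "a\<^sup>2 * K / 2 - a * (a * K) = - (a\<^sup>2 * K / 2)" by (simp add: power2_eq_square field_simps)
  finally show ?thesis .
qed

text \<open>
  The points \<open>x j\<close> need not be assumed distinct: points that realize all patterns are.
\<close>

definition vc_le :: "nat \<Rightarrow> ('v \<Rightarrow> 'x \<Rightarrow> bool) \<Rightarrow> 'v set \<Rightarrow> bool" where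
  "vc_le D h B \<longleftrightarrow> (\<forall>n x. (\<forall>S\<subseteq>{..<n}. \<exists>v\<in>B. \<forall>j<n. h v (x j) \<longleftrightarrow> j \<in> S) \<longrightarrow> n \<le> D)"

lemma vc_leD:
  assumes "vc_le D h B" "\<And>S. S \<subseteq> {..<n} \<Longrightarrow> \<exists>v\<in>B. \<forall>j<n. h v (x j) \<longleftrightarrow> j \<in> S"
  shows "n \<le> D"
  using assms(1)[unfolded vc_le_def, rule_format, of n x, OF assms(2)] .

lemma vc_le_mono:
  assumes "vc_le D h B" "T \<subseteq> B"
  shows "vc_le D h T"
  unfolding vc_le_def
proof (intro allI impI)
  fix n :: nat and x
  assume sh: "\<forall>S\<subseteq>{..<n}. \<exists>v\<in>T. \<forall>j<n. h v (x j) \<longleftrightarrow> j \<in> S"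
  show "n \<le> D"
  proof (rule vc_leD[OF assms(1)])
    fix S assume "S \<subseteq> {..<n}"
    with sh obtain v where "v \<in> T" "\<forall>j<n. h v (x j) \<longleftrightarrow> j \<in> S" by blast
    then show "\<exists>v\<in>B. \<forall>j<n. h v (x j) \<longleftrightarrow> j \<in> S" using assms(2) by blast
  qed
qed

text \<open>
  The number of ways in which the class can split a sample \<open>w\<close>, counted by indices so that repeated
  observations do no harm.
\<close>

lemma card_traces_le:
  fixes x :: real and I :: "nat set"
  assumes vc: "vc_le D h B" and "finite I" and x: "0 < x" "x \<le> 1"
  shows "real (card ((\<lambda>v. {i\<in>I. h v (w i)}) ` B)) \<le> (1 + x) ^ card I / x ^ D"
proof (rule sauer_shelah)
  let ?F = "(\<lambda>v. {i\<in>I. h v (w i)}) ` B"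
  fix A assume A: "A \<subseteq> I" "shatters ?F A"
  then have "finite A" using \<open>finite I\<close> finite_subset by blast
  then obtain b where b: "bij_betw b {..<card A} A"
    using ex_bij_betw_nat_finite by (metis atLeast0LessThan)
  have "\<exists>v\<in>B. \<forall>j<card A. h v (w (b j)) \<longleftrightarrow> j \<in> S" if S: "S \<subseteq> {..<card A}" for S
  proof -
    have "b ` S \<subseteq> A" using b S by (auto simp: bij_betw_def)
    then obtain v where v: "v \<in> B" "{i\<in>I. h v (w i)} \<inter> A = b ` S"
      using A(2) unfolding shatters_def by blast
    have "h v (w (b j)) \<longleftrightarrow> j \<in> S" if "j < card A" for j
    proof -
      have "b j \<in> A" using b that by (auto simp: bij_betw_def)
      then have "h v (w (b j)) \<longleftrightarrow> b j \<in> b ` S" using v A(1) by blast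
      also have "\<dots> \<longleftrightarrow> j \<in> S"
        using b S that by (auto simp: bij_betw_def inj_on_def)
      finally show ?thesis .
    qed
    then show ?thesis using v by blast
  qed
  then show "card A \<le> D" by (rule vc_leD[OF vc])
qed (use assms in auto)

section \<open>Uniform deviations by symmetrization\<close>

definition hits :: "('x \<Rightarrow> bool) \<Rightarrow> nat set \<Rightarrow> (nat \<Rightarrow> 'x) \<Rightarrow> real" where
  "hits P I w = (\<Sum>i\<in>I. if P (w i) then 1 else 0)"

lemma hits_eq_card: "finite I \<Longrightarrow> hits P I w = real (card {i\<in>I. P (w i)})"
  by (simp add: hits_def sum.If_cases Int_def)

text \<open>
  In a double sample, index \<open>k + K\<close> is the ghost of \<open>k < K\<close>; the permutation exchanges \<open>k\<close> with its
  ghost exactly for \<open>k \<in> s\<close>.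
\<close>

definition swap_idx :: "nat \<Rightarrow> nat set \<Rightarrow> nat \<Rightarrow> nat" where
  "swap_idx K s i = (if i < K then if i \<in> s then i + K else i else if i - K \<in> s then i - K else i)"

text \<open>
  Once the double sample is fixed, the condition on \<open>v\<close> depends only on its trace, so few cases
  remain. For one trace, the difference of the hits in the two halves is a sum of \<open>K\<close> terms from
  \<open>{-1, 0, 1}\<close> whose signs are flipped by \<open>s\<close>; it would have to exceed \<open>K / 8 - K / 32 = 3 K / 32\<close>, which
  only an exponentially small fraction of all \<open>s\<close> achieves.
\<close>

lemma card_separating_swaps:
  fixes w :: "nat \<Rightarrow> 'x" and x :: real
  assumes vc: "vc_le D h T" and x: "0 < x" "x \<le> 1" and K: "0 < K"
  shows "real (card {s\<in>Pow {..<K}. \<exists>v\<in>T. real K / 8 < hits (h v) {..<K} (\<lambda>i. w (swap_idx K s i)) \<and>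
      hits (h v) {K..<2*K} (\<lambda>i. w (swap_idx K s i)) < real K / 32})
    \<le> 2 ^ K * exp (- (K / 256)) * ((1 + x) ^ (2 * K) / x ^ D)"
    (is "real (card ?S) \<le> _")
proof -
  define pats where "pats = (\<lambda>v. {i\<in>{..<2*K}. h v (w i)}) ` T"
  define c where "c p k = of_bool (k \<in> p) - (of_bool (k + K \<in> p) :: real)" for p and k :: nat
  define G where "G p = {s\<in>Pow {..<K}. (3/32) * K \<le> (\<Sum>k<K. if k \<in> s then - c p k else c p k)}" for p
  have fp: "finite pats"
    by (rule finite_subset[of _ "Pow {..<2*K}"]) (auto simp: pats_def)
  have "?S \<subseteq> (\<Union>p\<in>pats. G p)"
  proof
    fix s assume s: "s \<in> ?S"
    then obtain v where v: "v \<in> T" "real K / 8 < hits (h v) {..<K} (\<lambda>i. w (swap_idx K s i))"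
      "hits (h v) {K..<2*K} (\<lambda>i. w (swap_idx K s i)) < real K / 32" by blast
    define p where "p = {i\<in>{..<2*K}. h v (w i)}"
    have "hits (h v) {K..<2*K} (\<lambda>i. w (swap_idx K s i))
        = (\<Sum>k<K. if h v (w (swap_idx K s (k + K))) then 1 else 0)"
      unfolding hits_def mult_2
      using sum.shift_bounds_nat_ivl[of "\<lambda>i. if h v (w (swap_idx K s i)) then 1 else 0::real" 0 K K]
      by (simp add: atLeast0LessThan)
    moreover have "(\<Sum>k<K. if k \<in> s then - c p k else c p k)
      = (\<Sum>k<K. (if h v (w (swap_idx K s k)) then 1 else 0)
           - (if h v (w (swap_idx K s (k + K))) then 1 else 0))"
      by (rule sum.cong) (auto simp: c_def p_def swap_idx_def)
    \<comment> \<open>the signed sum is the number of hits in the first half minus that in the second half\<close>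
    ultimately have "(\<Sum>k<K. if k \<in> s then - c p k else c p k) \<ge> (3/32) * K"
      using v by (simp add: sum_subtractf hits_def)
    moreover have "p \<in> pats" using v by (auto simp: p_def pats_def)
    ultimately show "s \<in> (\<Union>p\<in>pats. G p)" using s by (auto simp: G_def)
  qed
  then have "card ?S \<le> card (\<Union>p\<in>pats. G p)"
    by (intro card_mono) (auto simp: fp G_def)
  also have "\<dots> \<le> (\<Sum>p\<in>pats. card (G p))" by (rule card_UN_le[OF fp])
  finally have "real (card ?S) \<le> real (\<Sum>p\<in>pats. card (G p))" by linarith
  also have "\<dots> = (\<Sum>p\<in>pats. real (card (G p)))" by simp
  also have "\<dots> \<le> (\<Sum>p\<in>pats. 2 ^ K * exp (- (K / 256)))"
  proof (rule sum_mono)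
    fix p
    have "real (card (G p)) \<le> 2 ^ K * exp (- ((3/32)\<^sup>2 * K / 2))"
      unfolding G_def by (rule card_sign_flips) (auto simp: c_def)
    also have "\<dots> \<le> 2 ^ K * exp (- (K / 256))"
      by (intro mult_left_mono) (auto simp: power2_eq_square)
    finally show "real (card (G p)) \<le> 2 ^ K * exp (- (K / 256))" .
  qed
  also have "\<dots> = 2 ^ K * exp (- (K / 256)) * real (card pats)" by simp
  also have "\<dots> \<le> 2 ^ K * exp (- (K / 256)) * ((1 + x) ^ (2 * K) / x ^ D)"
    using card_traces_le[OF vc, of "{..<2*K}" x w] x by (intro mult_left_mono) (auto simp: pats_def)
  finally show ?thesis .
qed

definition overhit :: "nat \<Rightarrow> (nat \<Rightarrow> 'x measure) \<Rightarrow> ('v \<Rightarrow> 'x \<Rightarrow> bool) \<Rightarrow> 'v set \<Rightarrow> (nat \<Rightarrow> 'x) set" where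
  "overhit K Q h T = {w\<in>space (PiM {..<K} Q). \<exists>v\<in>T. K / 8 < hits (h v) {..<K} w}"

definition overhit_clean_ghost ::
  "nat \<Rightarrow> (nat \<Rightarrow> 'x measure) \<Rightarrow> ('v \<Rightarrow> 'x \<Rightarrow> bool) \<Rightarrow> 'v set \<Rightarrow> (nat \<Rightarrow> 'x) set" where
  "overhit_clean_ghost K Q h T = {w\<in>space (PiM {..<2*K} Q).
     \<exists>v\<in>T. K / 8 < hits (h v) {..<K} w \<and> hits (h v) {K..<2*K} w < K / 32}"

text \<open>
  The double sample consists of \<open>K\<close> observations with laws \<open>Q 0, \<dots>, Q (K - 1)\<close>, which may differ, and their ghosts; the
  periodicity of \<open>Q\<close> says that a ghost has the law of its observation.
\<close>

context
  fixes K :: nat and Q :: "nat \<Rightarrow> 'x measure" and S :: "'x measure" and h :: "'v \<Rightarrow> 'x \<Rightarrow> bool"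
    and T :: "'v set"
  assumes K: "0 < K"
    and Q: "\<And>i. prob_space (Q i)" and per: "\<And>i. Q (i + K) = Q i"
    and setsQ: "\<And>i. sets (Q i) = sets S"
    and T: "countable T" and meas: "\<And>v. v \<in> T \<Longrightarrow> Measurable.pred S (h v)"
    and p: "\<And>v i. v \<in> T \<Longrightarrow> measure (Q i) {x\<in>space S. h v x} \<le> 1 / 64"
begin

lemma hits_measurable:
  assumes "v \<in> T" "finite I" "I \<subseteq> J"
  shows "hits (h v) I \<in> borel_measurable (PiM J Q)"
proof -
  have "(\<lambda>w. if h v (w i) then 1 else 0 :: real) \<in> borel_measurable (PiM J Q)" if "i \<in> I" for i
  proof -
    have "i \<in> J" using that assms by auto
    have "(\<lambda>w. w i) \<in> measurable (PiM J Q) (Q i)" using \<open>i \<in> J\<close> by simp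
    then have [measurable]: "(\<lambda>w. w i) \<in> measurable (PiM J Q) S"
      by (simp cong: measurable_cong_sets add: setsQ)
    note [measurable] = meas[OF assms(1)]
    show ?thesis by measurable
  qed
  then show ?thesis unfolding hits_def[abs_def] by (intro borel_measurable_sum) auto
qed

text \<open>
  The expected number of hits is at most \<open>K / 64\<close>; Markov's inequality at twice this value.
\<close>

lemma second_half_seldom_hit:
  assumes v: "v \<in> T"
  shows "measure (PiM {K..<2*K} Q) {y\<in>space (PiM {K..<2*K} Q). hits (h v) {K..<2*K} y < K / 32} \<ge> 1/2"
proof -
  let ?P = "PiM {K..<2*K} Q"
  interpret P: prob_space ?P by (rule prob_space_PiM) (rule Q)
  have comp: "(\<lambda>w. w i) \<in> measurable ?P S" if "i \<in> {K..<2*K}" for i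
  proof -
    have "(\<lambda>w. w i) \<in> measurable ?P (Q i)" using that by simp
    then show ?thesis by (simp cong: measurable_cong_sets add: setsQ)
  qed
  note [measurable] = meas[OF v]
  have hm[measurable]: "hits (h v) {K..<2*K} \<in> borel_measurable ?P" using v by (intro hits_measurable) auto
  have int: "integrable ?P (\<lambda>w. if h v (w i) then 1 else 0 :: real)" if "i \<in> {K..<2*K}" for i
  proof -
    note [measurable] = comp[OF that]
    show ?thesis by (rule P.integrable_const_bound[of _ 1]) auto
  qed
  have "(\<integral>w. hits (h v) {K..<2*K} w \<partial>?P) = (\<Sum>i\<in>{K..<2*K}. \<integral>w. (if h v (w i) then 1 else 0) \<partial>?P)"
    unfolding hits_def by (rule Bochner_Integration.integral_sum) (rule int)
  also have "\<dots> \<le> (\<Sum>i\<in>{K..<2*K}. 1 / 64)"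
  proof (rule sum_mono)
    fix i assume i: "i \<in> {K..<2*K}"
    note [measurable] = comp[OF i]
    have spS: "space (Q i) = space S" using setsQ sets_eq_imp_space_eq by blast
    have Ai: "{x\<in>space S. h v x} \<in> sets (Q i)" unfolding setsQ by measurable
    have spP: "w i \<in> space S" if "w \<in> space ?P" for w
      using that i spS by (auto simp: space_PiM PiE_iff)
    have "(\<integral>w. (if h v (w i) then 1 else 0) \<partial>?P) = (\<integral>w. indicator {w\<in>space ?P. h v (w i)} w \<partial>?P)"
      by (rule Bochner_Integration.integral_cong) auto
    also have "\<dots> = measure ?P {w\<in>space ?P. h v (w i)}" by simp
    also have "\<dots> = measure (distr ?P (Q i) (\<lambda>w. w i)) {x\<in>space S. h v x}"
      using i Ai by (subst measure_distr) (auto intro!: arg_cong[where f="measure ?P"] dest: spP)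
    also have "\<dots> = measure (Q i) {x\<in>space S. h v x}"
      by (subst distr_PiM_component) (use Q i in auto)
    also have "\<dots> \<le> 1 / 64" by (rule p[OF v])
    finally show "(\<integral>w. (if h v (w i) then 1 else 0) \<partial>?P) \<le> (1 / 64 :: real)" .
  qed
  also have "\<dots> = K / 64" by simp
  finally have E: "(\<integral>w. hits (h v) {K..<2*K} w \<partial>?P) \<le> K / 64" .
  have "measure ?P {y\<in>space ?P. hits (h v) {K..<2*K} y \<ge> K / 32} \<le> (\<integral>w. hits (h v) {K..<2*K} w \<partial>?P) / (K / 32)"
  proof (rule integral_Markov_inequality_measure[where A = "{}"])
    show "integrable ?P (hits (h v) {K..<2*K})"
      unfolding hits_def[abs_def] by (intro Bochner_Integration.integrable_sum int) auto
  qed (use K in \<open>auto simp: hits_def intro!: sum_nonneg\<close>)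
  also have "\<dots> \<le> (K / 64) / (K / 32)" using E K by (intro divide_right_mono) auto
  also have "\<dots> = 1/2" using K by simp
  finally have 1: "measure ?P {y\<in>space ?P. hits (h v) {K..<2*K} y \<ge> K / 32} \<le> 1/2" .
  have "{y\<in>space ?P. hits (h v) {K..<2*K} y < K / 32} = space ?P - {y\<in>space ?P. hits (h v) {K..<2*K} y \<ge> K / 32}"
    by auto
  then have "measure ?P {y\<in>space ?P. hits (h v) {K..<2*K} y < K / 32}
     = 1 - measure ?P {y\<in>space ?P. hits (h v) {K..<2*K} y \<ge> K / 32}"
    using P.prob_compl[of "{y\<in>space ?P. hits (h v) {K..<2*K} y \<ge> K / 32}"] by simp
  then show ?thesis using 1 by simp
qed

lemma sets_overhit: "(overhit K Q h T) \<in> sets (PiM {..<K} Q)"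
proof -
  have "(overhit K Q h T) = (\<Union>v\<in>T. {w\<in>space (PiM {..<K} Q). K / 8 < hits (h v) {..<K} w})"
    by (auto simp: overhit_def)
  moreover have "{w\<in>space (PiM {..<K} Q). K / 8 < hits (h v) {..<K} w} \<in> sets (PiM {..<K} Q)"
    if "v \<in> T" for v
  proof -
    have [measurable]: "hits (h v) {..<K} \<in> borel_measurable (PiM {..<K} Q)"
      using that by (intro hits_measurable) auto
    show ?thesis by measurable
  qed
  ultimately show ?thesis using T by (auto intro!: sets.countable_UN'')
qed

lemma sets_overhit_clean_ghost: "(overhit_clean_ghost K Q h T) \<in> sets (PiM {..<2*K} Q)"
proof -
  have "(overhit_clean_ghost K Q h T) = (\<Union>v\<in>T. {w\<in>space (PiM {..<2*K} Q). K / 8 < hits (h v) {..<K} w \<and> hits (h v) {K..<2*K} w < K / 32})"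
    by (auto simp: overhit_clean_ghost_def)
  moreover have "{w\<in>space (PiM {..<2*K} Q). K / 8 < hits (h v) {..<K} w \<and> hits (h v) {K..<2*K} w < K / 32} \<in> sets (PiM {..<2*K} Q)"
    if "v \<in> T" for v
  proof -
    have [measurable]: "hits (h v) {..<K} \<in> borel_measurable (PiM {..<2*K} Q)"
      "hits (h v) {K..<2*K} \<in> borel_measurable (PiM {..<2*K} Q)"
      using that by (auto intro!: hits_measurable)
    show ?thesis by measurable
  qed
  ultimately show ?thesis using T by (auto intro!: sets.countable_UN'')
qed

text \<open>
  Suppose that the first half of the double sample over-hits some \<open>v\<close>. The choice of \<open>v\<close> depends on the
  first half only, and the second half is independent of it, so for this \<open>v\<close> the second half is clean
  with probability at least \<open>1/2\<close>. Fubini's theorem turns this into the claim.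
\<close>

lemma ghost_sample:
  "measure (PiM {..<K} Q) (overhit K Q h T) \<le> 2 * measure (PiM {..<2*K} Q) (overhit_clean_ghost K Q h T)"
proof -
  interpret product_sigma_finite Q
    unfolding product_sigma_finite_def by (intro allI prob_space_imp_sigma_finite Q)
  let ?A = "PiM {..<K} Q" and ?B = "PiM {K..<2*K} Q" and ?P = "PiM {..<2*K} Q"
  interpret A: prob_space ?A by (rule prob_space_PiM) (rule Q)
  interpret B: prob_space ?B by (rule prob_space_PiM) (rule Q)
  interpret P: prob_space ?P by (rule prob_space_PiM) (rule Q)
  have un: "{..<K} \<union> {K..<2*K} = {..<2*K}" by auto
  have d: "distr (?A \<Otimes>\<^sub>M ?B) ?P (merge {..<K} {K..<2*K}) = ?P"
    unfolding un[symmetric] by (rule distr_merge) auto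
  have mm[measurable]: "merge {..<K} {K..<2*K} \<in> measurable (?A \<Otimes>\<^sub>M ?B) ?P"
    unfolding un[symmetric] by (rule measurable_merge)
  let ?X = "merge {..<K} {K..<2*K} -` (overhit_clean_ghost K Q h T) \<inter> space (?A \<Otimes>\<^sub>M ?B)"
  have X: "?X \<in> sets (?A \<Otimes>\<^sub>M ?B)" using mm sets_overhit_clean_ghost by (rule measurable_sets)
  have "emeasure ?P (overhit_clean_ghost K Q h T) = emeasure (distr (?A \<Otimes>\<^sub>M ?B) ?P (merge {..<K} {K..<2*K})) (overhit_clean_ghost K Q h T)" by (simp add: d)
  also have "\<dots> = emeasure (?A \<Otimes>\<^sub>M ?B) ?X" by (rule emeasure_distr) (use sets_overhit_clean_ghost mm in auto)
  also have "\<dots> = (\<integral>\<^sup>+x. emeasure ?B (Pair x -` ?X) \<partial>?A)" by (rule B.emeasure_pair_measure_alt[OF X])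
  also have "\<dots> \<ge> (\<integral>\<^sup>+x. ennreal (1/2) * indicator (overhit K Q h T) x \<partial>?A)"
  proof (rule nn_integral_mono)
    fix x assume x: "x \<in> space ?A"
    show "ennreal (1/2) * indicator (overhit K Q h T) x \<le> emeasure ?B (Pair x -` ?X)"
    proof (cases "x \<in> (overhit K Q h T)")
      case True
      then obtain v where v: "v \<in> T" "K / 8 < hits (h v) {..<K} x" by (auto simp: overhit_def)
      let ?Y = "{y\<in>space ?B. hits (h v) {K..<2*K} y < K / 32}"
      have sub: "?Y \<subseteq> Pair x -` ?X"
      proof
        fix y assume y: "y \<in> ?Y"
        let ?m = "merge {..<K} {K..<2*K} (x, y)"
        have "hits (h v) {..<K} ?m = hits (h v) {..<K} x" "hits (h v) {K..<2*K} ?m = hits (h v) {K..<2*K} y"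
          unfolding hits_def by (auto intro!: sum.cong simp: merge_def)
        moreover have xy: "(x, y) \<in> space (?A \<Otimes>\<^sub>M ?B)" using x y by (simp add: space_pair_measure)
        moreover have "?m \<in> space ?P" using measurable_space[OF mm xy] .
        ultimately have "?m \<in> (overhit_clean_ghost K Q h T)" using v y unfolding overhit_clean_ghost_def
          by (intro CollectI conjI bexI[of _ v]) simp_all
        then show "y \<in> Pair x -` ?X" using xy by simp
      qed
      have "ennreal (1/2) \<le> ennreal (measure ?B ?Y)"
        using second_half_seldom_hit[OF v(1)] by (intro ennreal_leI) simp
      also have "\<dots> = emeasure ?B ?Y" by (rule B.emeasure_eq_measure[symmetric])
      also have "\<dots> \<le> emeasure ?B (Pair x -` ?X)"
        by (rule emeasure_mono[OF sub]) (rule sets_Pair1[OF X])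
      finally show ?thesis using True by simp
    qed simp
  qed
  also have "(\<integral>\<^sup>+x. ennreal (1/2) * indicator (overhit K Q h T) x \<partial>?A) = ennreal (1/2) * emeasure ?A (overhit K Q h T)"
    by (rule nn_integral_cmult_indicator) (rule sets_overhit)
  finally have "ennreal (1/2) * ennreal (measure ?A (overhit K Q h T)) \<le> ennreal (measure ?P (overhit_clean_ghost K Q h T))"
    by (simp only: A.emeasure_eq_measure P.emeasure_eq_measure)
  then have "ennreal (1/2 * measure ?A (overhit K Q h T)) \<le> ennreal (measure ?P (overhit_clean_ghost K Q h T))"
    by (subst ennreal_mult) auto
  then have "1/2 * measure ?A (overhit K Q h T) \<le> measure ?P (overhit_clean_ghost K Q h T)"
    by (rule ennreal_le_iff[THEN iffD1, rotated]) simp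
  then show ?thesis by simp
qed

lemma swap_invariant:
  assumes s: "s \<subseteq> {..<K}"
  shows "distr (PiM {..<2*K} Q) (PiM {..<2*K} Q) (\<lambda>w. \<lambda>n\<in>{..<2*K}. w (swap_idx K s n)) = PiM {..<2*K} Q"
proof -
  have "Q (swap_idx K s i) = Q i" for i
    using per[of i] per[of "i - K"] s unfolding swap_idx_def by auto
  moreover have "inj_on (swap_idx K s) {..<2*K}" "swap_idx K s \<in> {..<2*K} \<rightarrow> {..<2*K}"
    using s by (auto simp: inj_on_def swap_idx_def split: if_splits)
  ultimately show ?thesis
    using distr_PiM_reindex[of "{..<2*K}" Q "swap_idx K s" "{..<2*K}"] Q by simp
qed

text \<open>
  Every swap preserves the law of the double sample. Averaging over all \<open>2 ^ K\<close> swaps therefore bounds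
  the probability by the largest fraction of swaps, over all fixed double samples, that separate the
  two halves.
\<close>

lemma overhit_clean_ghost_bound:
  assumes vc: "vc_le D h T" and x: "0 < x" "x \<le> (1::real)"
  shows "measure (PiM {..<2*K} Q) (overhit_clean_ghost K Q h T) \<le> exp (- (K / 256)) * ((1 + x) ^ (2 * K) / x ^ D)"
proof -
  let ?P = "PiM {..<2*K} Q"
  interpret P: prob_space ?P by (rule prob_space_PiM) (rule Q)
  define \<tau> where "\<tau> s w = (\<lambda>n\<in>{..<2*K}. w (swap_idx K s n))" for s and w :: "nat \<Rightarrow> 'x"
  have "(\<lambda>w. \<lambda>n\<in>{..<2*K}. w (swap_idx K s n)) \<in> measurable ?P ?P" if "s \<subseteq> {..<K}" for s
  proof (rule measurable_restrict)
    fix n assume "n \<in> {..<2*K}"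
    then have "swap_idx K s n \<in> {..<2*K}" using that by (auto simp: swap_idx_def)
    then have "(\<lambda>w. w (swap_idx K s n)) \<in> measurable ?P (Q (swap_idx K s n))" by simp
    then show "(\<lambda>w. w (swap_idx K s n)) \<in> measurable ?P (Q n)"
      by (simp cong: measurable_cong_sets add: setsQ)
  qed
  then have \<tau>m: "\<tau> s \<in> measurable ?P ?P" if "s \<subseteq> {..<K}" for s
    using that by (simp add: \<tau>_def[abs_def])
  let ?V = "\<lambda>s. \<tau> s -` (overhit_clean_ghost K Q h T) \<inter> space ?P"
  have V: "?V s \<in> sets ?P" if "s \<subseteq> {..<K}" for s
    using \<tau>m[OF that] sets_overhit_clean_ghost by (rule measurable_sets)
  have eqm: "measure ?P (?V s) = measure ?P (overhit_clean_ghost K Q h T)" if "s \<subseteq> {..<K}" for s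
  proof -
    have "measure ?P (overhit_clean_ghost K Q h T) = measure (distr ?P ?P (\<tau> s)) (overhit_clean_ghost K Q h T)"
      using swap_invariant[OF that] by (simp add: \<tau>_def[abs_def])
    also have "\<dots> = measure ?P (?V s)" by (rule measure_distr[OF \<tau>m[OF that] sets_overhit_clean_ghost])
    finally show ?thesis by simp
  qed
  let ?b = "2 ^ K * exp (- (K / 256)) * ((1 + x) ^ (2 * K) / x ^ D)"
  have "2 ^ K * measure ?P (overhit_clean_ghost K Q h T) = (\<Sum>s\<in>Pow {..<K}. measure ?P (?V s))"
    by (simp add: eqm card_Pow)
  also have "\<dots> = (\<Sum>s\<in>Pow {..<K}. \<integral>w. indicator (?V s) w \<partial>?P)"
    by (intro sum.cong) auto
  also have "\<dots> = (\<integral>w. (\<Sum>s\<in>Pow {..<K}. indicator (?V s) w) \<partial>?P)"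
    by (rule Bochner_Integration.integral_sum[symmetric]) (use V in \<open>auto simp: P.emeasure_eq_measure\<close>)
  also have "\<dots> \<le> (\<integral>w. ?b \<partial>?P)"
  proof (rule integral_mono)
    fix w assume w: "w \<in> space ?P"
    have "(\<Sum>s\<in>Pow {..<K}. indicator (?V s) w) = real (card {s\<in>Pow {..<K}. w \<in> ?V s})"
      by (simp add: indicator_def sum.If_cases Int_def)
    also have "\<dots> \<le> real (card {s\<in>Pow {..<K}. \<exists>v\<in>T. real K / 8 < hits (h v) {..<K} (\<lambda>i. w (swap_idx K s i)) \<and>
      hits (h v) {K..<2*K} (\<lambda>i. w (swap_idx K s i)) < real K / 32})"
    proof (intro of_nat_mono card_mono)
      have "hits P {..<K} (\<tau> s w) = hits P {..<K} (\<lambda>i. w (swap_idx K s i))"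
        "hits P {K..<2*K} (\<tau> s w) = hits P {K..<2*K} (\<lambda>i. w (swap_idx K s i))" for P s
        unfolding hits_def by (auto intro!: sum.cong simp: \<tau>_def)
      then show "{s\<in>Pow {..<K}. w \<in> ?V s} \<subseteq> {s\<in>Pow {..<K}. \<exists>v\<in>T. real K / 8 < hits (h v) {..<K} (\<lambda>i. w (swap_idx K s i)) \<and>
      hits (h v) {K..<2*K} (\<lambda>i. w (swap_idx K s i)) < real K / 32}"
        by (auto simp: overhit_clean_ghost_def)
    qed auto
    also have "\<dots> \<le> ?b" by (rule card_separating_swaps[OF vc x K])
    finally show "(\<Sum>s\<in>Pow {..<K}. indicator (?V s) w) \<le> ?b" .
  qed (use V in \<open>auto simp: P.emeasure_eq_measure intro!: Bochner_Integration.integrable_sum\<close>)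
  also have "\<dots> = ?b" by (simp add: P.prob_space)
  finally have "2 ^ K * measure ?P (overhit_clean_ghost K Q h T) \<le> 2 ^ K * (exp (- (K / 256)) * ((1 + x) ^ (2 * K) / x ^ D))"
    by (simp only: mult.assoc)
  then show ?thesis by (rule mult_left_le_imp_le) simp
qed

text \<open>
  The parameter \<open>x = 1/2048\<close> in the Sauer--Shelah bound makes the growth \<open>(1 + x) ^ (2 K) \<le> exp (K / 1024)\<close>
  a quarter of the gain \<open>exp (- K / 256)\<close> in the exponent.
\<close>

lemma vc_tail_PiM:
  assumes vc: "vc_le D h T"
  shows "measure (PiM {..<K} Q) (overhit K Q h T) \<le> 2 * exp (9 * real D - 3 * K / 1024)"
proof -
  have "(1 + 1/2048 :: real) ^ (2 * K) \<le> exp (1/2048) ^ (2 * K)"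
    by (rule power_mono[OF exp_ge_add_one_self]) simp
  also have "\<dots> = exp (K / 1024)" by (simp flip: exp_of_nat_mult)
  finally have 1: "(1 + 1/2048 :: real) ^ (2 * K) \<le> exp (K / 1024)" .
  have "(2048::real) = 2 ^ 11" by simp
  also have "\<dots> \<le> exp 9"
  proof -
    have "(2::real) \<le> exp (9/11)"
      using exp_lower_Taylor_quadratic[of "9/11::real"] by (simp add: power2_eq_square field_simps)
    then have "(2::real) ^ 11 \<le> exp (9/11) ^ 11" by (rule power_mono) auto
    then show ?thesis by (simp flip: exp_of_nat_mult)
  qed
  finally have "(2048::real) ^ D \<le> exp 9 ^ D" by (intro power_mono) auto
  then have 2: "(2048::real) ^ D \<le> exp (9 * real D)" by (simp add: mult.commute flip: exp_of_nat_mult)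
  have "measure (PiM {..<K} Q) (overhit K Q h T) \<le> 2 * (exp (- (K / 256)) * ((1 + 1/2048) ^ (2 * K) / (1/2048) ^ D))"
    using ghost_sample overhit_clean_ghost_bound[OF vc, of "1/2048"] by simp
  also have "\<dots> = 2 * (exp (- (K / 256)) * ((1 + 1/2048) ^ (2 * K) * 2048 ^ D))"
    by (simp add: power_divide)
  also have "\<dots> \<le> 2 * (exp (- (K / 256)) * (exp (K / 1024) * exp (9 * real D)))"
    using 1 2 by (intro mult_left_mono mult_mono) auto
  also have "\<dots> = 2 * exp (9 * real D - 3 * K / 1024)"
    by (simp flip: exp_add)
  finally show ?thesis .
qed

end

section \<open>Half-spaces of a coordinate space\<close>

definition lin :: "nat set \<Rightarrow> (nat \<Rightarrow> real) \<Rightarrow> (nat \<Rightarrow> real) \<Rightarrow> real" where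
  "lin g v x = (\<Sum>j\<in>g. x j * v j)"

lemma lin_diff: "lin g v (\<lambda>j. x j - y j) = lin g v x - lin g v y"
  by (simp add: lin_def left_diff_distrib sum_subtractf)

lemma lin_minus: "lin g v (\<lambda>j. - x j) = - lin g v x"
  by (simp add: lin_def sum_negf)

lemma lin_cmul: "lin g v (\<lambda>j. a * x j) = a * lin g v x"
  by (simp add: lin_def sum_distrib_left mult.assoc)

lemma lin_sum: "lin g v (\<lambda>j. \<Sum>i\<in>I. x i j) = (\<Sum>i\<in>I. lin g v (x i))"
  unfolding lin_def by (simp add: sum_distrib_right, rule sum.swap)

lemma lin_le_L2: "\<bar>lin g v x\<bar> \<le> L2_set x g * L2_set v g"
proof -
  have "\<bar>lin g v x\<bar> \<le> (\<Sum>j\<in>g. \<bar>x j\<bar> * \<bar>v j\<bar>)"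
    unfolding lin_def by (rule order_trans[OF sum_abs]) (simp add: abs_mult)
  also have "\<dots> \<le> L2_set x g * L2_set v g" by (rule L2_set_mult_ineq)
  finally show ?thesis .
qed

text \<open>
  Gaussian elimination of one coordinate \<open>l\<close> at a time, with pivot \<open>q\<close>.
\<close>

lemma linear_dependence:
  fixes w :: "'i \<Rightarrow> nat \<Rightarrow> real"
  assumes "finite g" "finite I" "card g < card I"
  shows "\<exists>a. (\<exists>i\<in>I. a i \<noteq> 0) \<and> (\<forall>j\<in>g. (\<Sum>i\<in>I. a i * w i j) = 0)"
  using assms
proof (induction g arbitrary: I w rule: finite_induct)
  case empty
  then have "I \<noteq> {}" by auto
  then show ?case by (intro exI[of _ "\<lambda>_. 1"]) auto
next
  case (insert l g)
  show ?case
  proof (cases "\<forall>i\<in>I. w i l = 0")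
    case True
    have "card g < card I" using insert by simp
    from insert.IH[OF insert.prems(1) this, of w] obtain a where
      "\<exists>i\<in>I. a i \<noteq> 0" "\<forall>j\<in>g. (\<Sum>i\<in>I. a i * w i j) = 0" by blast
    then show ?thesis using True by (intro exI[of _ a]) auto
  next
    case False
    then obtain q where q: "q \<in> I" "w q l \<noteq> 0" by blast
    define u where "u i j = w i j - w i l / w q l * w q j" for i j
    have "card g < card (I - {q})" using insert q by simp
    from insert.IH[OF _ this, of u] insert.prems(1) obtain a where
      a: "\<exists>i\<in>I-{q}. a i \<noteq> 0" "\<forall>j\<in>g. (\<Sum>i\<in>I-{q}. a i * u i j) = 0" by auto
    define b where "b i = (if i = q then - (\<Sum>i\<in>I-{q}. a i * w i l) / w q l else a i)" for i
    have s: "(\<Sum>i\<in>I. b i * w i j) = b q * w q j + (\<Sum>i\<in>I-{q}. a i * w i j)" for j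
      using insert.prems(1) q by (subst sum.remove[of _ q]) (auto simp: b_def)
    have "(\<Sum>i\<in>I. b i * w i j) = 0" if "j \<in> insert l g" for j
    proof (cases "j = l")
      case True
      then show ?thesis using q unfolding s by (simp add: b_def)
    next
      case False
      then have "(\<Sum>i\<in>I-{q}. a i * u i j) = 0" using a that by auto
      then have "(\<Sum>i\<in>I-{q}. a i * w i j) = (\<Sum>i\<in>I-{q}. a i * w i l) / w q l * w q j"
        by (simp add: u_def right_diff_distrib sum_subtractf sum_distrib_right sum_divide_distrib mult.assoc)
      then show ?thesis unfolding s by (simp add: b_def)
    qed
    moreover have "\<exists>i\<in>I. b i \<noteq> 0" using a(1) by (auto simp: b_def)
    ultimately show ?thesis by blast
  qed
qed

text \<open>
  More points than coordinates satisfy a linear relation, and after a change of sign one of its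
  coefficients is negative. No \<open>v\<close> can then be nonnegative exactly on the points whose coefficient is
  nonnegative, since the relation would have a positive value.
\<close>

lemma vc_le_halfspaces:
  assumes "finite g"
  shows "vc_le (card g) (\<lambda>v x. 0 \<le> lin g v x) B"
  unfolding vc_le_def
proof (intro allI impI, rule ccontr)
  fix n :: nat and x :: "nat \<Rightarrow> nat \<Rightarrow> real"
  assume sh: "\<forall>S\<subseteq>{..<n}. \<exists>v\<in>B. \<forall>j<n. 0 \<le> lin g v (x j) \<longleftrightarrow> j \<in> S" and "\<not> n \<le> card g"
  then obtain a where a: "\<exists>i<n. a i \<noteq> 0" "\<forall>j\<in>g. (\<Sum>i<n. a i * x i j) = 0"
    using linear_dependence[OF assms, of "{..<n}" x] by auto
  have neg: False if b: "\<exists>i<n. b i < 0" "\<forall>j\<in>g. (\<Sum>i<n. b i * x i j) = 0" for b :: "nat \<Rightarrow> real"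
  proof -
    have "{i. i < n \<and> 0 \<le> b i} \<subseteq> {..<n}" by auto
    with sh obtain v where v: "\<forall>j<n. 0 \<le> lin g v (x j) \<longleftrightarrow> j \<in> {i. i < n \<and> 0 \<le> b i}" by blast
    have "(\<Sum>i<n. b i * lin g v (x i)) = lin g v (\<lambda>j. \<Sum>i<n. b i * x i j)"
      by (simp add: lin_sum lin_cmul)
    also have "\<dots> = 0" using b(2) by (simp add: lin_def)
    finally have 0: "(\<Sum>i<n. b i * lin g v (x i)) = 0" .
    have nn: "0 \<le> b i * lin g v (x i)" if "i < n" for i
      using v that by (cases "0 \<le> b i") (auto simp: mult_nonneg_nonneg mult_nonpos_nonpos)
    obtain i where i: "i < n" "b i < 0" using b by blast
    then have "lin g v (x i) < 0" using v by (auto simp: not_le[symmetric])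
    then have "0 < b i * lin g v (x i)" using i by (simp add: mult_neg_neg)
    also have "\<dots> \<le> (\<Sum>i<n. b i * lin g v (x i))"
      by (rule member_le_sum) (use nn i in auto)
    finally show False using 0 by simp
  qed
  obtain i where i: "i < n" "a i \<noteq> 0" using a by blast
  show False
  proof (cases "a i < 0")
    case True
    then show ?thesis using neg[of a] a(2) i by blast
  next
    case False
    then have "\<exists>i<n. - a i < 0" using i by (intro exI[of _ i]) auto
    then show ?thesis using neg[of "\<lambda>i. - a i"] a(2) by (simp add: sum_negf)
  qed
qed

text \<open>
  If \<open>v\<close> lies above the threshold at exactly one of two points, then the sign of \<open>v\<close> at their
  difference tells at which one. So points shattered with the threshold \<open>r\<close> give half as many
  differences shattered without it, by using only patterns that separate each pair.
\<close>

lemma vc_le_threshold: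
  assumes vc: "vc_le V (\<lambda>v x. 0 \<le> lin g v x) B"
  shows "vc_le (2 * V + 1) (\<lambda>v x. r < lin g v x) B"
  unfolding vc_le_def
proof (intro allI impI)
  fix n :: nat and x :: "nat \<Rightarrow> nat \<Rightarrow> real"
  assume sh: "\<forall>S\<subseteq>{..<n}. \<exists>v\<in>B. \<forall>j<n. r < lin g v (x j) \<longleftrightarrow> j \<in> S"
  have "n div 2 \<le> V"
  proof (rule vc_leD[OF vc, where x = "\<lambda>i j. x (2 * i) j - x (2 * i + 1) j"])
    fix S :: "nat set" assume S: "S \<subseteq> {..<n div 2}"
    define S' where "S' = (\<lambda>i. 2 * i) ` S \<union> (\<lambda>i. 2 * i + 1) ` ({..<n div 2} - S)"
    \<comment> \<open>in each pair \<open>{2 i, 2 i + 1}\<close> exactly one index belongs to \<open>S'\<close>, the even one iff \<open>i \<in> S\<close>\<close>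
    have "S' \<subseteq> {..<n}" using S by (auto simp: S'_def)
    with sh obtain v where v: "v \<in> B" "\<And>j. j < n \<Longrightarrow> r < lin g v (x j) \<longleftrightarrow> j \<in> S'" by blast
    have "0 \<le> lin g v (\<lambda>j. x (2 * i) j - x (2 * i + 1) j) \<longleftrightarrow> i \<in> S" if i: "i < n div 2" for i
    proof -
      have lt: "2 * i < n" "2 * i + 1 < n" using i by auto
      have m: "2 * i \<in> S' \<longleftrightarrow> i \<in> S" "2 * i + 1 \<in> S' \<longleftrightarrow> i \<notin> S"
        using i by (auto simp: S'_def) presburger+
      show ?thesis using v(2)[OF lt(1)] v(2)[OF lt(2)] m by (auto simp: lin_diff)
    qed
    then show "\<exists>v\<in>B. \<forall>i<n div 2. 0 \<le> lin g v (\<lambda>j. x (2 * i) j - x (2 * i + 1) j) \<longleftrightarrow> i \<in> S"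
      using v by blast
  qed
  then show "n \<le> 2 * V + 1" by linarith
qed

section \<open>Orthonormal coordinates and dual sets\<close>

lemma Rd_iff: "x \<in> Rd d \<longleftrightarrow> (\<forall>i\<ge>d. x i = 0)"
  by (simp add: topspace_Euclidean_space)

lemma Rd_simps [simp]:
  "(\<lambda>j. 0) \<in> Rd d"
  "x \<in> Rd d \<Longrightarrow> y \<in> Rd d \<Longrightarrow> (\<lambda>j. x j + y j) \<in> Rd d"
  "x \<in> Rd d \<Longrightarrow> y \<in> Rd d \<Longrightarrow> (\<lambda>j. x j - y j) \<in> Rd d"
  "x \<in> Rd d \<Longrightarrow> (\<lambda>j. a * x j) \<in> Rd d"
  "(\<And>i. i \<in> I \<Longrightarrow> z i \<in> Rd d) \<Longrightarrow> (\<lambda>j. \<Sum>i\<in>I. z i j) \<in> Rd d"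
  by (auto simp: Rd_iff)

lemma Rd_mono: "x \<in> Rd k \<Longrightarrow> k \<le> d \<Longrightarrow> x \<in> Rd d"
  by (auto simp: Rd_iff)

text \<open>
  Counting all \<open>2 ^ n\<close> patterns, as the definition of \<^const>\<open>VC\<close> does, is the same as realizing each of them.
\<close>

lemma all_patterns_iff:
  "(\<forall>S\<subseteq>{..<n}. \<exists>f\<in>F. \<forall>j<n. f (xs ! j) \<longleftrightarrow> j \<in> S) \<longleftrightarrow> card ((\<lambda>f. map f xs) ` F) = 2 ^ n"
  if len: "length xs = n"
proof -
  let ?L = "{bs::bool list. length bs = n}"
  have fin: "finite ?L" and cL: "card ?L = 2 ^ n"
    using finite_lists_length_eq[of "UNIV::bool set" n] card_lists_length_eq[of "UNIV::bool set" n]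
    by simp_all
  have sub: "(\<lambda>f. map f xs) ` F \<subseteq> ?L" using len by auto
  show ?thesis
  proof
    assume sh: "\<forall>S\<subseteq>{..<n}. \<exists>f\<in>F. \<forall>j<n. f (xs ! j) \<longleftrightarrow> j \<in> S"
    have "?L \<subseteq> (\<lambda>f. map f xs) ` F"
    proof
      fix bs assume bs: "bs \<in> ?L"
      have "{j. j < n \<and> bs ! j} \<subseteq> {..<n}" by auto
      with sh obtain f where "f \<in> F" "\<forall>j<n. f (xs ! j) \<longleftrightarrow> j \<in> {j. j < n \<and> bs ! j}" by blast
      then have "bs = map f xs" using bs len by (auto intro!: nth_equalityI)
      then show "bs \<in> (\<lambda>f. map f xs) ` F" using \<open>f \<in> F\<close> by blast
    qed
    then show "card ((\<lambda>f. map f xs) ` F) = 2 ^ n" using sub cL by (metis subset_antisym)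
  next
    assume "card ((\<lambda>f. map f xs) ` F) = 2 ^ n"
    then have eq: "(\<lambda>f. map f xs) ` F = ?L" using card_subset_eq[OF fin sub] cL by simp
    show "\<forall>S\<subseteq>{..<n}. \<exists>f\<in>F. \<forall>j<n. f (xs ! j) \<longleftrightarrow> j \<in> S"
    proof (intro allI impI)
      fix S :: "nat set"
      have "map (\<lambda>j. j \<in> S) [0..<n] \<in> (\<lambda>f. map f xs) ` F" unfolding eq by simp
      then obtain f where f: "f \<in> F" "map (\<lambda>j. j \<in> S) [0..<n] = map f xs" by blast
      have "f (xs ! j) \<longleftrightarrow> j \<in> S" if "j < n" for j
        using arg_cong[OF f(2), of "\<lambda>l. l ! j"] that len by simp
      then show "\<exists>f\<in>F. \<forall>j<n. f (xs ! j) \<longleftrightarrow> j \<in> S" using f(1) by blast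
    qed
  qed
qed

locale inner_product =
  fixes d :: nat and ip :: "(nat \<Rightarrow> real) \<Rightarrow> (nat \<Rightarrow> real) \<Rightarrow> real"
  assumes ip_on: "inner_product_on d ip"
begin

lemma ip_commute: "x \<in> Rd d \<Longrightarrow> y \<in> Rd d \<Longrightarrow> ip x y = ip y x"
  using ip_on unfolding inner_product_on_def by blast
lemma ip_add_left: "x \<in> Rd d \<Longrightarrow> y \<in> Rd d \<Longrightarrow> z \<in> Rd d \<Longrightarrow> ip (\<lambda>j. x j + y j) z = ip x z + ip y z"
  using ip_on unfolding inner_product_on_def by blast
lemma ip_scale_left: "x \<in> Rd d \<Longrightarrow> y \<in> Rd d \<Longrightarrow> ip (\<lambda>j. a * x j) y = a * ip x y"
  using ip_on unfolding inner_product_on_def by blast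
lemma ip_pos: "x \<in> Rd d \<Longrightarrow> x \<noteq> (\<lambda>j. 0) \<Longrightarrow> 0 < ip x x"
  using ip_on unfolding inner_product_on_def by blast

lemma ip_zero_left: "y \<in> Rd d \<Longrightarrow> ip (\<lambda>j. 0) y = 0"
  using ip_scale_left[of "\<lambda>j. 0" y 0] by simp

lemma ip_diff_left: "x \<in> Rd d \<Longrightarrow> y \<in> Rd d \<Longrightarrow> z \<in> Rd d \<Longrightarrow> ip (\<lambda>j. x j - y j) z = ip x z - ip y z"
  using ip_add_left[of x "\<lambda>j. - 1 * y j" z] ip_scale_left[of y z "- 1"] Rd_simps(4)[of y d "- 1"]
  by (simp add: Rd_iff)

lemma ip_sum_left:
  assumes "finite I" "\<And>i. i \<in> I \<Longrightarrow> x i \<in> Rd d" "z \<in> Rd d"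
  shows "ip (\<lambda>j. \<Sum>i\<in>I. c i * x i j) z = (\<Sum>i\<in>I. c i * ip (x i) z)"
  using assms(1,2)
proof (induction I rule: finite_induct)
  case empty
  then show ?case using ip_zero_left[OF assms(3)] by simp
next
  case (insert i I)
  have "ip (\<lambda>j. c i * x i j + (\<Sum>i\<in>I. c i * x i j)) z = ip (\<lambda>j. c i * x i j) z + ip (\<lambda>j. \<Sum>i\<in>I. c i * x i j) z"
    using insert assms(3) by (intro ip_add_left) auto
  then show ?case using insert assms(3) by (simp add: ip_scale_left)
qed

text \<open>
  Gram--Schmidt, one coordinate of \<open>\<real>\<^sup>d\<close> at a time. The residual \<open>w\<close> of the \<open>k\<close>-th unit vector cannot
  vanish, as its \<open>k\<close>-th coordinate is still \<open>1\<close>.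
\<close>

lemma orthonormal_prefix:
  "k \<le> d \<Longrightarrow> \<exists>e. (\<forall>j<k. e j \<in> Rd k) \<and> (\<forall>j<k. \<forall>l<k. ip (e j) (e l) = of_bool (j = l)) \<and>
     (\<forall>x\<in>Rd k. x = (\<lambda>i. \<Sum>j<k. ip x (e j) * e j i))"
proof (induction k)
  case 0
  show ?case by (auto simp: Rd_iff)
next
  case (Suc k)
  then obtain e where E: "\<forall>j<k. e j \<in> Rd k" "\<forall>j<k. \<forall>l<k. ip (e j) (e l) = of_bool (j = l)"
    "\<forall>x\<in>Rd k. x = (\<lambda>i. \<Sum>j<k. ip x (e j) * e j i)" by force
  have e: "e j \<in> Rd k" if "j < k" for j using E(1) that by blast
  have e_ip: "ip (e j) (e l) = of_bool (j = l)" if "j < k" "l < k" for j l using E(2) that by blast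
  have e_expand: "x = (\<lambda>i. \<Sum>j<k. ip x (e j) * e j i)" if "x \<in> Rd k" for x
    using that by (rule E(3)[rule_format])
  have up: "x \<in> Rd d" if "x \<in> Rd k" for x using that Suc.prems by (auto intro: Rd_mono)
  have up': "x \<in> Rd d" if "x \<in> Rd (Suc k)" for x using that Suc.prems by (auto intro: Rd_mono)
  define b :: "nat \<Rightarrow> real" where "b = (\<lambda>i. if i = k then 1 else 0)"
  have b: "b \<in> Rd (Suc k)" by (auto simp: b_def Rd_iff)
  define w where "w = (\<lambda>i. b i - (\<Sum>j<k. ip b (e j) * e j i))"
  have s: "(\<lambda>i. \<Sum>j<k. ip b (e j) * e j i) \<in> Rd k" using e by (intro Rd_simps) auto
  have w: "w \<in> Rd (Suc k)" unfolding w_def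
    using b s by (intro Rd_simps(3)) (auto intro: Rd_mono)
  have wk: "w k = 1" using s by (auto simp: w_def b_def Rd_iff)
  have we: "ip w (e l) = 0" if "l < k" for l
  proof -
    have "ip w (e l) = ip b (e l) - ip (\<lambda>i. \<Sum>j<k. ip b (e j) * e j i) (e l)"
      unfolding w_def by (rule ip_diff_left[OF up'[OF b] up[OF s] up[OF e[OF that]]])
    also have "ip (\<lambda>i. \<Sum>j<k. ip b (e j) * e j i) (e l) = (\<Sum>j<k. ip b (e j) * ip (e j) (e l))"
      by (rule ip_sum_left) (use e up that in auto)
    also have "(\<Sum>j<k. ip b (e j) * ip (e j) (e l)) = (\<Sum>j<k. if j = l then ip b (e j) else 0)"
      using that e_ip by (intro sum.cong) auto
    finally show ?thesis using that by simp
  qed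
  have "w \<noteq> (\<lambda>j. 0)" using wk by (metis zero_neq_one)
  then have pos: "0 < ip w w" using ip_pos up' w by blast
  define n where "n = sqrt (ip w w)"
  have n: "n > 0" "n * n = ip w w" using pos by (auto simp: n_def)
  define f where "f = (\<lambda>i. (1 / n) * w i)"
  have f: "f \<in> Rd (Suc k)" unfolding f_def using w by (rule Rd_simps)
  have fip: "ip f u = (1 / n) * ip w u" if "u \<in> Rd d" for u
    unfolding f_def by (rule ip_scale_left[OF up'[OF w] that])
  have wf: "ip w f = n"
    unfolding ip_commute[OF up'[OF w] up'[OF f]] fip[OF up'[OF w]] n(2)[symmetric] using n(1) by simp
  have ff: "ip f f = 1"
    unfolding fip[OF up'[OF f]] wf using n(1) by simp
  have fe: "ip f (e l) = 0" if "l < k" for l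
    using fip[OF up[OF e[OF that]]] we[OF that] by simp
  have ef: "ip (e l) f = 0" if "l < k" for l
    using fe[OF that] ip_commute[of f "e l"] f e[OF that] up up' by simp
  define e' where "e' = e(k := f)"
  have "x = (\<lambda>i. \<Sum>j<Suc k. ip x (e' j) * e' j i)" if x: "x \<in> Rd (Suc k)" for x
  proof -
    \<comment> \<open>subtracting a multiple of \<open>w\<close> removes the \<open>k\<close>-th coordinate\<close>
    define y where "y = (\<lambda>i. x i - x k * w i)"
    have y: "y \<in> Rd k"
      unfolding Rd_iff
    proof (intro allI impI)
      fix i assume "k \<le> i"
      then show "y i = 0" using x w wk by (cases "i = k") (auto simp: y_def Rd_iff)
    qed
    have xy: "x = (\<lambda>i. y i + x k * w i)" by (auto simp: y_def)
    have xe: "ip x (e l) = ip y (e l)" if "l < k" for l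
      using we[OF that] y w e[OF that]
      by (subst xy, subst ip_add_left) (auto simp: up up' ip_scale_left)
    have "ip y f = (\<Sum>j<k. ip y (e j) * ip (e j) f)"
      by (subst e_expand[OF y], subst ip_sum_left) (use e e_ip f up up' in auto)
    then have "ip y f = 0" using ef by simp
    then have xf: "ip x f = x k * n"
      using y w f wf by (subst xy, subst ip_add_left) (auto simp: up up' ip_scale_left)
    have "x i = (\<Sum>j<Suc k. ip x (e' j) * e' j i)" for i
    proof -
      have "x i = y i + x k * w i" by (simp add: y_def)
      also have "y i = (\<Sum>j<k. ip y (e j) * e j i)" by (subst e_expand[OF y]) simp
      also have "\<dots> = (\<Sum>j<k. ip x (e j) * e j i)" using xe by simp
      also have "x k * w i = ip x f * f i" unfolding xf using n(1) by (simp add: f_def)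
      finally show ?thesis by (simp add: e'_def)
    qed
    then show ?thesis by (rule ext)
  qed
  moreover have "e' j \<in> Rd (Suc k)" if "j < Suc k" for j
    using that e[of j] f by (auto simp: e'_def intro: Rd_mono)
  moreover have "ip (e' j) (e' l) = of_bool (j = l)" if "j < Suc k" "l < Suc k" for j l
    using that e_ip[of j l] ff fe ef by (auto simp: e'_def less_Suc_eq)
  ultimately show ?case by (intro exI[of _ e']) auto
qed

definition onb :: "nat \<Rightarrow> nat \<Rightarrow> real" where
  "onb = (SOME e. (\<forall>j<d. e j \<in> Rd d) \<and> (\<forall>j<d. \<forall>l<d. ip (e j) (e l) = of_bool (j = l)) \<and>
     (\<forall>x\<in>Rd d. x = (\<lambda>i. \<Sum>j<d. ip x (e j) * e j i)))"

lemma onb: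
  shows onb_Rd: "j < d \<Longrightarrow> onb j \<in> Rd d"
    and onb_ip: "j < d \<Longrightarrow> l < d \<Longrightarrow> ip (onb j) (onb l) = of_bool (j = l)"
    and onb_expand: "x \<in> Rd d \<Longrightarrow> x = (\<lambda>i. \<Sum>j<d. ip x (onb j) * onb j i)"
proof -
  have "(\<forall>j<d. onb j \<in> Rd d) \<and> (\<forall>j<d. \<forall>l<d. ip (onb j) (onb l) = of_bool (j = l)) \<and>
     (\<forall>x\<in>Rd d. x = (\<lambda>i. \<Sum>j<d. ip x (onb j) * onb j i))"
    by (rule someI_ex[OF orthonormal_prefix[OF order_refl], folded onb_def])
  then show "j < d \<Longrightarrow> onb j \<in> Rd d" "j < d \<Longrightarrow> l < d \<Longrightarrow> ip (onb j) (onb l) = of_bool (j = l)"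
    "x \<in> Rd d \<Longrightarrow> x = (\<lambda>i. \<Sum>j<d. ip x (onb j) * onb j i)" by auto
qed

definition coord :: "(nat \<Rightarrow> real) \<Rightarrow> nat \<Rightarrow> real" where
  "coord x j = ip x (onb j)"

definition vec :: "(nat \<Rightarrow> real) \<Rightarrow> nat \<Rightarrow> real" where
  "vec c = (\<lambda>i. \<Sum>j<d. c j * onb j i)"

lemma vec_Rd [simp]: "vec c \<in> Rd d"
  unfolding vec_def using onb_Rd by (intro Rd_simps) auto

lemma vec_coord: "x \<in> Rd d \<Longrightarrow> vec (coord x) = x"
  using onb_expand[of x] by (simp add: vec_def coord_def)

lemma coord_vec: "j < d \<Longrightarrow> coord (vec c) j = c j"
proof -
  assume j: "j < d"
  have "coord (vec c) j = (\<Sum>l<d. c l * ip (onb l) (onb j))"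
    unfolding coord_def vec_def by (rule ip_sum_left) (use onb_Rd j in auto)
  also have "\<dots> = (\<Sum>l<d. if l = j then c l else 0)"
    by (rule sum.cong) (use onb_ip j in auto)
  finally show ?thesis using j by simp
qed

lemma ip_eq_lin: "x \<in> Rd d \<Longrightarrow> y \<in> Rd d \<Longrightarrow> ip x y = lin {..<d} (coord y) (coord x)"
proof -
  assume x: "x \<in> Rd d" and y: "y \<in> Rd d"
  have "ip x y = ip (vec (coord x)) y" using x by (simp add: vec_coord)
  also have "\<dots> = (\<Sum>j<d. coord x j * ip (onb j) y)"
    unfolding vec_def by (rule ip_sum_left) (use onb_Rd y in auto)
  also have "\<dots> = (\<Sum>j<d. coord x j * coord y j)"
    by (rule sum.cong) (use onb_Rd y ip_commute in \<open>auto simp: coord_def\<close>)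
  finally show ?thesis by (simp add: lin_def)
qed

lemma ip_norm_eq: "x \<in> Rd d \<Longrightarrow> ip_norm ip x = L2_set (coord x) {..<d}"
  by (simp add: ip_norm_def ip_eq_lin lin_def L2_set_def power2_eq_square)

lemma coord_diff: "x \<in> Rd d \<Longrightarrow> y \<in> Rd d \<Longrightarrow> j < d \<Longrightarrow> coord (vminus x y) j = coord x j - coord y j"
  by (simp add: coord_def ip_diff_left onb_Rd)

lemma ip_norm_diff:
  assumes "x \<in> Rd d" "y \<in> Rd d"
  shows "ip_norm ip (vminus x y) = L2_set (\<lambda>j. coord x j - coord y j) {..<d}"
  using assms by (simp add: ip_norm_eq coord_diff cong: L2_set_cong_simp)

lemma ip_norm_nonneg: "x \<in> Rd d \<Longrightarrow> 0 \<le> ip_norm ip x"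
  by (simp add: ip_norm_eq)

lemma cauchy_schwarz: "x \<in> Rd d \<Longrightarrow> y \<in> Rd d \<Longrightarrow> \<bar>ip x y\<bar> \<le> ip_norm ip x * ip_norm ip y"
  using lin_le_L2[of "{..<d}" "coord y" "coord x"] by (simp add: ip_eq_lin ip_norm_eq)

lemma ip_norm_scale: "x \<in> Rd d \<Longrightarrow> ip_norm ip (\<lambda>j. a * x j) = \<bar>a\<bar> * ip_norm ip x"
proof -
  assume x: "x \<in> Rd d"
  have "ip (\<lambda>j. a * x j) (\<lambda>j. a * x j) = a * (a * ip x x)"
    using x ip_scale_left[of x "\<lambda>j. a * x j" a] ip_commute[of x "\<lambda>j. a * x j"] by (simp add: ip_scale_left)
  then show ?thesis by (simp add: ip_norm_def real_sqrt_mult flip: mult.assoc)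
qed

lemma ip_norm_sq: "x \<in> Rd d \<Longrightarrow> (ip_norm ip x)\<^sup>2 = ip x x"
  using ip_pos[of x] ip_zero_left[of "\<lambda>j. 0"] by (cases "x = (\<lambda>j. 0)") (auto simp: ip_norm_def)

text \<open>
  The Cauchy--Schwarz inequality, with equality at \<open>y = x / \<parallel>x\<parallel>\<close>: the dual norm is the norm.
\<close>

lemma dual_ball_eq: "dual_ball d ip = {x\<in>Rd d. ip_norm ip x \<le> 1}"
proof -
  have "dual_norm d ip x \<le> 1 \<longleftrightarrow> ip_norm ip x \<le> 1" if x: "x \<in> Rd d" for x
  proof
    let ?Y = "{y\<in>Rd d. ip_norm ip y \<le> 1}"
    have bound: "\<bar>ip y x\<bar> \<le> ip_norm ip x" if "y \<in> ?Y" for y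
    proof -
      have "\<bar>ip y x\<bar> \<le> ip_norm ip y * ip_norm ip x" using that x by (intro cauchy_schwarz) auto
      also have "\<dots> \<le> 1 * ip_norm ip x" using that x ip_norm_nonneg by (intro mult_right_mono) auto
      finally show ?thesis by simp
    qed
    { assume 1: "dual_norm d ip x \<le> 1"
      show "ip_norm ip x \<le> 1"
      proof (cases "ip_norm ip x = 0")
        case False
        define n where "n = ip_norm ip x"
        have n: "n > 0" using False ip_norm_nonneg[OF x] by (simp add: n_def)
        define y where "y = (\<lambda>j. (1 / n) * x j)"
        have "y \<in> Rd d" unfolding y_def by (rule Rd_simps(4)[OF x])
        moreover have "ip_norm ip y = 1" unfolding y_def ip_norm_scale[OF x] using n by (simp add: n_def)
        ultimately have y: "y \<in> ?Y" by simp
        have "ip y x = n" unfolding y_def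
          using n ip_norm_sq[OF x] by (subst ip_scale_left) (auto simp: x n_def power2_eq_square field_simps)
        then have "n \<le> \<bar>ip y x\<bar>" by simp
        also have "\<dots> \<le> dual_norm d ip x" unfolding dual_norm_def
          by (rule cSUP_upper[OF y]) (rule bdd_aboveI2, rule bound)
        finally show ?thesis using 1 by (simp add: n_def)
      qed simp }
    { assume 1: "ip_norm ip x \<le> 1"
      have "(\<lambda>j. 0) \<in> ?Y" using ip_zero_left[of "\<lambda>j. 0"] by (simp add: ip_norm_def)
      then show "dual_norm d ip x \<le> 1" unfolding dual_norm_def
        using order_trans[OF bound 1] by (intro cSUP_least) blast+ }
  qed
  then show ?thesis by (auto simp: dual_ball_def)
qed

text \<open>
  Strict convexity of a norm that comes from an inner product.
\<close>

lemma sphere_extreme: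
  assumes x: "x \<in> Rd d" "ip_norm ip x = 1"
  shows "x \<in> extreme_points (dual_ball d ip)"
proof -
  have False if y: "y \<in> Rd d" "ip_norm ip y \<le> 1" and z: "z \<in> Rd d" "ip_norm ip z \<le> 1" and "y \<noteq> z"
    and t: "0 < t" "t < 1" and xe: "x = (\<lambda>j. (1 - t) * y j + t * z j)" for y z and t :: real
  proof -
    have xz: "ip x u = (1 - t) * ip y u + t * ip z u" if "u \<in> Rd d" for u
      unfolding xe using y z that by (simp add: ip_add_left ip_scale_left)
    have xx: "ip x x = (1 - t) * ((1 - t) * ip y y + t * ip z y) + t * ((1 - t) * ip y z + t * ip z z)"
      using xz[OF x(1)] ip_commute[OF y(1) x(1)] ip_commute[OF z(1) x(1)] xz[OF y(1)] xz[OF z(1)] by simp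
    have w: "(\<lambda>j. y j - z j) \<in> Rd d" using y z by simp
    have "(\<lambda>j. y j - z j) \<noteq> (\<lambda>j. 0)" using \<open>y \<noteq> z\<close> by (auto simp: fun_eq_iff)
    then have "0 < ip (\<lambda>j. y j - z j) (\<lambda>j. y j - z j)" using ip_pos w by blast
    also have "\<dots> = ip y y - 2 * ip y z + ip z z"
      using y z w ip_commute[OF y(1) w] ip_commute[OF z(1) w] ip_commute[OF y(1) z(1)] by (simp add: ip_diff_left)
    finally have "0 < t * (1 - t) * (ip y y - 2 * ip y z + ip z z)" using t by simp
    moreover have "ip x x = 1" using ip_norm_sq[OF x(1)] x(2) by simp
    moreover have "ip y y \<le> 1" "ip z z \<le> 1"
      using ip_norm_sq[OF y(1)] ip_norm_sq[OF z(1)] y z ip_norm_nonneg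
      by (metis power_le_one)+
    then have "(1 - t) * ip y y \<le> (1 - t) * 1" "t * ip z z \<le> t * 1"
      using t by (intro mult_left_mono; simp)+
    moreover have "ip z y = ip y z" using y z ip_commute by simp
    ultimately show False unfolding xx by (simp add: algebra_simps)
  qed
  then show ?thesis using x unfolding extreme_points_def dual_ball_eq by fastforce
qed

end

locale dual_pair = inner_product d ip for d ip +
  fixes U B :: "(nat \<Rightarrow> real) set"
  assumes U: "U \<subseteq> Rd d" and dual: "is_dual_set d ip U B"
begin

lemma B_ball: "v \<in> B \<Longrightarrow> v \<in> Rd d \<and> ip_norm ip v \<le> 1"
  using dual unfolding is_dual_set_def extreme_points_def dual_ball_eq by (auto split: if_splits)

lemma sphere_B: "U = Rd d \<Longrightarrow> v \<in> Rd d \<Longrightarrow> ip_norm ip v = 1 \<Longrightarrow> v \<in> B"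
  using dual sphere_extreme unfolding is_dual_set_def by auto

lemma onb_norm: "j < d \<Longrightarrow> ip_norm ip (onb j) = 1"
  by (simp add: ip_norm_def onb_ip)

lemma B_nonempty: "B \<noteq> {}"
proof (cases "U = Rd d")
  case True
  show ?thesis
  proof (cases "d = 0")
    case False
    then have "onb 0 \<in> B" using True onb_Rd onb_norm by (intro sphere_B) auto
    then show ?thesis by auto
  next
    case d0: True
    have z: "Rd d = {\<lambda>j. 0}" using d0 by (auto simp: Rd_iff)
    have "(\<lambda>j. 0) \<in> extreme_points (dual_ball d ip)"
      using ip_zero_left[of "\<lambda>j. 0"] unfolding extreme_points_def dual_ball_eq z by (simp add: ip_norm_def)
    then show ?thesis using dual True unfolding is_dual_set_def by auto
  qed
qed (use dual in \<open>auto simp: is_dual_set_def norming_for_def\<close>)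

text \<open>
  The one property of a dual set on which the estimators rely. For \<open>U = \<real>\<^sup>d\<close> it holds because the extreme
  points include the normalized vector \<open>u - w\<close>.
\<close>

lemma norm_le_if_functionals_le:
  assumes u: "u \<in> U" "w \<in> U" and le: "\<And>v. v \<in> B \<Longrightarrow> ip (vminus u w) v \<le> \<rho>"
  shows "ip_norm ip (vminus u w) \<le> \<rho>"
proof (cases "U = Rd d")
  case True
  let ?x = "vminus u w"
  have x: "?x \<in> Rd d" using u U by (intro Rd_simps) auto
  show ?thesis
  proof (cases "ip_norm ip ?x = 0")
    case False
    define n where "n = ip_norm ip ?x"
    have n: "n > 0" using False ip_norm_nonneg[OF x] by (simp add: n_def)
    define v where "v = (\<lambda>j. (1 / n) * ?x j)"
    have v: "v \<in> Rd d" unfolding v_def using x by (rule Rd_simps)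
    have "ip_norm ip v = 1" unfolding v_def ip_norm_scale[OF x] using n by (simp add: n_def)
    then have "v \<in> B" using True v sphere_B by blast
    moreover have "ip v ?x = (1 / n) * ip ?x ?x" unfolding v_def by (rule ip_scale_left[OF x x])
    then have "ip ?x v = n"
      using ip_norm_sq[OF x] n unfolding ip_commute[OF x v] n_def[symmetric] by (simp add: power2_eq_square nonzero_divide_eq_eq)
    ultimately show ?thesis using le unfolding n_def by force
  next
    case True
    obtain v where v: "v \<in> B" using B_nonempty by blast
    have "?x = (\<lambda>j. 0)" using True ip_pos[OF x] ip_norm_sq[OF x] by (metis less_irrefl power_zero_numeral)
    then have "0 \<le> \<rho>" using le[OF v] ip_zero_left[of v] B_ball[OF v] by simp
    then show ?thesis using True by simp
  qed
next
  case False
  then have "ip_norm ip (vminus u w) = (SUP x\<in>B. ip (vminus u w) x)"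
    using dual u by (auto simp: is_dual_set_def norming_for_def)
  also have "\<dots> \<le> \<rho>" using B_nonempty le by (intro cSUP_least) auto
  finally show ?thesis .
qed

lemma VC_vectors_eq:
  "VC_vectors d ip B = Sup {enat n |n. \<exists>xs. length xs = n \<and> set xs \<subseteq> Rd d \<and>
      (\<forall>S\<subseteq>{..<n}. \<exists>v\<in>B. \<forall>j<n. 0 \<le> ip (xs ! j) v \<longleftrightarrow> j \<in> S)}"
  unfolding VC_vectors_def VC_def
  using all_patterns_iff[of _ _ "(\<lambda>v x. 0 \<le> ip x v) ` B", symmetric]
  by (intro arg_cong[where f = Sup] Collect_cong) (auto; fail)+

text \<open>
  In particular the VC dimension is finite, so that \<^const>\<open>VC_real\<close> is indeed its value.
\<close>

lemma VC_vectors_le_dim: "VC_vectors d ip B \<le> enat d"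
  unfolding VC_vectors_eq
proof (rule Sup_least)
  fix N assume "N \<in> {enat n |n. \<exists>xs. length xs = n \<and> set xs \<subseteq> Rd d \<and>
      (\<forall>S\<subseteq>{..<n}. \<exists>v\<in>B. \<forall>j<n. 0 \<le> ip (xs ! j) v \<longleftrightarrow> j \<in> S)}"
  then obtain xs where N: "N = enat (length xs)" and xs: "set xs \<subseteq> Rd d"
    and sh: "\<forall>S\<subseteq>{..<length xs}. \<exists>v\<in>B. \<forall>j<length xs. 0 \<le> ip (xs ! j) v \<longleftrightarrow> j \<in> S" by auto
  have "length xs \<le> card {..<d}"
  proof (rule vc_leD[OF vc_le_halfspaces, where x = "\<lambda>j. coord (xs ! j)" and B = "coord ` B"])
    fix S assume "S \<subseteq> {..<length xs}"
    with sh obtain v where v: "v \<in> B" "\<forall>j<length xs. 0 \<le> ip (xs ! j) v \<longleftrightarrow> j \<in> S" by blast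
    have "xs ! j \<in> Rd d" if "j < length xs" for j using xs that by (meson nth_mem subsetD)
    then have "\<forall>j<length xs. 0 \<le> lin {..<d} (coord v) (coord (xs ! j)) \<longleftrightarrow> j \<in> S"
      using v B_ball[OF v(1)] by (auto simp: ip_eq_lin)
    then show "\<exists>v\<in>coord ` B. \<forall>j<length xs. 0 \<le> lin {..<d} v (coord (xs ! j)) \<longleftrightarrow> j \<in> S"
      using v(1) by blast
  qed simp
  then show "N \<le> enat d" using N by simp
qed

lemma VC_real_le_dim: "VC_real d ip B \<le> real d"
  using VC_vectors_le_dim by (cases "VC_vectors d ip B") (auto simp: VC_real_def)

lemma vc_le_B: "vc_le (the_enat (VC_vectors d ip B)) (\<lambda>v x. 0 \<le> lin {..<d} v x) (coord ` B)"
proof -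
  let ?N = "{enat n |n. \<exists>xs. length xs = n \<and> set xs \<subseteq> Rd d \<and>
      (\<forall>S\<subseteq>{..<n}. \<exists>v\<in>B. \<forall>j<n. 0 \<le> ip (xs ! j) v \<longleftrightarrow> j \<in> S)}"
  obtain V where V: "VC_vectors d ip B = enat V"
    using VC_vectors_le_dim by (cases "VC_vectors d ip B") auto
  show ?thesis
    unfolding vc_le_def
  proof (intro allI impI)
    fix n :: nat and x :: "nat \<Rightarrow> nat \<Rightarrow> real"
    assume sh: "\<forall>S\<subseteq>{..<n}. \<exists>v\<in>coord ` B. \<forall>j<n. 0 \<le> lin {..<d} v (x j) \<longleftrightarrow> j \<in> S"
    define xs where "xs = map (\<lambda>j. vec (x j)) [0..<n]"
    have "\<exists>v\<in>B. \<forall>j<n. 0 \<le> ip (xs ! j) v \<longleftrightarrow> j \<in> S" if S: "S \<subseteq> {..<n}" for S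
    proof -
      obtain v where v: "v \<in> B" "\<forall>j<n. 0 \<le> lin {..<d} (coord v) (x j) \<longleftrightarrow> j \<in> S"
        using sh[rule_format, OF S] by auto
      have "ip (xs ! j) v = lin {..<d} (coord v) (x j)" if "j < n" for j
      proof -
        have "ip (xs ! j) v = lin {..<d} (coord v) (coord (vec (x j)))"
          using that B_ball[OF v(1)] by (simp add: xs_def ip_eq_lin)
        also have "\<dots> = lin {..<d} (coord v) (x j)"
          unfolding lin_def by (rule sum.cong) (auto simp: coord_vec)
        finally show ?thesis .
      qed
      then show ?thesis using v by (intro bexI[of _ v]) auto
    qed
    then have "enat n \<in> ?N"
      by (intro CollectI exI[of _ n] conjI refl exI[of _ xs]) (auto simp: xs_def)
    then have "enat n \<le> VC_vectors d ip B" unfolding VC_vectors_eq by (rule Sup_upper)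
    then show "n \<le> the_enat (VC_vectors d ip B)" using V by simp
  qed
qed

text \<open>
  Unit vectors with all coordinates \<open>\<plusminus> 1 / sqrt d\<close> shatter the orthonormal basis. So in the whole space the
  dimension may be replaced by the VC dimension in upper bounds.
\<close>

lemma VC_real_ge_dim:
  assumes "U = Rd d"
  shows "real d \<le> VC_real d ip B"
proof (cases "d = 0")
  case False
  have "d \<le> the_enat (VC_vectors d ip B)"
  proof (rule vc_leD[OF vc_le_B, where x = "\<lambda>j. coord (onb j)"])
    fix S :: "nat set"
    define c where "c j = (if j \<in> S then 1 else -1) / sqrt d" for j
    have "L2_set c {..<d} = 1"
      using False by (simp add: L2_set_def c_def power_divide if_distrib[of "\<lambda>t. t^2"] cong: if_cong)
    moreover have "L2_set (coord (vec c)) {..<d} = L2_set c {..<d}"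
      by (rule L2_set_cong) (auto simp: coord_vec)
    ultimately have "vec c \<in> B" using assms by (intro sphere_B) (auto simp: ip_norm_eq)
    moreover have "0 \<le> lin {..<d} (coord (vec c)) (coord (onb j)) \<longleftrightarrow> j \<in> S" if "j < d" for j
    proof -
      have "lin {..<d} (coord (vec c)) (coord (onb j)) = (\<Sum>l<d. if l = j then c l else 0)"
        unfolding lin_def by (rule sum.cong) (use that in \<open>auto simp: coord_vec, auto simp: coord_def onb_ip\<close>)
      also have "\<dots> = c j" using that by simp
      finally show ?thesis using False by (simp add: c_def)
    qed
    ultimately show "\<exists>v\<in>coord ` B. \<forall>j<d. 0 \<le> lin {..<d} v (coord (onb j)) \<longleftrightarrow> j \<in> S" by blast
  qed
  then show ?thesis by (simp add: VC_real_def)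
qed (simp add: VC_real_def)

end

section \<open>Uniform tails of linear functionals\<close>

text \<open>
  The law of independent observations is a product measure; \<open>vc_tail_PiM\<close> applies with the \<open>K\<close>
  marginals repeated periodically. As \<open>K\<close> exceeds a large multiple of \<open>D\<close>, the number of traces costs only a
  part of the exponent.
\<close>

lemma (in prob_space) vc_tail:
  fixes Z :: "nat \<Rightarrow> 'a \<Rightarrow> 'x"
  assumes ind: "indep_vars (\<lambda>_. S) Z {..<K}" and K: "0 < K" "10000 * D \<le> K"
    and T: "countable T" and meas: "\<And>v. v \<in> T \<Longrightarrow> Measurable.pred S (h v)"
    and p: "\<And>v k. v \<in> T \<Longrightarrow> k < K \<Longrightarrow> prob {\<omega>\<in>space M. h v (Z k \<omega>)} \<le> 1 / 64"
    and vc: "vc_le D h T"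
  shows "\<exists>F\<in>events. prob F \<le> 2 * exp (- (K / 512)) \<and>
    (\<forall>\<omega>\<in>space M - F. \<forall>v\<in>T. 8 * card {k\<in>{..<K}. h v (Z k \<omega>)} \<le> K)"
proof -
  define Q where "Q i = distr M S (Z (i mod K))" for i
  have rv: "Z k \<in> measurable M S" if "k < K" for k
    using ind that by (auto simp: indep_vars_def)
  have rv': "Z (i mod K) \<in> measurable M S" for i using K by (intro rv) simp
  have 1: "prob_space (Q i)" for i unfolding Q_def by (rule prob_space_distr[OF rv'])
  have 2: "Q (i + K) = Q i" for i by (simp add: Q_def)
  have 3: "sets (Q i) = sets S" for i by (simp add: Q_def)
  have 4: "measure (Q i) {x\<in>space S. h v x} \<le> 1 / 64" if v: "v \<in> T" for v i
  proof -
    have [measurable]: "Measurable.pred S (h v)" by (rule meas[OF v])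
    have "measure (Q i) {x\<in>space S. h v x} = prob (Z (i mod K) -` {x\<in>space S. h v x} \<inter> space M)"
      unfolding Q_def by (rule measure_distr[OF rv']) measurable
    also have "Z (i mod K) -` {x\<in>space S. h v x} \<inter> space M = {\<omega>\<in>space M. h v (Z (i mod K) \<omega>)}"
      using measurable_space[OF rv'] by auto
    also have "prob \<dots> \<le> 1 / 64" using K by (intro p[OF v]) simp
    finally show ?thesis .
  qed
  note ctx = K(1) 1 2 3 T meas 4
  let ?J = "\<lambda>\<omega>. \<lambda>k\<in>{..<K}. Z k \<omega>"
  have J: "?J \<in> measurable M (PiM {..<K} Q)"
    by (rule measurable_restrict) (use rv in \<open>simp add: Q_def\<close>)
  have Jd: "distr M (PiM {..<K} Q) ?J = PiM {..<K} Q"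
  proof -
    have "distr M (PiM {..<K} (\<lambda>_. S)) ?J = PiM {..<K} (\<lambda>k. distr M S (Z k))"
      using ind by (subst (asm) indep_vars_iff_distr_eq_PiM') (use K rv in auto)
    moreover have "PiM {..<K} (\<lambda>k. distr M S (Z k)) = PiM {..<K} Q"
      by (rule PiM_cong) (auto simp: Q_def)
    moreover have "distr M (PiM {..<K} (\<lambda>_. S)) ?J = distr M (PiM {..<K} Q) ?J"
      by (rule distr_cong) (auto intro!: sets_PiM_cong simp: 3)
    ultimately show ?thesis by simp
  qed
  let ?O = "overhit K Q h T"
  have O: "?O \<in> sets (PiM {..<K} Q)" by (rule sets_overhit[of K Q S T h, OF ctx])
  let ?F = "?J -` ?O \<inter> space M"
  have F: "?F \<in> events" using J O by (rule measurable_sets)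
  have "prob ?F = measure (distr M (PiM {..<K} Q) ?J) ?O" by (rule measure_distr[OF J O, symmetric])
  also have "\<dots> \<le> 2 * exp (9 * real D - real (3 * K) / 1024)"
    unfolding Jd by (rule vc_tail_PiM[of K Q S T h D, OF ctx vc])
  also have "\<dots> \<le> 2 * exp (- (K / 512))"
  proof -
    have "10000 * real D \<le> real K" using K(2) by linarith
    then show ?thesis by simp
  qed
  finally have P: "prob ?F \<le> 2 * exp (- (K / 512))" .
  have "8 * card {k\<in>{..<K}. h v (Z k \<omega>)} \<le> K" if \<omega>: "\<omega> \<in> space M - ?F" and v: "v \<in> T" for \<omega> v
  proof -
    have "?J \<omega> \<in> space (PiM {..<K} Q)" using \<omega> measurable_space[OF J] by blast
    then have "\<not> K / 8 < hits (h v) {..<K} (?J \<omega>)" using \<omega> v by (auto simp: overhit_def)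
    moreover have "hits (h v) {..<K} (?J \<omega>) = hits (h v) {..<K} (\<lambda>k. Z k \<omega>)"
      unfolding hits_def by (rule sum.cong) auto
    ultimately have "8 * real (card {k\<in>{..<K}. h v (Z k \<omega>)}) \<le> K" by (simp add: hits_eq_card)
    then show ?thesis by linarith
  qed
  then show ?thesis using F P by blast
qed

text \<open>
  For \<open>s = 0\<close>, which occurs when \<open>R = 0\<close>, the variable vanishes almost surely; otherwise this is
  Chebyshev's inequality.
\<close>

lemma (in prob_space) second_moment_tail:
  fixes f :: "'a \<Rightarrow> real"
  assumes f: "f \<in> borel_measurable M" and int: "integrable M (\<lambda>\<omega>. (f \<omega>)\<^sup>2)"
    and s: "0 \<le> s" "expectation (\<lambda>\<omega>. (f \<omega>)\<^sup>2) \<le> s\<^sup>2"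
  shows "prob {\<omega>\<in>space M. 8 * s < \<bar>f \<omega>\<bar>} \<le> 1 / 64"
proof (cases "s = 0")
  case True
  have [measurable]: "f \<in> borel_measurable M" by (rule f)
  have "0 \<le> expectation (\<lambda>\<omega>. (f \<omega>)\<^sup>2)" by (rule integral_nonneg_AE) simp
  moreover have "expectation (\<lambda>\<omega>. (f \<omega>)\<^sup>2) \<le> 0" using s True by simp
  ultimately have "expectation (\<lambda>\<omega>. (f \<omega>)\<^sup>2) = 0" by linarith
  then have "AE \<omega> in M. (f \<omega>)\<^sup>2 = 0" using integral_nonneg_eq_0_iff_AE[OF int] by simp
  then have "AE \<omega> in M. \<not> 8 * s < \<bar>f \<omega>\<bar>" by eventually_elim (simp add: True)
  then have "prob {\<omega>\<in>space M. 8 * s < \<bar>f \<omega>\<bar>} = 0" by (subst prob_eq_0) auto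
  then show ?thesis by simp
next
  case False
  have [measurable]: "f \<in> borel_measurable M" by (rule f)
  have "prob {\<omega>\<in>space M. 8 * s < \<bar>f \<omega>\<bar>} \<le> prob {\<omega>\<in>space M. (f \<omega>)\<^sup>2 \<ge> (8 * s)\<^sup>2}"
  proof (rule finite_measure_mono)
    show "{\<omega>\<in>space M. 8 * s < \<bar>f \<omega>\<bar>} \<subseteq> {\<omega>\<in>space M. (f \<omega>)\<^sup>2 \<ge> (8 * s)\<^sup>2}"
      using s(1) power_mono[of "8 * s" "\<bar>f _\<bar>" 2] by (auto simp del: power_mult_distrib)
  qed measurable
  also have "\<dots> \<le> expectation (\<lambda>\<omega>. (f \<omega>)\<^sup>2) / (8 * s)\<^sup>2"
    by (rule integral_Markov_inequality_measure[OF int, where A = "{}"]) (use False in auto)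
  also have "\<dots> \<le> s\<^sup>2 / (8 * s)\<^sup>2" using s by (intro divide_right_mono) auto
  also have "\<dots> = 1 / 64" using False by (simp add: power_mult_distrib)
  finally show ?thesis .
qed

lemma (in prob_space) square_integrable_sum:
  assumes "finite I" "\<And>i. i \<in> I \<Longrightarrow> X i \<in> borel_measurable M"
    "\<And>i. i \<in> I \<Longrightarrow> integrable M (\<lambda>\<omega>. (X i \<omega>)\<^sup>2)"
  shows "integrable M (\<lambda>\<omega>. (\<Sum>i\<in>I. X i \<omega> :: real)\<^sup>2)"
  using assms
proof (induction I rule: finite_induct)
  case (insert i I)
  have [measurable]: "X j \<in> borel_measurable M" if "j \<in> insert i I" for j using insert that by blast
  have "integrable M (\<lambda>\<omega>. 2 * (X i \<omega>)\<^sup>2 + 2 * (\<Sum>j\<in>I. X j \<omega>)\<^sup>2)"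
    using insert by (intro Bochner_Integration.integrable_add integrable_mult_right) auto
  then show ?case
  proof (rule Bochner_Integration.integrable_bound)
    show "(\<lambda>\<omega>. (\<Sum>j\<in>insert i I. X j \<omega>)\<^sup>2) \<in> borel_measurable M"
      using insert by (intro borel_measurable_power borel_measurable_sum) auto
    have "(a + b)\<^sup>2 \<le> 2 * a\<^sup>2 + 2 * b\<^sup>2" for a b :: real
      using sum_squares_bound[of a b] by (simp add: power2_sum)
    then show "AE \<omega> in M. norm ((\<Sum>j\<in>insert i I. X j \<omega>)\<^sup>2) \<le> norm (2 * (X i \<omega>)\<^sup>2 + 2 * (\<Sum>j\<in>I. X j \<omega>)\<^sup>2)"
      using insert by (intro AE_I2) simp
  qed
qed simp

text \<open>
  Independent centred variables are orthogonal, so second moments add up.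
\<close>

lemma (in prob_space) second_moment_sum:
  fixes X :: "'i \<Rightarrow> 'a \<Rightarrow> real" and s :: real
  assumes "finite I" "indep_vars (\<lambda>_. borel) X I"
    "\<And>i. i \<in> I \<Longrightarrow> integrable M (\<lambda>\<omega>. (X i \<omega>)\<^sup>2)" "\<And>i. i \<in> I \<Longrightarrow> expectation (X i) = 0"
    "\<And>i. i \<in> I \<Longrightarrow> expectation (\<lambda>\<omega>. (X i \<omega>)\<^sup>2) \<le> s"
  shows "expectation (\<lambda>\<omega>. (\<Sum>i\<in>I. X i \<omega>)\<^sup>2) \<le> card I * s"
  using assms
proof (induction I rule: finite_induct)
  case (insert i I)
  have rv: "X j \<in> borel_measurable M" if "j \<in> insert i I" for j
    using insert.prems(1) that unfolding indep_vars_def by blast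
  have int1: "integrable M (X j)" if "j \<in> insert i I" for j
    by (rule square_integrable_imp_integrable) (use rv insert that in auto)
  have ind: "indep_var borel (X i) borel (\<lambda>\<omega>. \<Sum>j\<in>I. X j \<omega>)"
    using insert by (intro indep_vars_sum) auto
  have intS: "integrable M (\<lambda>\<omega>. \<Sum>j\<in>I. X j \<omega>)" using int1 by (intro Bochner_Integration.integrable_sum) auto
  have intS2: "integrable M (\<lambda>\<omega>. (\<Sum>j\<in>I. X j \<omega>)\<^sup>2)"
    using insert rv by (intro square_integrable_sum) auto
  have intP: "integrable M (\<lambda>\<omega>. X i \<omega> * (\<Sum>j\<in>I. X j \<omega>))"
    by (rule indep_var_integrable[OF ind]) (use int1 intS in auto)
  have "expectation (\<lambda>\<omega>. X i \<omega> * (\<Sum>j\<in>I. X j \<omega>)) = 0"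
    using insert.prems(3) by (subst indep_var_lebesgue_integral[OF ind]) (use int1 intS in auto)
  moreover have "expectation (\<lambda>\<omega>. (\<Sum>j\<in>insert i I. X j \<omega>)\<^sup>2)
     = expectation (\<lambda>\<omega>. (X i \<omega>)\<^sup>2 + (2 * (X i \<omega> * (\<Sum>j\<in>I. X j \<omega>)) + (\<Sum>j\<in>I. X j \<omega>)\<^sup>2))"
    using insert by (intro Bochner_Integration.integral_cong) (auto simp: power2_sum)
  moreover have "\<dots> = expectation (\<lambda>\<omega>. (X i \<omega>)\<^sup>2) + (2 * expectation (\<lambda>\<omega>. X i \<omega> * (\<Sum>j\<in>I. X j \<omega>)) +
      expectation (\<lambda>\<omega>. (\<Sum>j\<in>I. X j \<omega>)\<^sup>2))"
    using insert.prems(2) intP intS2 by simp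
  moreover have "expectation (\<lambda>\<omega>. (\<Sum>j\<in>I. X j \<omega>)\<^sup>2) \<le> card I * s"
    using insert by (intro insert.IH) (auto intro: indep_vars_subset)
  moreover have "expectation (\<lambda>\<omega>. (X i \<omega>)\<^sup>2) \<le> s" using insert by auto
  ultimately show ?case using insert.hyps by (simp add: algebra_simps)
qed simp

lemma countable_dense_subset:
  fixes B :: "'x::second_countable_topology set"
  shows "\<exists>T\<subseteq>B. countable T \<and> (\<forall>G. open G \<longrightarrow> G \<inter> B \<noteq> {} \<longrightarrow> G \<inter> T \<noteq> {})"
proof -
  obtain \<B> :: "'x set set" where \<B>: "countable \<B>" "topological_basis \<B>"
    using ex_countable_basis by blast
  define pt where "pt b = (SOME t. t \<in> b \<inter> B)" for b
  have pt: "pt b \<in> b \<inter> B" if "b \<inter> B \<noteq> {}" for b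
    unfolding pt_def by (rule someI_ex) (use that in blast)
  let ?T = "pt ` {b\<in>\<B>. b \<inter> B \<noteq> {}}"
  have "G \<inter> ?T \<noteq> {}" if "open G" "G \<inter> B \<noteq> {}" for G
  proof -
    obtain x where x: "x \<in> G" "x \<in> B" using \<open>G \<inter> B \<noteq> {}\<close> by blast
    obtain b where b: "b \<in> \<B>" "x \<in> b" "b \<subseteq> G"
      using topological_basisE[OF \<B>(2) \<open>open G\<close> x(1)] by blast
    then have ne: "b \<inter> B \<noteq> {}" using x by blast
    then have "pt b \<in> ?T" "pt b \<in> G" using b pt[OF ne] by auto
    then show ?thesis by blast
  qed
  moreover have "?T \<subseteq> B" using pt by auto
  moreover have "countable ?T" using \<B>(1) by simp
  ultimately show ?thesis by blast
qed

lemma open_lin_gt: "finite g \<Longrightarrow> finite A \<Longrightarrow> open {v. \<forall>k\<in>A. r < lin g v (z k)}"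
proof -
  assume "finite g" "finite A"
  have "open {v. r < lin g v (z k)}" for k
    unfolding lin_def
    by (intro open_Collect_less continuous_on_sum continuous_on_mult continuous_on_const
        continuous_on_product_coordinates)
  then have "open (\<Inter>k\<in>A. {v. r < lin g v (z k)})" using \<open>finite A\<close> by (intro open_INT) auto
  moreover have "(\<Inter>k\<in>A. {v. r < lin g v (z k)}) = {v. \<forall>k\<in>A. r < lin g v (z k)}" by auto
  ultimately show ?thesis by simp
qed

lemma borel_measurable_coordinate: "(\<lambda>x::nat \<Rightarrow> real. x j) \<in> borel_measurable borel"
  by (intro borel_measurable_continuous_onI continuous_on_product_coordinates)

lemma borel_measurable_lin: "lin g v \<in> borel_measurable borel"
  unfolding lin_def[abs_def]
  by (intro borel_measurable_sum borel_measurable_times borel_measurable_coordinate borel_measurable_const)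

text \<open>
  For a fixed outcome, the vectors \<open>v\<close> that satisfy finitely many strict inequalities form an open set.
  Hence a countable dense subset of \<open>B\<close> sees the same numbers of hits, and the exceptional event can be
  chosen measurable although \<open>B\<close> is arbitrary.
\<close>

lemma (in prob_space) uniform_tail_upper:
  fixes Z :: "nat \<Rightarrow> 'a \<Rightarrow> nat \<Rightarrow> real"
  assumes ind: "indep_vars (\<lambda>_. borel) Z {..<K}" and g: "finite g"
    and vc: "vc_le D (\<lambda>v x. r < lin g v x) B"
    and K: "0 < K" "10000 * D \<le> K"
    and p: "\<And>v k. v \<in> B \<Longrightarrow> k < K \<Longrightarrow> prob {\<omega>\<in>space M. r < lin g v (Z k \<omega>)} \<le> 1 / 64"
  shows "\<exists>F\<in>events. prob F \<le> 2 * exp (- (K / 512)) \<and>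
    (\<forall>\<omega>\<in>space M - F. \<forall>v\<in>B. 8 * card {k\<in>{..<K}. r < lin g v (Z k \<omega>)} \<le> K)"
proof -
  obtain T where T: "T \<subseteq> B" "countable T" "\<And>G. open G \<Longrightarrow> G \<inter> B \<noteq> {} \<Longrightarrow> G \<inter> T \<noteq> {}"
    using countable_dense_subset[of B] by blast
  have "\<exists>F\<in>events. prob F \<le> 2 * exp (- (K / 512)) \<and>
    (\<forall>\<omega>\<in>space M - F. \<forall>v\<in>T. 8 * card {k\<in>{..<K}. r < lin g v (Z k \<omega>)} \<le> K)"
  proof (rule vc_tail[OF ind K T(2)])
    fix v
    note [measurable] = borel_measurable_lin[of g v]
    show "Measurable.pred borel (\<lambda>x. r < lin g v x)" by measurable
  qed (use T(1) p vc_le_mono[OF vc T(1)] in auto)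
  then obtain F where F: "F \<in> events" "prob F \<le> 2 * exp (- (K / 512))"
    "\<And>\<omega> v. \<omega> \<in> space M - F \<Longrightarrow> v \<in> T \<Longrightarrow> 8 * card {k\<in>{..<K}. r < lin g v (Z k \<omega>)} \<le> K" by blast
  have "8 * card {k\<in>{..<K}. r < lin g v (Z k \<omega>)} \<le> K" if \<omega>: "\<omega> \<in> space M - F" and v: "v \<in> B" for \<omega> v
  proof -
    let ?A = "{k\<in>{..<K}. r < lin g v (Z k \<omega>)}"
    have "open {u. \<forall>k\<in>?A. r < lin g u (Z k \<omega>)}" by (rule open_lin_gt[OF g]) simp
    from T(3)[OF this] v obtain t where t: "t \<in> T" "\<forall>k\<in>?A. r < lin g t (Z k \<omega>)" by auto
    have "card ?A \<le> card {k\<in>{..<K}. r < lin g t (Z k \<omega>)}" using t by (intro card_mono) auto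
    then show ?thesis using F(3)[OF \<omega> t(1)] by linarith
  qed
  then show ?thesis using F(1,2) by blast
qed

text \<open>
  The lower tail is the upper tail of the reflected vectors \<open>- Z k\<close>.
\<close>

lemma (in prob_space) uniform_tail:
  fixes Z :: "nat \<Rightarrow> 'a \<Rightarrow> nat \<Rightarrow> real"
  assumes ind: "indep_vars (\<lambda>_. borel) Z {..<K}" and g: "finite g"
    and vc: "vc_le V (\<lambda>v x. 0 \<le> lin g v x) B"
    and K: "10000 * (2 * V + 1) \<le> K" and s: "0 \<le> s"
    and int: "\<And>v k. v \<in> B \<Longrightarrow> k < K \<Longrightarrow> integrable M (\<lambda>\<omega>. (lin g v (Z k \<omega>))\<^sup>2)"
    and var: "\<And>v k. v \<in> B \<Longrightarrow> k < K \<Longrightarrow> expectation (\<lambda>\<omega>. (lin g v (Z k \<omega>))\<^sup>2) \<le> s\<^sup>2"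
  shows "\<exists>F\<in>events. prob F \<le> 4 * exp (- (K / 512)) \<and>
    (\<forall>\<omega>\<in>space M - F. \<forall>v\<in>B. 4 * card {k\<in>{..<K}. 8 * s < \<bar>lin g v (Z k \<omega>)\<bar>} \<le> K)"
proof -
  have K0: "0 < K" using K by simp
  have ind': "indep_vars (\<lambda>_. borel) (\<lambda>k \<omega> j. - Z k \<omega> j) {..<K}"
    by (rule indep_vars_compose2[OF ind, where Y = "\<lambda>_ x j. - x j"])
       (intro measurable_coordinatewise_then_product borel_measurable_uminus borel_measurable_coordinate)
  have rv: "(\<lambda>\<omega>. lin g v (Z k \<omega>)) \<in> borel_measurable M" if "k < K" for v k
    using ind that unfolding indep_vars_def
    by (intro measurable_compose[OF _ borel_measurable_lin]) blast
  have p: "prob {\<omega>\<in>space M. 8 * s < \<bar>lin g v (Z k \<omega>)\<bar>} \<le> 1 / 64" if "v \<in> B" "k < K" for v k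
    using that by (intro second_moment_tail rv int var s)
  have sub: "prob A \<le> prob {\<omega>\<in>space M. 8 * s < \<bar>lin g v (Z k \<omega>)\<bar>}"
    if "k < K" "A \<subseteq> {\<omega>\<in>space M. 8 * s < \<bar>lin g v (Z k \<omega>)\<bar>}" for A v k
  proof (rule finite_measure_mono[OF that(2)])
    note [measurable] = rv[OF that(1), of v]
    show "{\<omega>\<in>space M. 8 * s < \<bar>lin g v (Z k \<omega>)\<bar>} \<in> events" by measurable
  qed
  obtain F1 where F1: "F1 \<in> events" "prob F1 \<le> 2 * exp (- (K / 512))"
    "\<And>\<omega> v. \<omega> \<in> space M - F1 \<Longrightarrow> v \<in> B \<Longrightarrow> 8 * card {k\<in>{..<K}. 8 * s < lin g v (Z k \<omega>)} \<le> K"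
  proof -
    have "prob {\<omega>\<in>space M. 8 * s < lin g v (Z k \<omega>)} \<le> 1 / 64" if "v \<in> B" "k < K" for v k
      using sub[OF that(2), of "{\<omega>\<in>space M. 8 * s < lin g v (Z k \<omega>)}" v] p[OF that] by force
    from uniform_tail_upper[OF ind g vc_le_threshold[OF vc] K0 K this] show thesis using that by blast
  qed
  obtain F2 where F2: "F2 \<in> events" "prob F2 \<le> 2 * exp (- (K / 512))"
    "\<And>\<omega> v. \<omega> \<in> space M - F2 \<Longrightarrow> v \<in> B \<Longrightarrow> 8 * card {k\<in>{..<K}. 8 * s < lin g v (\<lambda>j. - Z k \<omega> j)} \<le> K"
  proof -
    have "prob {\<omega>\<in>space M. 8 * s < lin g v (\<lambda>j. - Z k \<omega> j)} \<le> 1 / 64" if "v \<in> B" "k < K" for v k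
      using sub[OF that(2), of "{\<omega>\<in>space M. 8 * s < lin g v (\<lambda>j. - Z k \<omega> j)}" v] p[OF that]
      by (force simp: lin_minus)
    from uniform_tail_upper[OF ind' g vc_le_threshold[OF vc] K0 K this] show thesis using that by blast
  qed
  have "prob (F1 \<union> F2) \<le> prob F1 + prob F2" using F1(1) F2(1) by (rule measure_Un_le)
  then have P: "prob (F1 \<union> F2) \<le> 4 * exp (- (K / 512))" using F1(2) F2(2) by simp
  have "4 * card {k\<in>{..<K}. 8 * s < \<bar>lin g v (Z k \<omega>)\<bar>} \<le> K"
    if \<omega>: "\<omega> \<in> space M - (F1 \<union> F2)" and v: "v \<in> B" for \<omega> v
  proof -
    have "{k\<in>{..<K}. 8 * s < \<bar>lin g v (Z k \<omega>)\<bar>} \<subseteq>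
      {k\<in>{..<K}. 8 * s < lin g v (Z k \<omega>)} \<union> {k\<in>{..<K}. 8 * s < lin g v (\<lambda>j. - Z k \<omega> j)}"
      by (auto simp: lin_minus)
    then have "card {k\<in>{..<K}. 8 * s < \<bar>lin g v (Z k \<omega>)\<bar>} \<le>
      card {k\<in>{..<K}. 8 * s < lin g v (Z k \<omega>)} + card {k\<in>{..<K}. 8 * s < lin g v (\<lambda>j. - Z k \<omega> j)}"
      by (intro order_trans[OF card_mono card_Un_le]) auto
    then show ?thesis using F1(3)[of \<omega> v] F2(3)[of \<omega> v] \<omega> v by auto
  qed
  then show ?thesis using F1(1) F2(1) P by blast
qed

section \<open>The centred clean sample and its block means\<close>

definition block :: "nat \<Rightarrow> nat \<Rightarrow> nat set" where
  "block m k = {k * m..<k * m + m}"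

lemma finite_block [simp]: "finite (block m k)" by (simp add: block_def)

lemma card_block [simp]: "card (block m k) = m" by (simp add: block_def)

lemma block_div: "i \<in> block m k \<Longrightarrow> i div m = k"
  by (auto simp: block_def intro!: div_nat_eqI simp: algebra_simps)

lemma block_subset: "k < K \<Longrightarrow> m * K \<le> N \<Longrightarrow> block m k \<subseteq> {..<N}"
proof -
  assume "k < K" "m * K \<le> N"
  then have "Suc k * m \<le> N" by (metis Suc_leI mult.commute mult_le_mono2 order_trans)
  then show ?thesis by (auto simp: block_def)
qed

text \<open>
  Averaging over \<open>m\<close> independent observations divides the second moment of each functional by \<open>m\<close>, and
  disjoint blocks are independent.
\<close>

lemma (in prob_space) block_means_tail:
  fixes W :: "nat \<Rightarrow> 'a \<Rightarrow> nat \<Rightarrow> real"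
  assumes ind: "indep_vars (\<lambda>_. borel) W {..<N}" and g: "finite g"
    and vc: "vc_le V (\<lambda>v x. 0 \<le> lin g v x) B"
    and K: "10000 * (2 * V + 1) \<le> K" and m: "0 < m" "m * K \<le> N" and s: "0 \<le> s"
    and int: "\<And>j i. j \<in> g \<Longrightarrow> i < N \<Longrightarrow> integrable M (\<lambda>\<omega>. (W i \<omega> j)\<^sup>2)"
    and mean: "\<And>j i. j \<in> g \<Longrightarrow> i < N \<Longrightarrow> expectation (\<lambda>\<omega>. W i \<omega> j) = 0"
    and var: "\<And>v i. v \<in> B \<Longrightarrow> i < N \<Longrightarrow> expectation (\<lambda>\<omega>. (lin g v (W i \<omega>))\<^sup>2) \<le> s\<^sup>2"
  shows "\<exists>F\<in>events. prob F \<le> 4 * exp (- (K / 512)) \<and>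
    (\<forall>\<omega>\<in>space M - F. \<forall>v\<in>B.
      4 * card {k\<in>{..<K}. 8 * (s / sqrt m) < \<bar>(\<Sum>i\<in>block m k. lin g v (W i \<omega>)) / m\<bar>} \<le> K)"
proof -
  have rvW: "W i \<in> borel_measurable M" if "i < N" for i
    using ind that unfolding indep_vars_def by blast
  have rv: "(\<lambda>\<omega>. W i \<omega> j) \<in> borel_measurable M" if "i < N" for i j
    by (rule measurable_compose[OF rvW[OF that] borel_measurable_coordinate])
  have rvl: "(\<lambda>\<omega>. lin g v (W i \<omega>)) \<in> borel_measurable M" if "i < N" for i v
    by (rule measurable_compose[OF rvW[OF that] borel_measurable_lin])
  have int1: "integrable M (\<lambda>\<omega>. W i \<omega> j)" if "i < N" "j \<in> g" for i j
    by (rule square_integrable_imp_integrable[OF rv int]) (use that in auto)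
  have intl: "integrable M (\<lambda>\<omega>. (lin g v (W i \<omega>))\<^sup>2)" if i: "i < N" for i v
    unfolding lin_def
  proof (rule square_integrable_sum[OF g])
    fix j assume j: "j \<in> g"
    show "(\<lambda>\<omega>. W i \<omega> j * v j) \<in> borel_measurable M"
      by (intro borel_measurable_times rv i borel_measurable_const)
    show "integrable M (\<lambda>\<omega>. (W i \<omega> j * v j)\<^sup>2)"
      unfolding power_mult_distrib by (intro integrable_mult_left int j i)
  qed
  have meanl: "expectation (\<lambda>\<omega>. lin g v (W i \<omega>)) = 0" if i: "i < N" for i v
  proof -
    have "expectation (\<lambda>\<omega>. lin g v (W i \<omega>)) = (\<Sum>j\<in>g. expectation (\<lambda>\<omega>. W i \<omega> j * v j))"
      unfolding lin_def by (rule Bochner_Integration.integral_sum) (intro integrable_mult_left int1 i)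
    also have "\<dots> = 0" using mean i by (intro sum.neutral) auto
    finally show ?thesis .
  qed
  define Z where "Z k \<omega> = (\<lambda>j. (\<Sum>i\<in>block m k. W i \<omega> j) / m)" for k \<omega>
  have linZ: "lin g v (Z k \<omega>) = (\<Sum>i\<in>block m k. lin g v (W i \<omega>)) / m" for v k \<omega>
  proof -
    have "lin g v (Z k \<omega>) = lin g v (\<lambda>j. (1 / m) * (\<Sum>i\<in>block m k. W i \<omega> j))"
      by (simp add: Z_def)
    also have "\<dots> = (1 / m) * (\<Sum>i\<in>block m k. lin g v (W i \<omega>))"
      unfolding lin_cmul lin_sum ..
    finally show ?thesis by simp
  qed
  have bsub: "block m k \<subseteq> {..<N}" if "k < K" for k using block_subset[OF that m(2)] .
  have indZ: "indep_vars (\<lambda>_. borel) Z {..<K}"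
  proof -
    have 1: "indep_vars (\<lambda>k. PiM (block m k) (\<lambda>_. borel)) (\<lambda>k \<omega>. restrict (\<lambda>i. W i \<omega>) (block m k)) {..<K}"
    proof (rule indep_vars_restrict[OF ind])
      show "disjoint_family_on (block m) {..<K}"
        unfolding disjoint_family_on_def using block_div by blast
    qed (use bsub in auto)
    have 2: "(\<lambda>(w :: nat \<Rightarrow> nat \<Rightarrow> real) j. (\<Sum>i\<in>block m k. w i j) / m) \<in> measurable (PiM (block m k) (\<lambda>_. borel)) borel" for k
    proof (rule measurable_coordinatewise_then_product)
      fix j
      have "(\<lambda>w. w i j) \<in> borel_measurable (PiM (block m k) (\<lambda>_. borel :: (nat \<Rightarrow> real) measure))"
        if "i \<in> block m k" for i
        by (rule measurable_compose[OF measurable_component_singleton[OF that] borel_measurable_coordinate])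
      then show "(\<lambda>w. (\<Sum>i\<in>block m k. w i j) / m) \<in> borel_measurable (PiM (block m k) (\<lambda>_. borel :: (nat \<Rightarrow> real) measure))"
        by (intro borel_measurable_divide borel_measurable_sum borel_measurable_const) auto
    qed
    have "indep_vars (\<lambda>_. borel) (\<lambda>k \<omega>. (\<lambda>j. (\<Sum>i\<in>block m k. restrict (\<lambda>i. W i \<omega>) (block m k) i j) / m)) {..<K}"
      by (rule indep_vars_compose2[OF 1]) (rule 2)
    moreover have "(\<lambda>k \<omega>. (\<lambda>j. (\<Sum>i\<in>block m k. restrict (\<lambda>i. W i \<omega>) (block m k) i j) / m)) = Z"
      by (intro ext) (auto simp: Z_def intro!: arg_cong[where f = "\<lambda>t. t / m"] sum.cong)
    ultimately show ?thesis by simp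
  qed
  have intS: "integrable M (\<lambda>\<omega>. (\<Sum>i\<in>block m k. lin g v (W i \<omega>))\<^sup>2)" if k: "k < K" for v k
    using bsub[OF k] by (intro square_integrable_sum rvl intl) auto
  have intZ: "integrable M (\<lambda>\<omega>. (lin g v (Z k \<omega>))\<^sup>2)" if k: "k < K" for v k
    unfolding linZ power_divide by (intro integrable_divide intS k)
  have varZ: "expectation (\<lambda>\<omega>. (lin g v (Z k \<omega>))\<^sup>2) \<le> (s / sqrt m)\<^sup>2" if v: "v \<in> B" and k: "k < K" for v k
  proof -
    have "indep_vars (\<lambda>_. borel) (\<lambda>i \<omega>. lin g v (W i \<omega>)) (block m k)"
      by (rule indep_vars_compose2[OF indep_vars_subset[OF ind bsub[OF k]]]) (rule borel_measurable_lin)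
    then have "expectation (\<lambda>\<omega>. (\<Sum>i\<in>block m k. lin g v (W i \<omega>))\<^sup>2) \<le> card (block m k) * s\<^sup>2"
      using bsub[OF k] by (intro second_moment_sum) (auto intro: intl meanl var[OF v])
    then have "expectation (\<lambda>\<omega>. (lin g v (Z k \<omega>))\<^sup>2) \<le> (m * s\<^sup>2) / m\<^sup>2"
      unfolding linZ power_divide by (simp add: divide_right_mono)
    also have "\<dots> = (s / sqrt m)\<^sup>2" using m by (simp add: power_divide power2_eq_square)
    finally show ?thesis .
  qed
  have "0 \<le> s / sqrt m" using s by simp
  from uniform_tail[OF indZ g vc K this intZ varZ] show ?thesis
    unfolding linZ .
qed

locale mean_problem = dual_pair d ip U B + prob_space M
  for d ip U B and M :: "'w measure" +
  fixes N :: nat and Y :: "nat \<Rightarrow> 'w \<Rightarrow> nat \<Rightarrow> real"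
  assumes N: "0 < N" and iid: "iid_vectors M d N Y"
    and second_moments: "finite_second_moments M d (Y 0)" and mean_U: "mean_vec M (Y 0) \<in> U"
begin

abbreviation "\<mu> \<equiv> mean_vec M (Y 0)"

text \<open>
  \<open>coord\<close> is linear on \<open>\<real>\<^sup>d\<close> only, and \<open>ip\<close> is unconstrained elsewhere. This linear formula agrees with
  it on \<open>\<real>\<^sup>d\<close> and is a measurable function of all sequences.
\<close>

definition coord_ext :: "(nat \<Rightarrow> real) \<Rightarrow> nat \<Rightarrow> real" where
  "coord_ext x j = (\<Sum>l<d. x l * ip (\<lambda>i. of_bool (i = l)) (onb j))"

definition W :: "nat \<Rightarrow> 'w \<Rightarrow> nat \<Rightarrow> real" where
  "W i \<omega> j = coord_ext (Y i \<omega>) j - coord_ext \<mu> j"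

lemma \<mu>_Rd: "\<mu> \<in> Rd d" using mean_U U by auto

lemma Y_Rd: "i < N \<Longrightarrow> \<omega> \<in> space M \<Longrightarrow> Y i \<omega> \<in> Rd d"
  using iid unfolding iid_vectors_def by blast

lemma Y_indep: "indep_vars (\<lambda>_. borel) Y {..<N}"
  using iid unfolding iid_vectors_def by blast

lemma Y_rv: "i < N \<Longrightarrow> Y i \<in> borel_measurable M"
  using Y_indep unfolding indep_vars_def by blast

lemma coord_ext_eq: "x \<in> Rd d \<Longrightarrow> j < d \<Longrightarrow> coord_ext x j = coord x j"
proof -
  assume x: "x \<in> Rd d" and j: "j < d"
  have "x = (\<lambda>i. \<Sum>l<d. x l * of_bool (i = l))"
  proof
    fix i
    show "x i = (\<Sum>l<d. x l * of_bool (i = l))"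
      using x by (cases "i < d") (auto simp: Rd_iff of_bool_def if_distrib cong: if_cong)
  qed
  moreover have "ip (\<lambda>i. \<Sum>l<d. x l * of_bool (i = l)) (onb j) = coord_ext x j"
    unfolding coord_ext_def by (rule ip_sum_left) (use onb_Rd[OF j] in \<open>auto simp: Rd_iff\<close>)
  ultimately show "coord_ext x j = coord x j" by (simp add: coord_def)
qed

lemma W_eq_coord:
  "i < N \<Longrightarrow> \<omega> \<in> space M \<Longrightarrow> j < d \<Longrightarrow> W i \<omega> j = coord (Y i \<omega>) j - coord \<mu> j"
  by (simp add: W_def coord_ext_eq \<mu>_Rd Y_Rd)

lemma lin_W:
  "i < N \<Longrightarrow> \<omega> \<in> space M \<Longrightarrow> g \<subseteq> {..<d} \<Longrightarrow> lin g v (W i \<omega>) = lin g v (\<lambda>j. coord (Y i \<omega>) j - coord \<mu> j)"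
  unfolding lin_def by (rule sum.cong) (auto simp: W_eq_coord)

lemma coord_ext_borel: "(\<lambda>x. coord_ext x j) \<in> borel_measurable borel"
  unfolding coord_ext_def
  by (intro borel_measurable_sum borel_measurable_times borel_measurable_coordinate borel_measurable_const)

lemma center_borel: "(\<lambda>x j. coord_ext x j - coord_ext \<mu> j) \<in> borel_measurable borel"
  by (intro measurable_coordinatewise_then_product borel_measurable_diff coord_ext_borel borel_measurable_const)

lemma W_indep: "indep_vars (\<lambda>_. borel) W {..<N}"
proof -
  have "indep_vars (\<lambda>_. borel) (\<lambda>i \<omega> j. coord_ext (Y i \<omega>) j - coord_ext \<mu> j) {..<N}"
    by (rule indep_vars_compose2[OF Y_indep]) (rule center_borel)
  moreover have "(\<lambda>i \<omega> j. coord_ext (Y i \<omega>) j - coord_ext \<mu> j) = W" by (simp add: W_def fun_eq_iff)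
  ultimately show ?thesis by simp
qed

text \<open>
  The observations have the same law, so moments need only be computed for the first one.
\<close>

lemma W_law:
  assumes i: "i < N" and \<phi>: "\<phi> \<in> borel_measurable borel"
  shows "integrable M (\<lambda>\<omega>. \<phi> (W i \<omega>) :: real) \<longleftrightarrow> integrable M (\<lambda>\<omega>. \<phi> (W 0 \<omega>))"
    and "expectation (\<lambda>\<omega>. \<phi> (W i \<omega>)) = expectation (\<lambda>\<omega>. \<phi> (W 0 \<omega>))"
proof -
  let ?\<psi> = "\<lambda>x. \<phi> (\<lambda>j. coord_ext x j - coord_ext \<mu> j)"
  have \<psi>: "?\<psi> \<in> borel_measurable borel" by (rule measurable_compose[OF center_borel \<phi>])
  have W: "W k \<omega> = (\<lambda>j. coord_ext (Y k \<omega>) j - coord_ext \<mu> j)" for k \<omega> by (simp add: W_def fun_eq_iff)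
  have law: "distr M borel (Y i) = distr M borel (Y 0)" using iid i unfolding iid_vectors_def by blast
  show "integrable M (\<lambda>\<omega>. \<phi> (W i \<omega>)) \<longleftrightarrow> integrable M (\<lambda>\<omega>. \<phi> (W 0 \<omega>))"
    unfolding W using integrable_distr_eq[OF Y_rv[OF i] \<psi>] integrable_distr_eq[OF Y_rv[OF N] \<psi>] law by simp
  show "expectation (\<lambda>\<omega>. \<phi> (W i \<omega>)) = expectation (\<lambda>\<omega>. \<phi> (W 0 \<omega>))"
    unfolding W using integral_distr[OF Y_rv[OF i] \<psi>] integral_distr[OF Y_rv[OF N] \<psi>] law by simp
qed

lemma Y0_coord_rv: "(\<lambda>\<omega>. Y 0 \<omega> l) \<in> borel_measurable M"
  by (rule measurable_compose[OF Y_rv[OF N] borel_measurable_coordinate])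

lemma Y0_integrable: "l < d \<Longrightarrow> integrable M (\<lambda>\<omega>. Y 0 \<omega> l)"
  by (rule square_integrable_imp_integrable[OF Y0_coord_rv])
     (use second_moments in \<open>simp add: finite_second_moments_def\<close>)

lemma W0_sum: "W 0 \<omega> j = (\<Sum>l<d. (Y 0 \<omega> l - \<mu> l) * ip (\<lambda>i. of_bool (i = l)) (onb j))"
  by (simp add: W_def coord_ext_def left_diff_distrib sum_subtractf)

lemma W_square_integrable: "i < N \<Longrightarrow> integrable M (\<lambda>\<omega>. (W i \<omega> j)\<^sup>2)"
proof -
  assume i: "i < N"
  have "integrable M (\<lambda>\<omega>. (W 0 \<omega> j)\<^sup>2)"
    unfolding W0_sum
  proof (rule square_integrable_sum)
    fix l assume l: "l \<in> {..<d}"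
    show "(\<lambda>\<omega>. (Y 0 \<omega> l - \<mu> l) * ip (\<lambda>i. of_bool (i = l)) (onb j)) \<in> borel_measurable M"
      by (intro borel_measurable_times borel_measurable_diff Y0_coord_rv borel_measurable_const)
    have "integrable M (\<lambda>\<omega>. (Y 0 \<omega> l - \<mu> l)\<^sup>2)"
      unfolding power2_diff using l second_moments Y0_integrable
      by (intro Bochner_Integration.integrable_add Bochner_Integration.integrable_diff integrable_mult_left integrable_mult_right)
         (auto simp: finite_second_moments_def)
    then show "integrable M (\<lambda>\<omega>. ((Y 0 \<omega> l - \<mu> l) * ip (\<lambda>i. of_bool (i = l)) (onb j))\<^sup>2)"
      unfolding power_mult_distrib by (rule integrable_mult_left)
  qed simp
  moreover have "(\<lambda>x::nat \<Rightarrow> real. (x j)\<^sup>2) \<in> borel_measurable borel"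
    by (intro borel_measurable_power borel_measurable_coordinate)
  ultimately show ?thesis using W_law(1)[OF i, of "\<lambda>x. (x j)\<^sup>2"] by simp
qed

lemma W_mean: "i < N \<Longrightarrow> expectation (\<lambda>\<omega>. W i \<omega> j) = 0"
proof -
  assume i: "i < N"
  have "expectation (\<lambda>\<omega>. W 0 \<omega> j) = (\<Sum>l<d. expectation (\<lambda>\<omega>. (Y 0 \<omega> l - \<mu> l) * ip (\<lambda>i. of_bool (i = l)) (onb j)))"
    unfolding W0_sum by (rule Bochner_Integration.integral_sum) (use Y0_integrable in auto)
  also have "\<dots> = 0"
  proof (rule sum.neutral, rule ballI)
    fix l assume "l \<in> {..<d}"
    then have "expectation (\<lambda>\<omega>. Y 0 \<omega> l - \<mu> l) = 0"
      using Y0_integrable[of l] by (simp add: prob_space mean_vec_def)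
    then show "expectation (\<lambda>\<omega>. (Y 0 \<omega> l - \<mu> l) * ip (\<lambda>i. of_bool (i = l)) (onb j)) = 0" by simp
  qed
  finally show ?thesis using W_law(2)[OF i borel_measurable_coordinate] by simp
qed

abbreviation "R \<equiv> weak_sd M ip B (Y 0)"

lemma ip_centered: "v \<in> B \<Longrightarrow> \<omega> \<in> space M \<Longrightarrow>
    ip (vminus (Y 0 \<omega>) \<mu>) v = lin {..<d} (coord v) (W 0 \<omega>)"
  using Y_Rd[OF N] \<mu>_Rd B_ball[of v]
  by (simp add: ip_eq_lin lin_W[OF N]) (auto simp: lin_def coord_diff intro!: sum.cong)

text \<open>
  The supremum in the definition of \<open>R\<close> is over a bounded set: on the dual ball the second moments are at
  most the total variance.
\<close>

lemma weak_variance_bound: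
  "v \<in> B \<Longrightarrow> expectation (\<lambda>\<omega>. (ip (vminus (Y 0 \<omega>) \<mu>) v)\<^sup>2) \<le> R\<^sup>2" and R_nonneg: "0 \<le> R"
proof -
  let ?f = "\<lambda>v. expectation (\<lambda>\<omega>. (ip (vminus (Y 0 \<omega>) \<mu>) v)\<^sup>2)"
  let ?b = "expectation (\<lambda>\<omega>. \<Sum>j<d. (W 0 \<omega> j)\<^sup>2)"
  have "?f v \<le> ?b" if v: "v \<in> B" for v
  proof (rule Bochner_Integration.integral_mono')
    show "integrable M (\<lambda>\<omega>. \<Sum>j<d. (W 0 \<omega> j)\<^sup>2)"
      by (intro Bochner_Integration.integrable_sum W_square_integrable N)
    fix \<omega> assume \<omega>: "\<omega> \<in> space M"
    have nv: "L2_set (coord v) {..<d} \<le> 1" using B_ball[OF v] ip_norm_eq[of v] by simp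
    have "\<bar>ip (vminus (Y 0 \<omega>) \<mu>) v\<bar> \<le> L2_set (W 0 \<omega>) {..<d} * L2_set (coord v) {..<d}"
      unfolding ip_centered[OF v \<omega>] by (rule lin_le_L2)
    also have "\<dots> \<le> L2_set (W 0 \<omega>) {..<d}" using nv by (intro mult_left_le) auto
    finally have "\<bar>ip (vminus (Y 0 \<omega>) \<mu>) v\<bar>\<^sup>2 \<le> (L2_set (W 0 \<omega>) {..<d})\<^sup>2"
      by (intro power_mono) auto
    also have "\<dots> = (\<Sum>j<d. (W 0 \<omega> j)\<^sup>2)" unfolding L2_set_def by (intro real_sqrt_pow2 sum_nonneg) auto
    finally show "(ip (vminus (Y 0 \<omega>) \<mu>) v)\<^sup>2 \<le> (\<Sum>j<d. (W 0 \<omega> j)\<^sup>2)" by simp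
  qed (auto intro: sum_nonneg)
  then have bdd: "bdd_above (?f ` B)" by (auto intro!: bdd_aboveI2)
  have up: "?f v \<le> (SUP v\<in>B. ?f v)" if "v \<in> B" for v by (rule cSUP_upper[OF that bdd])
  obtain v where "v \<in> B" using B_nonempty by blast
  then have "0 \<le> (SUP v\<in>B. ?f v)" using up[of v] by (intro order_trans[OF _ up]) auto
  then show "0 \<le> R" "v \<in> B \<Longrightarrow> ?f v \<le> R\<^sup>2" for v using up by (auto simp: weak_sd_def)
qed

lemma W_variance:
  assumes "v \<in> B" "i < N"
  shows "expectation (\<lambda>\<omega>. (lin {..<d} (coord v) (W i \<omega>))\<^sup>2) \<le> R\<^sup>2"
proof -
  have "expectation (\<lambda>\<omega>. (lin {..<d} (coord v) (W i \<omega>))\<^sup>2) = expectation (\<lambda>\<omega>. (lin {..<d} (coord v) (W 0 \<omega>))\<^sup>2)"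
    by (rule W_law(2)[OF assms(2), of "\<lambda>x. (lin {..<d} (coord v) x)\<^sup>2"])
       (intro borel_measurable_power borel_measurable_lin)
  also have "\<dots> = expectation (\<lambda>\<omega>. (ip (vminus (Y 0 \<omega>) \<mu>) v)\<^sup>2)"
    by (rule Bochner_Integration.integral_cong) (auto simp: ip_centered[OF assms(1)])
  also have "\<dots> \<le> R\<^sup>2" by (rule weak_variance_bound[OF assms(1)])
  finally show ?thesis .
qed

end

section \<open>Centres of a majority of block means\<close>

text \<open>
  Any candidate \<open>a\<close> whose radius is less than twice the infimum \<open>m\<close> of all radii will do. If \<open>m = 0\<close>, there
  may be no such candidate; but then candidates whose radii tend to \<open>0\<close> form a Cauchy sequence, and
  its limit is even within \<open>\<eta>\<close> of every candidate of radius \<open>\<eta>\<close>. The limit is not a candidate in general.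
\<close>

lemma exists_center:
  fixes S :: "((nat \<Rightarrow> real) \<times> real) set"
  assumes g: "finite g"
    and S: "\<And>a \<eta> a' \<eta>'. (a, \<eta>) \<in> S \<Longrightarrow> (a', \<eta>') \<in> S \<Longrightarrow> L2_set (\<lambda>j. a j - a' j) g \<le> \<eta> + \<eta>'"
  shows "\<exists>y. \<forall>(a, \<eta>)\<in>S. L2_set (\<lambda>j. y j - a j) g \<le> 3 * \<eta>"
proof (cases "S = {}")
  case False
  have nonneg: "0 \<le> \<eta>" if "(a, \<eta>) \<in> S" for a \<eta>
    using S[OF that that] by (simp add: L2_set_def)
  define m where "m = Inf (snd ` S)"
  have bdd: "bdd_below (snd ` S)" using nonneg by (auto intro!: bdd_belowI[of _ 0])
  have mle: "m \<le> \<eta>" if "(a, \<eta>) \<in> S" for a \<eta>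
    unfolding m_def by (rule cInf_lower[OF _ bdd]) (use that in force)
  have m0: "0 \<le> m" unfolding m_def using False nonneg by (intro cInf_greatest) auto
  have near: "\<exists>a \<eta>. (a, \<eta>) \<in> S \<and> \<eta> < m + e" if "e > 0" for e
  proof -
    have "\<exists>z\<in>snd ` S. z < m + e"
      using cInf_lessD[of "snd ` S" "m + e"] False that unfolding m_def by auto
    then show ?thesis by force
  qed
  show ?thesis
  proof (cases "m > 0")
    case True
    then obtain a \<eta> where a: "(a, \<eta>) \<in> S" "\<eta> < m + m" using near by blast
    have "L2_set (\<lambda>j. a j - a' j) g \<le> 3 * \<eta>'" if "(a', \<eta>') \<in> S" for a' \<eta>'
      using S[OF a(1) that] mle[OF that] a(2) by linarith
    then show ?thesis by (intro exI[of _ a]) auto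
  next
    case False
    then have m: "m = 0" using m0 by simp
    have "\<exists>a \<eta>. (a, \<eta>) \<in> S \<and> \<eta> < 1 / real (Suc n)" for n
      using near[of "1 / real (Suc n)"] m by simp
    then obtain a \<eta> where a: "\<And>n. (a n, \<eta> n) \<in> S" "\<And>n. \<eta> n < 1 / real (Suc n)" by metis
    have coord: "\<bar>a n j - a k j\<bar> \<le> \<eta> n + \<eta> k" if "j \<in> g" for n k j
      using member_le_L2_set[OF g that, of "\<lambda>j. \<bar>a n j - a k j\<bar>"] S[OF a(1)[of n] a(1)[of k]]
      by (simp add: L2_set_def)
    have "convergent (\<lambda>n. a n j)" if "j \<in> g" for j
    proof (rule Cauchy_convergent, rule metric_CauchyI)
      fix e :: real assume "e > 0"
      then obtain N :: nat where N: "1 / real (Suc N) < e / 2"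
        using nat_approx_posE[of "e/2"] by auto
      have "\<eta> n < e / 2" if "n \<ge> N" for n
      proof -
        have "1 / real (Suc n) \<le> 1 / real (Suc N)" using that by (intro divide_left_mono) auto
        then show ?thesis using a(2)[of n] N by linarith
      qed
      then show "\<exists>M. \<forall>m\<ge>M. \<forall>n\<ge>M. dist (a m j) (a n j) < e"
        using coord[OF that] by (intro exI[of _ N] allI impI) (smt (verit) dist_real_def field_sum_of_halves)
    qed
    then have lim: "(\<lambda>n. a n j) \<longlonglongrightarrow> lim (\<lambda>n. a n j)" if "j \<in> g" for j
      using that convergent_LIMSEQ_iff by blast
    have "L2_set (\<lambda>j. lim (\<lambda>n. a n j) - b j) g \<le> 3 * \<theta>" if b: "(b, \<theta>) \<in> S" for b \<theta>
    proof -
      have "(\<lambda>n. L2_set (\<lambda>j. a n j - b j) g) \<longlonglongrightarrow> L2_set (\<lambda>j. lim (\<lambda>n. a n j) - b j) g"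
        unfolding L2_set_def by (intro tendsto_intros lim)
      moreover have "(\<lambda>n. 1 / real (Suc n) + \<theta>) \<longlonglongrightarrow> 0 + \<theta>"
        by (intro tendsto_intros LIMSEQ_Suc[OF lim_1_over_n])
      moreover have "L2_set (\<lambda>j. a n j - b j) g \<le> 1 / real (Suc n) + \<theta>" for n
        using S[OF a(1)[of n] b] a(2)[of n] by linarith
      ultimately have "L2_set (\<lambda>j. lim (\<lambda>n. a n j) - b j) g \<le> 0 + \<theta>"
        by (intro LIMSEQ_le) auto
      then show ?thesis using nonneg[OF b] by simp
    qed
    then show ?thesis by (intro exI[of _ "\<lambda>j. lim (\<lambda>n. a n j)"]) auto
  qed
qed simp

abbreviation sample :: "nat \<Rightarrow> (nat \<Rightarrow> 'w \<Rightarrow> 'x) \<Rightarrow> 'w \<Rightarrow> nat \<Rightarrow> 'x" where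
  "sample N X \<omega> \<equiv> (\<lambda>i\<in>{..<N}. X i \<omega>)"

context dual_pair
begin

definition block_mean :: "nat \<Rightarrow> (nat \<Rightarrow> nat \<Rightarrow> real) \<Rightarrow> nat \<Rightarrow> nat \<Rightarrow> real" where
  "block_mean m x k = (\<lambda>j. (1 / m) * (\<Sum>i\<in>block m k. x i j))"

lemma block_mean_Rd:
  "(\<And>i. i \<in> block m k \<Longrightarrow> x i \<in> Rd d) \<Longrightarrow> block_mean m x k \<in> Rd d"
  unfolding block_mean_def by (intro Rd_simps(4,5))

definition far_blocks :: "nat \<Rightarrow> nat \<Rightarrow> (nat \<Rightarrow> nat \<Rightarrow> real) \<Rightarrow> (nat \<Rightarrow> real) \<Rightarrow> (nat \<Rightarrow> real) \<Rightarrow> real \<Rightarrow> nat set" where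
  "far_blocks K m x u v \<eta> = {k\<in>{..<K}. \<eta> < \<bar>ip (vminus (block_mean m x k) u) v\<bar>}"

lemma finite_far_blocks [simp]: "finite (far_blocks K m x u v \<eta>)"
  by (simp add: far_blocks_def)

text \<open>
  In each direction \<open>v\<close> two majorities of blocks intersect, and a common block is close to both points.
\<close>

lemma norm_le_if_majority_close:
  assumes x: "\<And>i. i < N \<Longrightarrow> x i \<in> Rd d" and m: "m * K \<le> N"
    and u: "u \<in> U" "\<And>v. v \<in> B \<Longrightarrow> 2 * card (far_blocks K m x u v \<eta>) < K"
    and w: "w \<in> U" "\<And>v. v \<in> B \<Longrightarrow> 2 * card (far_blocks K m x w v \<theta>) < K"
  shows "ip_norm ip (vminus u w) \<le> \<eta> + \<theta>"
proof (rule norm_le_if_functionals_le[OF u(1) w(1)])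
  fix v assume v: "v \<in> B"
  have "card (far_blocks K m x u v \<eta> \<union> far_blocks K m x w v \<theta>) < card {..<K}"
    using card_Un_le[of "far_blocks K m x u v \<eta>" "far_blocks K m x w v \<theta>"] u(2)[OF v] w(2)[OF v] by simp
  then have "\<not> {..<K} \<subseteq> far_blocks K m x u v \<eta> \<union> far_blocks K m x w v \<theta>"
    using card_mono[of "far_blocks K m x u v \<eta> \<union> far_blocks K m x w v \<theta>" "{..<K}"] by (auto simp: not_le[symmetric])
  then obtain k where "k < K" "k \<notin> far_blocks K m x u v \<eta>" "k \<notin> far_blocks K m x w v \<theta>" by blast
  then have k: "k < K" "\<bar>ip (vminus (block_mean m x k) u) v\<bar> \<le> \<eta>"
    "\<bar>ip (vminus (block_mean m x k) w) v\<bar> \<le> \<theta>" by (auto simp: far_blocks_def)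
  let ?b = "block_mean m x k"
  have b: "?b \<in> Rd d" using block_subset[OF k(1) m] x by (intro block_mean_Rd) auto
  have uR: "u \<in> Rd d" "w \<in> Rd d" "v \<in> Rd d" using u w U B_ball[OF v] by auto
  have "ip (vminus u w) v = ip (vminus ?b w) v - ip (vminus ?b u) v"
    using b uR by (simp add: ip_diff_left)
  then show "ip (vminus u w) v \<le> \<eta> + \<theta>" using k by linarith
qed

text \<open>
  The candidates are all points of \<open>U\<close> together with all their good radii; they are determined by the
  data, so the estimator depends neither on the scale \<open>R\<close> nor on the law of the observations.
\<close>

lemma median_of_means_estimator:
  assumes m: "m * K \<le> N"
  shows "\<exists>muhat \<in> ({..<N} \<rightarrow>\<^sub>E Rd d) \<rightarrow> Rd d. \<forall>x\<in>{..<N} \<rightarrow>\<^sub>E Rd d. \<forall>u\<in>U. \<forall>\<eta>.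
    (\<forall>v\<in>B. 2 * card (far_blocks K m x u v \<eta>) < K) \<longrightarrow> ip_norm ip (vminus (muhat x) u) \<le> 3 * \<eta>"
proof -
  define S where "S x = {(coord u, \<eta>) |u \<eta>. u \<in> U \<and> (\<forall>v\<in>B. 2 * card (far_blocks K m x u v \<eta>) < K)}" for x
  have "\<exists>y. \<forall>(a, \<eta>)\<in>S x. L2_set (\<lambda>j. y j - a j) {..<d} \<le> 3 * \<eta>" if x: "x \<in> {..<N} \<rightarrow>\<^sub>E Rd d" for x
  proof (rule exists_center)
    fix a \<eta> a' \<eta>' assume "(a, \<eta>) \<in> S x" "(a', \<eta>') \<in> S x"
    then obtain u w where u: "a = coord u" "u \<in> U" "\<And>v. v \<in> B \<Longrightarrow> 2 * card (far_blocks K m x u v \<eta>) < K"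
      and w: "a' = coord w" "w \<in> U" "\<And>v. v \<in> B \<Longrightarrow> 2 * card (far_blocks K m x w v \<eta>') < K"
      unfolding S_def by blast
    have xR: "x i \<in> Rd d" if "i < N" for i using x that by auto
    have "ip_norm ip (vminus u w) \<le> \<eta> + \<eta>'"
      by (rule norm_le_if_majority_close[OF xR m u(2,3) w(2,3)])
    moreover have "u \<in> Rd d" "w \<in> Rd d" using u(2) w(2) U by auto
    ultimately show "L2_set (\<lambda>j. a j - a' j) {..<d} \<le> \<eta> + \<eta>'"
      unfolding u(1) w(1) using ip_norm_diff[of u w] by simp
  qed simp
  then have "\<forall>x\<in>{..<N} \<rightarrow>\<^sub>E Rd d. \<exists>y. \<forall>(a, \<eta>)\<in>S x. L2_set (\<lambda>j. y j - a j) {..<d} \<le> 3 * \<eta>" by blast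
  from bchoice[OF this] obtain y where
    y0: "\<forall>x\<in>{..<N} \<rightarrow>\<^sub>E Rd d. \<forall>(a, \<eta>)\<in>S x. L2_set (\<lambda>j. y x j - a j) {..<d} \<le> 3 * \<eta>" by blast
  have y: "L2_set (\<lambda>j. y x j - a j) {..<d} \<le> 3 * \<eta>" if "x \<in> {..<N} \<rightarrow>\<^sub>E Rd d" "(a, \<eta>) \<in> S x" for x a \<eta>
    using bspec[OF bspec[OF y0 that(1)] that(2)] by simp
  have "ip_norm ip (vminus (vec (y x)) u) \<le> 3 * \<eta>"
    if "x \<in> {..<N} \<rightarrow>\<^sub>E Rd d" "u \<in> U" "\<forall>v\<in>B. 2 * card (far_blocks K m x u v \<eta>) < K" for x u \<eta>
  proof -
    have "(coord u, \<eta>) \<in> S x" using that by (auto simp: S_def)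
    then have "L2_set (\<lambda>j. y x j - coord u j) {..<d} \<le> 3 * \<eta>" by (rule y[OF that(1)])
    moreover have "u \<in> Rd d" using that(2) U by auto
    then have "ip_norm ip (vminus (vec (y x)) u) = L2_set (\<lambda>j. coord (vec (y x)) j - coord u j) {..<d}"
      by (intro ip_norm_diff) auto
    moreover have "\<dots> = L2_set (\<lambda>j. y x j - coord u j) {..<d}"
      by (rule L2_set_cong) (auto simp: coord_vec)
    ultimately show ?thesis by simp
  qed
  then show ?thesis by (intro bexI[of _ "\<lambda>x. vec (y x)"]) auto
qed

end

lemma contaminated_bound:
  assumes "contaminated M d N \<epsilon> Y X" "8 * \<epsilon> * real N \<le> real K"
  shows "\<exists>S. \<forall>\<omega>\<in>space M. S \<omega> \<subseteq> {..<N} \<and> 8 * card (S \<omega>) \<le> K \<and> (\<forall>i\<in>{..<N} - S \<omega>. X i \<omega> = Y i \<omega>)"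
proof -
  obtain S where S: "\<forall>\<omega>\<in>space M. S \<omega> \<subseteq> {..<N} \<and> int (card (S \<omega>)) \<le> \<lfloor>\<epsilon> * real N\<rfloor> \<and>
      (\<forall>i\<in>{..<N} - S \<omega>. X i \<omega> = Y i \<omega>)"
    using assms(1) unfolding contaminated_def by blast
  have "8 * card (S \<omega>) \<le> K" if "\<omega> \<in> space M" for \<omega>
  proof -
    have "int (card (S \<omega>)) \<le> \<lfloor>\<epsilon> * real N\<rfloor>" using S that by blast
    then have "real (card (S \<omega>)) \<le> \<epsilon> * real N" by (simp add: le_floor_iff)
    then show ?thesis using assms(2) by linarith
  qed
  then show ?thesis using S by (intro exI[of _ S]) blast
qed

context mean_problem
begin

lemma block_mean_error:
  assumes x: "\<And>i. i \<in> block m k \<Longrightarrow> x i = Y i \<omega>" and \<omega>: "\<omega> \<in> space M" and b: "block m k \<subseteq> {..<N}"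
    and m: "0 < m" and v: "v \<in> B"
  shows "ip (vminus (block_mean m x k) \<mu>) v = (\<Sum>i\<in>block m k. lin {..<d} (coord v) (W i \<omega>)) / m"
proof -
  have vR: "v \<in> Rd d" using B_ball[OF v] by blast
  have YR: "Y i \<omega> \<in> Rd d" if "i \<in> block m k" for i using Y_Rd[of i] \<omega> b that by auto
  have bR: "block_mean m x k \<in> Rd d" by (rule block_mean_Rd) (simp add: x YR)
  have sR: "(\<lambda>j. \<Sum>i\<in>block m k. 1 * Y i \<omega> j) \<in> Rd d" by (intro Rd_simps(5)) (use YR in simp)
  have "block_mean m x k = (\<lambda>j. (1 / m) * (\<Sum>i\<in>block m k. 1 * Y i \<omega> j))"
    unfolding block_mean_def using x by (auto intro!: sum.cong)
  then have "ip (block_mean m x k) v = (1 / m) * ip (\<lambda>j. \<Sum>i\<in>block m k. 1 * Y i \<omega> j) v"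
    by (simp only: ip_scale_left[OF sR vR])
  also have "ip (\<lambda>j. \<Sum>i\<in>block m k. 1 * Y i \<omega> j) v = (\<Sum>i\<in>block m k. 1 * ip (Y i \<omega>) v)"
    by (rule ip_sum_left) (use YR vR in auto)
  finally have 1: "ip (block_mean m x k) v = (\<Sum>i\<in>block m k. ip (Y i \<omega>) v) / m" by simp
  have "lin {..<d} (coord v) (W i \<omega>) = ip (Y i \<omega>) v - ip \<mu> v" if "i \<in> block m k" for i
    using that b \<omega> YR[OF that] \<mu>_Rd vR by (subst lin_W) (auto simp: lin_diff ip_eq_lin)
  then have "(\<Sum>i\<in>block m k. lin {..<d} (coord v) (W i \<omega>)) = (\<Sum>i\<in>block m k. ip (Y i \<omega>) v) - m * ip \<mu> v"
    by (simp add: sum_subtractf)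
  then show ?thesis
    unfolding ip_diff_left[OF bR \<mu>_Rd vR] 1 using m by (simp add: diff_divide_distrib)
qed

text \<open>
  At most a quarter of the clean block means are far from \<open>\<mu>\<close> in any direction, and the adversary reaches at
  most another eighth of the blocks, as a corrupted observation spoils only the block that contains it.
\<close>

lemma mean_is_central:
  assumes K: "10000 * (2 * the_enat (VC_vectors d ip B) + 1) \<le> K" and m: "0 < m" "m * K \<le> N"
    and \<epsilon>: "8 * \<epsilon> * real N \<le> real K" and cont: "contaminated M d N \<epsilon> Y X"
  shows "\<exists>A\<in>events. 1 - 4 * exp (- (K / 512)) \<le> prob A \<and>
    (\<forall>\<omega>\<in>A. \<forall>v\<in>B. 2 * card (far_blocks K m (sample N X \<omega>) \<mu> v (8 * (R / sqrt m))) < K)"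
proof -
  obtain S where S: "\<forall>\<omega>\<in>space M. S \<omega> \<subseteq> {..<N} \<and> 8 * card (S \<omega>) \<le> K \<and> (\<forall>i\<in>{..<N} - S \<omega>. X i \<omega> = Y i \<omega>)"
    using contaminated_bound[OF cont \<epsilon>] by blast
  have "\<exists>F\<in>events. prob F \<le> 4 * exp (- (K / 512)) \<and>
    (\<forall>\<omega>\<in>space M - F. \<forall>v\<in>coord ` B.
      4 * card {k\<in>{..<K}. 8 * (R / sqrt m) < \<bar>(\<Sum>i\<in>block m k. lin {..<d} v (W i \<omega>)) / m\<bar>} \<le> K)"
    by (rule block_means_tail[OF W_indep _ vc_le_B K m R_nonneg])
       (use W_square_integrable W_mean W_variance in auto)
  then obtain F where F: "F \<in> events" "prob F \<le> 4 * exp (- (K / 512))"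
    "\<And>\<omega> v. \<omega> \<in> space M - F \<Longrightarrow> v \<in> B \<Longrightarrow>
      4 * card {k\<in>{..<K}. 8 * (R / sqrt m) < \<bar>(\<Sum>i\<in>block m k. lin {..<d} (coord v) (W i \<omega>)) / m\<bar>} \<le> K"
    by blast
  have "2 * card (far_blocks K m (sample N X \<omega>) \<mu> v (8 * (R / sqrt m))) < K"
    if \<omega>: "\<omega> \<in> space M - F" and v: "v \<in> B" for \<omega> v
  proof -
    have "0 < K" using K by simp
    define x where "x = sample N X \<omega>"
    let ?G = "{k\<in>{..<K}. 8 * (R / sqrt m) < \<bar>(\<Sum>i\<in>block m k. lin {..<d} (coord v) (W i \<omega>)) / m\<bar>}"
    have \<omega>': "\<omega> \<in> space M" using \<omega> by simp
    from S[rule_format, OF \<omega>'] have S\<omega>: "S \<omega> \<subseteq> {..<N}" "8 * card (S \<omega>) \<le> K"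
      "\<And>i. i \<in> {..<N} - S \<omega> \<Longrightarrow> X i \<omega> = Y i \<omega>" by auto
    have fS: "finite (S \<omega>)" using S\<omega>(1) finite_lessThan by (rule finite_subset)
    have "far_blocks K m x \<mu> v (8 * (R / sqrt m)) \<subseteq> ?G \<union> (\<lambda>i. i div m) ` S \<omega>"
    proof
      fix k assume k: "k \<in> far_blocks K m x \<mu> v (8 * (R / sqrt m))"
      then have kK: "k < K" by (simp add: far_blocks_def)
      note bN = block_subset[OF kK m(2)]
      show "k \<in> ?G \<union> (\<lambda>i. i div m) ` S \<omega>"
      proof (cases "block m k \<inter> S \<omega> = {}")
        case True
        have "x i = Y i \<omega>" if "i \<in> block m k" for i
          using that True bN S\<omega>(3)[of i] by (auto simp: x_def)
        from block_mean_error[OF this \<omega>' bN m(1) v] k show ?thesis by (simp add: far_blocks_def)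
      next
        case False
        then obtain i where "i \<in> block m k" "i \<in> S \<omega>" by blast
        then show ?thesis using block_div[of i m k] by blast
      qed
    qed
    then have "card (far_blocks K m x \<mu> v (8 * (R / sqrt m))) \<le> card (?G \<union> (\<lambda>i. i div m) ` S \<omega>)"
      using fS by (intro card_mono) auto
    also have "\<dots> \<le> card ?G + card ((\<lambda>i. i div m) ` S \<omega>)" by (rule card_Un_le)
    also have "\<dots> \<le> card ?G + card (S \<omega>)" using card_image_le[OF fS] by simp
    finally show ?thesis unfolding x_def[symmetric] using F(3)[OF \<omega> v] S\<omega>(2) \<open>0 < K\<close> by linarith
  qed
  moreover have "prob (space M - F) \<ge> 1 - 4 * exp (- (K / 512))"
    using prob_compl[OF F(1)] F(2) by simp
  ultimately show ?thesis using F(1) by (intro bexI[of _ "space M - F"]) auto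
qed

end

section \<open>Estimation by groups of coordinates\<close>

text \<open>
  If more than \<open>N / 4\<close> of the numbers exceeded \<open>sqrt w\<close>, then the products of pairs of these alone would
  exceed the double sum. The factor \<open>32\<close> accounts for the number \<open>n (n - 1) \<ge> N\<^sup>2 / 32\<close> of such pairs.
\<close>

lemma few_large_of_pair_sum:
  fixes a :: "nat \<Rightarrow> real"
  assumes a: "\<And>i. i < N \<Longrightarrow> 0 \<le> a i" and N: "8 \<le> N"
  defines "w \<equiv> (32 / (real N)\<^sup>2) * (\<Sum>i<N. \<Sum>k\<in>{..<N} - {i}. a i * a k)"
  shows "4 * card {i\<in>{..<N}. sqrt w < a i} \<le> N"
proof (rule ccontr)
  let ?A = "{i\<in>{..<N}. sqrt w < a i}"
  define n where "n = card ?A"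
  assume "\<not> 4 * card ?A \<le> N"
  then have n: "N + 1 \<le> 4 * n" by (simp add: n_def)
  have nn: "0 \<le> (\<Sum>i<N. \<Sum>k\<in>{..<N} - {i}. a i * a k)" using a by (intro sum_nonneg mult_nonneg_nonneg) auto
  then have w0: "0 \<le> w" unfolding w_def by (intro mult_nonneg_nonneg) auto
  have prod: "w < a i * a k" if "i \<in> ?A" "k \<in> ?A" for i k
  proof -
    have "sqrt w * sqrt w < a i * a k"
      using that w0 by (intro mult_strict_mono') auto
    then show ?thesis using w0 by simp
  qed
  have "n * (n - 1) * w = (\<Sum>i\<in>?A. \<Sum>k\<in>?A - {i}. w)"
    by (simp add: n_def card_Diff_singleton_if)
  also have "\<dots> < (\<Sum>i\<in>?A. \<Sum>k\<in>?A - {i}. a i * a k)"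
  proof (rule sum_strict_mono)
    have "0 < card ?A" using n unfolding n_def by linarith
    then show "?A \<noteq> {}" by (metis card.empty less_irrefl)
    fix i assume i: "i \<in> ?A"
    have "card (?A - {i}) = n - 1" using i by (simp add: n_def)
    then have "0 < card (?A - {i})" using n N by linarith
    then have "?A - {i} \<noteq> {}" by (metis card.empty less_irrefl)
    then show "(\<Sum>k\<in>?A - {i}. w) < (\<Sum>k\<in>?A - {i}. a i * a k)"
      using i prod by (intro sum_strict_mono) auto
  qed simp
  also have "\<dots> \<le> (\<Sum>i\<in>?A. \<Sum>k\<in>{..<N} - {i}. a i * a k)"
    using a by (intro sum_mono sum_mono2) auto
  also have "\<dots> \<le> (\<Sum>i<N. \<Sum>k\<in>{..<N} - {i}. a i * a k)"
    using a by (intro sum_mono2) (auto intro!: sum_nonneg)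
  also have "\<dots> = w * (real N)\<^sup>2 / 32" using N by (simp add: w_def)
  finally have lt: "real (n * (n - 1)) * w < w * (real N)\<^sup>2 / 32" .
  have "(real N)\<^sup>2 / 32 \<le> real (n * (n - 1))"
  proof -
    have "real (N + 1) \<le> real (4 * n)" using n by (rule of_nat_mono)
    then have r1: "(real N + 1) / 4 \<le> real n" by simp
    have "1 \<le> n" using n N by linarith
    then have r2: "(real N - 3) / 4 \<le> real (n - 1)" using r1 by (simp add: of_nat_diff)
    note r = r1 r2
    have key: "p / 32 \<le> (p - 2 * x - 3) / 16" if "8 * x \<le> p" "8 \<le> x" for p x :: real using that by simp
    have "8 * real N \<le> real N * real N" using N by (intro mult_right_mono) auto
    then have "real N * real N / 32 \<le> (real N * real N - 2 * real N - 3) / 16"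
      by (rule key) (use N in simp)
    then have "(real N)\<^sup>2 / 32 \<le> ((real N + 1) / 4) * ((real N - 3) / 4)"
      by (simp add: power2_eq_square algebra_simps)
    also have "\<dots> \<le> real n * real (n - 1)" using r N by (intro mult_mono) auto
    finally show ?thesis by simp
  qed
  then have "w * ((real N)\<^sup>2 / 32) \<le> w * real (n * (n - 1))" using w0 by (rule mult_left_mono)
  then show False using lt by (simp add: mult.commute)
qed

definition lin_ball :: "nat set \<Rightarrow> (nat \<Rightarrow> real) set" where
  "lin_ball g = {v. L2_set v g \<le> 1}"

definition far_points ::
  "nat \<Rightarrow> nat set \<Rightarrow> (nat \<Rightarrow> nat \<Rightarrow> real) \<Rightarrow> (nat \<Rightarrow> real) \<Rightarrow> (nat \<Rightarrow> real) \<Rightarrow> real \<Rightarrow> nat set" where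
  "far_points N g z a v \<eta> = {k\<in>{..<N}. \<eta> < \<bar>lin g v (\<lambda>j. z k j - a j)\<bar>}"

lemma finite_far_points [simp]: "finite (far_points N g z a v \<eta>)"
  by (simp add: far_points_def)

text \<open>
  The two majorities are compared in the direction of \<open>a - b\<close> itself. If the distance is \<open>0\<close>, the direction is the
  zero vector by \<open>x / 0 = 0\<close>, and the argument still applies.
\<close>

lemma dist_le_if_majority_close:
  assumes "\<And>v. v \<in> lin_ball g \<Longrightarrow> 2 * card (far_points N g z a v \<eta>) < N"
    and "\<And>v. v \<in> lin_ball g \<Longrightarrow> 2 * card (far_points N g z b v \<theta>) < N"
  shows "L2_set (\<lambda>j. a j - b j) g \<le> \<eta> + \<theta>"
proof -
  define n where "n = L2_set (\<lambda>j. a j - b j) g"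
  define v where "v j = (a j - b j) / n" for j
  have nn: "0 \<le> n" by (simp add: n_def)
  have sq: "(\<Sum>j\<in>g. (a j - b j)\<^sup>2) = n\<^sup>2"
    unfolding n_def L2_set_def by (rule real_sqrt_pow2[symmetric]) (auto intro: sum_nonneg)
  have "L2_set v g = sqrt (n\<^sup>2 / n\<^sup>2)"
    unfolding L2_set_def v_def power_divide sum_divide_distrib[symmetric] sq ..
  also have "\<dots> \<le> 1" by simp
  finally have v: "v \<in> lin_ball g" by (simp add: lin_ball_def)
  have "lin g v (\<lambda>j. a j - b j) = (\<Sum>j\<in>g. (a j - b j)\<^sup>2) / n"
    unfolding lin_def v_def sum_divide_distrib by (rule sum.cong) (auto simp: power2_eq_square)
  then have val: "lin g v (\<lambda>j. a j - b j) = n" unfolding sq by (simp add: power2_eq_square)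
  have "card (far_points N g z a v \<eta> \<union> far_points N g z b v \<theta>) < card {..<N}"
    using card_Un_le[of "far_points N g z a v \<eta>" "far_points N g z b v \<theta>"] assms[OF v] by simp
  then have "\<not> {..<N} \<subseteq> far_points N g z a v \<eta> \<union> far_points N g z b v \<theta>"
    using card_mono[of "far_points N g z a v \<eta> \<union> far_points N g z b v \<theta>" "{..<N}"] by (auto simp: not_le[symmetric])
  then obtain k where "k < N" "k \<notin> far_points N g z a v \<eta>" "k \<notin> far_points N g z b v \<theta>" by blast
  then have "\<bar>lin g v (\<lambda>j. z k j - a j)\<bar> \<le> \<eta>" "\<bar>lin g v (\<lambda>j. z k j - b j)\<bar> \<le> \<theta>"
    by (auto simp: far_points_def)
  then have "n \<le> \<eta> + \<theta>" unfolding val[symmetric] by (simp add: lin_diff)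
  then show ?thesis by (simp add: n_def)
qed

text \<open>
  The median-of-means estimator for the coordinates in \<open>g\<close>, with each observation as its own block.
\<close>

lemma coordinate_group_estimator:
  assumes g: "finite g"
  shows "\<exists>y. \<forall>z a \<eta>. (\<forall>v\<in>lin_ball g. 2 * card (far_points N g z a v \<eta>) < N) \<longrightarrow>
    L2_set (\<lambda>j. y z j - a j) g \<le> 3 * \<eta>"
proof -
  define S where "S z = {(a, \<eta>). \<forall>v\<in>lin_ball g. 2 * card (far_points N g z a v \<eta>) < N}" for z
  have "\<exists>y. \<forall>(a, \<eta>)\<in>S z. L2_set (\<lambda>j. y j - a j) g \<le> 3 * \<eta>" for z
    by (rule exists_center[OF g]) (auto simp: S_def intro: dist_le_if_majority_close)
  then have "\<forall>z. \<exists>y. \<forall>(a, \<eta>)\<in>S z. L2_set (\<lambda>j. y j - a j) g \<le> 3 * \<eta>" by blast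
  from choice[OF this] obtain y where y: "\<forall>z. \<forall>(a, \<eta>)\<in>S z. L2_set (\<lambda>j. y z j - a j) g \<le> 3 * \<eta>" by blast
  show ?thesis
  proof (intro exI[of _ y] allI impI)
    fix z a \<eta> assume "\<forall>v\<in>lin_ball g. 2 * card (far_points N g z a v \<eta>) < N"
    then have "(a, \<eta>) \<in> S z" by (simp add: S_def)
    from bspec[OF spec[OF y, of z] this] show "L2_set (\<lambda>j. y z j - a j) g \<le> 3 * \<eta>" by simp
  qed
qed

definition group :: "nat \<Rightarrow> nat \<Rightarrow> nat \<Rightarrow> nat set" where
  "group d n q = {j. j < d \<and> j div n = q}"

lemma finite_group [simp]: "finite (group d n q)" by (simp add: group_def)

abbreviation central_in_groups ::
  "nat \<Rightarrow> nat \<Rightarrow> nat \<Rightarrow> (nat \<Rightarrow> nat \<Rightarrow> real) \<Rightarrow> (nat \<Rightarrow> real) \<Rightarrow> (nat \<Rightarrow> real) \<Rightarrow> bool" where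
  "central_in_groups d n N z a \<eta> \<equiv> (\<forall>q\<le>d div n. \<forall>v\<in>lin_ball (group d n q).
     2 * card (far_points N (group d n q) z a v (\<eta> q)) < N)"

lemma card_group_le: "0 < n \<Longrightarrow> card (group d n q) \<le> n"
proof -
  assume n: "0 < n"
  have "group d n q \<subseteq> {q * n..<q * n + n}"
    using n by (auto simp: group_def div_times_less_eq_dividend dividend_less_div_times add.commute)
  then show ?thesis using card_mono[of "{q * n..<q * n + n}"] by simp
qed

lemma sum_over_groups:
  fixes f :: "nat \<Rightarrow> real"
  shows "(\<Sum>j<d. f j) = (\<Sum>q\<le>d div n. \<Sum>j\<in>group d n q. f j)"
proof -
  have "(\<Sum>q\<le>d div n. \<Sum>j\<in>{j\<in>{..<d}. j div n = q}. f j) = (\<Sum>j<d. f j)"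
    by (rule sum.group) (auto intro: div_le_mono)
  then show ?thesis by (simp add: group_def)
qed

context inner_product
begin

text \<open>
  The estimators of all groups are combined into one vector, whose squared error is the sum of the squared
  errors in the groups.
\<close>

lemma groupwise_estimator:
  "\<exists>muhat \<in> ({..<N} \<rightarrow>\<^sub>E Rd d) \<rightarrow> Rd d. \<forall>x. \<forall>u\<in>Rd d. \<forall>\<eta>.
    central_in_groups d n N (\<lambda>k. coord (x k)) (coord u) \<eta> \<longrightarrow>
    (ip_norm ip (vminus (muhat x) u))\<^sup>2 \<le> (\<Sum>q\<le>d div n. 9 * (\<eta> q)\<^sup>2)"
proof -
  let ?P = "\<lambda>q y. \<forall>z a \<eta>. (\<forall>v\<in>lin_ball (group d n q). 2 * card (far_points N (group d n q) z a v \<eta>) < N) \<longrightarrow>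
    L2_set (\<lambda>j. y z j - a j) (group d n q) \<le> 3 * \<eta>"
  have "\<forall>q. \<exists>y. ?P q y" using coordinate_group_estimator[OF finite_group] by blast
  from choice[OF this] obtain y where y: "\<forall>q. ?P q (y q)" by blast
  define muhat where "muhat x = vec (\<lambda>j. y (j div n) (\<lambda>k. coord (x k)) j)" for x
  have "(ip_norm ip (vminus (muhat x) u))\<^sup>2 \<le> (\<Sum>q\<le>d div n. 9 * (\<eta> q)\<^sup>2)"
    if u: "u \<in> Rd d" and far: "central_in_groups d n N (\<lambda>k. coord (x k)) (coord u) \<eta>" for x u and \<eta> :: "nat \<Rightarrow> real"
  proof -
    let ?e = "\<lambda>j. coord (muhat x) j - coord u j"
    have "(ip_norm ip (vminus (muhat x) u))\<^sup>2 = (\<Sum>j<d. (?e j)\<^sup>2)"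
      using u unfolding muhat_def
      by (subst ip_norm_diff) (auto simp: L2_set_def intro!: real_sqrt_pow2 sum_nonneg)
    also have "\<dots> = (\<Sum>q\<le>d div n. \<Sum>j\<in>group d n q. (?e j)\<^sup>2)" by (rule sum_over_groups)
    also have "\<dots> \<le> (\<Sum>q\<le>d div n. 9 * (\<eta> q)\<^sup>2)"
    proof (rule sum_mono)
      fix q assume q: "q \<in> {..d div n}"
      have "L2_set (\<lambda>j. y q (\<lambda>k. coord (x k)) j - coord u j) (group d n q) \<le> 3 * \<eta> q"
        using y far q by blast
      moreover have "L2_set ?e (group d n q) = L2_set (\<lambda>j. y q (\<lambda>k. coord (x k)) j - coord u j) (group d n q)"
        by (rule L2_set_cong) (auto simp: group_def muhat_def coord_vec)
      ultimately have "(L2_set ?e (group d n q))\<^sup>2 \<le> (3 * \<eta> q)\<^sup>2" by (intro power_mono) auto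
      moreover have "(L2_set ?e (group d n q))\<^sup>2 = (\<Sum>j\<in>group d n q. (?e j)\<^sup>2)"
        unfolding L2_set_def by (intro real_sqrt_pow2 sum_nonneg) auto
      ultimately show "(\<Sum>j\<in>group d n q. (?e j)\<^sup>2) \<le> 9 * (\<eta> q)\<^sup>2" by (simp add: power_mult_distrib)
    qed
    finally show ?thesis .
  qed
  then show ?thesis by (intro bexI[of _ muhat]) (auto simp: muhat_def)
qed

end

context mean_problem
begin

text \<open>
  For \<open>U = \<real>\<^sup>d\<close> the dual set contains the unit sphere, so \<open>R\<^sup>2\<close> bounds the variance in every unit direction,
  in particular in those supported on a group.
\<close>

lemma full_variance:
  assumes U: "U = Rd d" and g: "g \<subseteq> {..<d}" and v: "v \<in> lin_ball g" and i: "i < N"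
  shows "expectation (\<lambda>\<omega>. (lin g v (W i \<omega>))\<^sup>2) \<le> R\<^sup>2"
proof -
  have fg: "finite g" using g finite_subset by blast
  define n where "n = L2_set v g"
  have n: "0 \<le> n" "n \<le> 1" using v by (auto simp: n_def lin_ball_def)
  show ?thesis
  proof (cases "n = 0")
    case True
    have "lin g v x = 0" for x using lin_le_L2[of g v x] True by (simp add: n_def)
    then show ?thesis by simp
  next
    case False
    define c where "c j = (if j \<in> g then v j / n else 0)" for j
    have sq: "(\<Sum>j\<in>g. (v j)\<^sup>2) = n\<^sup>2"
      unfolding n_def L2_set_def by (rule real_sqrt_pow2[symmetric]) (auto intro: sum_nonneg)
    have "(\<Sum>j<d. (c j)\<^sup>2) = (\<Sum>j\<in>g. (v j / n)\<^sup>2)"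
      using g by (intro sum.mono_neutral_cong_right) (auto simp: c_def)
    also have "\<dots> = 1" using False sq by (simp add: power_divide flip: sum_divide_distrib)
    finally have "L2_set c {..<d} = 1" by (simp add: L2_set_def)
    moreover have "L2_set (coord (vec c)) {..<d} = L2_set c {..<d}"
      by (rule L2_set_cong) (auto simp: coord_vec)
    ultimately have B: "vec c \<in> B" using U by (intro sphere_B) (auto simp: ip_norm_eq)
    have l: "lin g v x = n * lin {..<d} (coord (vec c)) x" for x
    proof -
      have "lin {..<d} (coord (vec c)) x = (\<Sum>j\<in>g. x j * (v j / n))"
        unfolding lin_def using g by (intro sum.mono_neutral_cong_right) (auto simp: c_def coord_vec)
      then show ?thesis using False by (simp add: lin_def sum_distrib_left)
    qed
    have "expectation (\<lambda>\<omega>. (lin g v (W i \<omega>))\<^sup>2) = n\<^sup>2 * expectation (\<lambda>\<omega>. (lin {..<d} (coord (vec c)) (W i \<omega>))\<^sup>2)"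
      by (simp add: l power_mult_distrib)
    also have "\<dots> \<le> 1 * R\<^sup>2"
      using n W_variance[OF B i] by (intro mult_mono) (auto simp: power_le_one)
    finally show ?thesis by simp
  qed
qed

lemma coordinate_variance:
  assumes U: "U = Rd d" and j: "j < d" and i: "i < N"
  shows "expectation (\<lambda>\<omega>. (W i \<omega> j)\<^sup>2) \<le> R\<^sup>2"
  using full_variance[OF U, of "{j}" "\<lambda>_. 1" i] j i by (simp add: lin_ball_def lin_def L2_set_def)

text \<open>
  If \<open>R\<close> were \<open>0\<close>, all coordinates would be almost surely constant and the covariance matrix would vanish.
\<close>

lemma weak_sd_pos:
  assumes U: "U = Rd d" and d: "0 < d" and nd: "nondegenerate_mat d (cov_mat M (Y 0))"
  shows "0 < R"
proof (rule ccontr)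
  assume "\<not> 0 < R"
  then have R0: "R = 0" using R_nonneg by linarith
  have "AE \<omega> in M. W 0 \<omega> j = 0" if j: "j < d" for j
  proof -
    have "0 \<le> expectation (\<lambda>\<omega>. (W 0 \<omega> j)\<^sup>2)" by (rule integral_nonneg_AE) simp
    moreover have "expectation (\<lambda>\<omega>. (W 0 \<omega> j)\<^sup>2) \<le> 0"
      using coordinate_variance[OF U j N] R0 by simp
    ultimately have "expectation (\<lambda>\<omega>. (W 0 \<omega> j)\<^sup>2) = 0" by linarith
    then have "AE \<omega> in M. (W 0 \<omega> j)\<^sup>2 = 0"
      using integral_nonneg_eq_0_iff_AE[OF W_square_integrable[OF N]] by simp
    then show ?thesis by simp
  qed
  then have "AE \<omega> in M. \<forall>j\<in>{..<d}. W 0 \<omega> j = 0" by (intro AE_finite_allI) auto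
  then have ae: "AE \<omega> in M. Y 0 \<omega> = \<mu>"
  proof (rule AE_mp, intro AE_I2 impI)
    fix \<omega> assume \<omega>: "\<omega> \<in> space M" and z: "\<forall>j\<in>{..<d}. W 0 \<omega> j = 0"
    have "L2_set (\<lambda>j. coord (Y 0 \<omega>) j - coord \<mu> j) {..<d} = 0"
      using z W_eq_coord[OF N \<omega>] by (simp add: L2_set_def)
    then have "ip_norm ip (vminus (Y 0 \<omega>) \<mu>) = 0" using Y_Rd[OF N \<omega>] \<mu>_Rd by (simp add: ip_norm_diff)
    moreover have x: "vminus (Y 0 \<omega>) \<mu> \<in> Rd d" using Y_Rd[OF N \<omega>] \<mu>_Rd by simp
    ultimately have "vminus (Y 0 \<omega>) \<mu> = (\<lambda>j. 0)" using ip_pos[OF x] ip_norm_sq[OF x] by auto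
    then show "Y 0 \<omega> = \<mu>" by (simp add: fun_eq_iff)
  qed
  have cov: "cov_mat M (Y 0) j k = 0" for j k
  proof -
    have "cov_mat M (Y 0) j k = (\<integral>\<omega>. 0 \<partial>M)"
      unfolding cov_mat_def
    proof (rule integral_cong_AE)
      show "(\<lambda>\<omega>. (Y 0 \<omega> j - \<mu> j) * (Y 0 \<omega> k - \<mu> k)) \<in> borel_measurable M"
        by (intro borel_measurable_times borel_measurable_diff Y0_coord_rv borel_measurable_const)
      show "AE \<omega> in M. (Y 0 \<omega> j - \<mu> j) * (Y 0 \<omega> k - \<mu> k) = 0" using ae by eventually_elim simp
    qed simp
    then show ?thesis by simp
  qed
  have "(\<lambda>i::nat. of_bool (i = 0) :: real) \<in> Rd d" using d by (auto simp: Rd_iff)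
  then have "(\<lambda>i::nat. of_bool (i = 0) :: real) = (\<lambda>j. 0)"
    by (rule nd[unfolded nondegenerate_mat_def, rule_format]) (simp add: cov)
  then show False by (auto dest: fun_cong[of _ _ 0])
qed

definition energy :: "nat set \<Rightarrow> nat \<Rightarrow> 'w \<Rightarrow> real" where
  "energy g i \<omega> = (\<Sum>j\<in>g. (W i \<omega> j)\<^sup>2)"

text \<open>
  A measurable substitute for the square of a high order statistic of the energies. It involves only
  products of two distinct, hence independent, energies, and is thus integrable under second moments
  of the observations.
\<close>

definition pair_energy :: "nat set \<Rightarrow> 'w \<Rightarrow> real" where
  "pair_energy g \<omega> = (32 / (real N)\<^sup>2) * (\<Sum>i<N. \<Sum>k\<in>{..<N} - {i}. energy g i \<omega> * energy g k \<omega>)"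

lemma energy_nonneg: "0 \<le> energy g i \<omega>" by (auto simp: energy_def intro: sum_nonneg)

lemma pair_energy_nonneg: "0 \<le> pair_energy g \<omega>"
  unfolding pair_energy_def by (intro mult_nonneg_nonneg sum_nonneg energy_nonneg) auto

lemma pair_energy_expectation:
  assumes U: "U = Rd d" and g: "g \<subseteq> {..<d}"
  shows "integrable M (pair_energy g)" "expectation (pair_energy g) \<le> 32 * (card g * R\<^sup>2)\<^sup>2"
proof -
  have int: "integrable M (energy g i)" if "i < N" for i
    unfolding energy_def[abs_def] by (intro Bochner_Integration.integrable_sum W_square_integrable that)
  have ex: "expectation (energy g i) \<le> card g * R\<^sup>2" if i: "i < N" for i
  proof -
    have "expectation (energy g i) = (\<Sum>j\<in>g. expectation (\<lambda>\<omega>. (W i \<omega> j)\<^sup>2))"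
      unfolding energy_def[abs_def] by (intro Bochner_Integration.integral_sum W_square_integrable i)
    also have "\<dots> \<le> (\<Sum>j\<in>g. R\<^sup>2)" using g by (intro sum_mono coordinate_variance U i) auto
    finally show ?thesis by simp
  qed
  have ind: "indep_vars (\<lambda>_. borel) (energy g) {..<N}"
    unfolding energy_def[abs_def]
    by (rule indep_vars_compose2[OF W_indep, where Y = "\<lambda>_ x. \<Sum>j\<in>g. (x j)\<^sup>2"])
       (intro borel_measurable_sum borel_measurable_power borel_measurable_coordinate)
  have pair: "integrable M (\<lambda>\<omega>. energy g i \<omega> * energy g k \<omega>) \<and>
      expectation (\<lambda>\<omega>. energy g i \<omega> * energy g k \<omega>) \<le> (card g * R\<^sup>2)\<^sup>2"
    if ik: "i < N" "k \<in> {..<N} - {i}" for i k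
  proof -
    have ind2: "indep_vars (\<lambda>_. borel) (energy g) {i, k}" by (rule indep_vars_subset[OF ind]) (use ik in auto)
    have int2: "integrable M (energy g l)" if "l \<in> {i, k}" for l using that ik by (auto intro: int)
    have p: "(\<lambda>\<omega>. \<Prod>l\<in>{i, k}. energy g l \<omega>) = (\<lambda>\<omega>. energy g i \<omega> * energy g k \<omega>)" using ik by auto
    have "expectation (\<lambda>\<omega>. energy g i \<omega> * energy g k \<omega>) = expectation (energy g i) * expectation (energy g k)"
      using indep_vars_lebesgue_integral[OF _ ind2 int2] ik unfolding p by simp
    also have "\<dots> \<le> (card g * R\<^sup>2) * (card g * R\<^sup>2)"
      using ik by (intro mult_mono ex integral_nonneg_AE) (auto simp: energy_nonneg)
    finally show ?thesis using indep_vars_integrable[OF _ ind2 int2] unfolding p by (simp add: power2_eq_square)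
  qed
  have pint: "integrable M (\<lambda>\<omega>. energy g i \<omega> * energy g k \<omega>)" if "i < N" "k \<in> {..<N} - {i}" for i k
    using pair[OF that] by blast
  have int': "integrable M (\<lambda>\<omega>. \<Sum>k\<in>{..<N} - {i}. energy g i \<omega> * energy g k \<omega>)" if "i < N" for i
    by (intro Bochner_Integration.integrable_sum pint that)
  show "integrable M (pair_energy g)"
    unfolding pair_energy_def[abs_def]
    by (intro integrable_mult_right Bochner_Integration.integrable_sum int') auto
  have "expectation (\<lambda>\<omega>. \<Sum>i<N. \<Sum>k\<in>{..<N} - {i}. energy g i \<omega> * energy g k \<omega>)
      = (\<Sum>i<N. \<Sum>k\<in>{..<N} - {i}. expectation (\<lambda>\<omega>. energy g i \<omega> * energy g k \<omega>))"
    proof -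
    have "expectation (\<lambda>\<omega>. \<Sum>i<N. \<Sum>k\<in>{..<N} - {i}. energy g i \<omega> * energy g k \<omega>)
        = (\<Sum>i<N. expectation (\<lambda>\<omega>. \<Sum>k\<in>{..<N} - {i}. energy g i \<omega> * energy g k \<omega>))"
      by (rule Bochner_Integration.integral_sum) (use int' in auto)
    also have "\<dots> = (\<Sum>i<N. \<Sum>k\<in>{..<N} - {i}. expectation (\<lambda>\<omega>. energy g i \<omega> * energy g k \<omega>))"
      by (intro sum.cong refl Bochner_Integration.integral_sum pint) auto
    finally show ?thesis .
  qed
  also have "\<dots> \<le> (\<Sum>i<N. \<Sum>k\<in>{..<N} - {i}. (card g * R\<^sup>2)\<^sup>2)"
    by (intro sum_mono conjunct2[OF pair]) auto
  also have "\<dots> \<le> (\<Sum>i<N. \<Sum>k<N. (card g * R\<^sup>2)\<^sup>2)"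
    by (intro sum_mono sum_mono2) auto
  also have "\<dots> = (real N)\<^sup>2 * (card g * R\<^sup>2)\<^sup>2" by (simp add: power2_eq_square)
  finally have "expectation (pair_energy g) \<le> (32 / (real N)\<^sup>2) * ((real N)\<^sup>2 * (card g * R\<^sup>2)\<^sup>2)"
    unfolding pair_energy_def[abs_def] by (subst integral_mult_right_zero) (intro mult_left_mono, auto)
  then show "expectation (pair_energy g) \<le> 32 * (card g * R\<^sup>2)\<^sup>2" using N by simp
qed

text \<open>
  The radius \<open>pair_energy ^ (1/4)\<close> is good for the clean sample with certainty: a deviation of a functional is at
  most the square root of the energy.
\<close>

lemma pair_energy_tail:
  assumes "8 \<le> N" and v: "v \<in> lin_ball g"
  shows "4 * card {k\<in>{..<N}. sqrt (sqrt (pair_energy g \<omega>)) < \<bar>lin g v (W k \<omega>)\<bar>} \<le> N"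
proof -
  have "{k\<in>{..<N}. sqrt (sqrt (pair_energy g \<omega>)) < \<bar>lin g v (W k \<omega>)\<bar>}
      \<subseteq> {k\<in>{..<N}. sqrt (pair_energy g \<omega>) < energy g k \<omega>}"
  proof safe
    fix k assume k: "sqrt (sqrt (pair_energy g \<omega>)) < \<bar>lin g v (W k \<omega>)\<bar>"
    note k
    also have "\<bar>lin g v (W k \<omega>)\<bar> \<le> L2_set (W k \<omega>) g * L2_set v g" by (rule lin_le_L2)
    also have "\<dots> \<le> L2_set (W k \<omega>) g" using v by (intro mult_left_le) (auto simp: lin_ball_def)
    also have "\<dots> = sqrt (energy g k \<omega>)" by (simp add: L2_set_def energy_def)
    finally show "sqrt (pair_energy g \<omega>) < energy g k \<omega>" by simp
  qed
  then have "card {k\<in>{..<N}. sqrt (sqrt (pair_energy g \<omega>)) < \<bar>lin g v (W k \<omega>)\<bar>}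
      \<le> card {k\<in>{..<N}. sqrt (pair_energy g \<omega>) < energy g k \<omega>}" by (intro card_mono) auto
  then show ?thesis
    using few_large_of_pair_sum[of N "\<lambda>i. energy g i \<omega>"] assms(1)
    unfolding pair_energy_def by (simp add: energy_nonneg)
qed

text \<open>
  In one group, of dimension much smaller than \<open>N\<close>, the tail bound for half-spaces applies to the
  observations themselves, as blocks of length one.
\<close>

lemma group_failure:
  assumes U: "U = Rd d" and g: "g \<subseteq> {..<d}" and big: "10000 * (2 * card g + 1) \<le> N"
  shows "\<exists>F\<in>events. prob F \<le> 4 * exp (- (N / 512)) \<and>
    (\<forall>\<omega>\<in>space M - F. \<forall>v\<in>lin_ball g. 4 * card {k\<in>{..<N}. 8 * R < \<bar>lin g v (W k \<omega>)\<bar>} \<le> N)"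
proof -
  have fg: "finite g" using g finite_subset by blast
  have b: "block 1 k = {k}" for k by (auto simp: block_def)
  have "\<exists>F\<in>events. prob F \<le> 4 * exp (- (N / 512)) \<and>
    (\<forall>\<omega>\<in>space M - F. \<forall>v\<in>lin_ball g.
      4 * card {k\<in>{..<N}. 8 * (R / sqrt (1::nat)) < \<bar>(\<Sum>i\<in>block 1 k. lin g v (W i \<omega>)) / (1::nat)\<bar>} \<le> N)"
    by (rule block_means_tail[OF W_indep fg vc_le_halfspaces[OF fg] big _ _ R_nonneg])
       (use W_square_integrable W_mean full_variance[OF U g] in auto)
  then show ?thesis unfolding b by simp
qed

end

context mean_problem
begin

text \<open>
  The radius in a group is \<open>8 R\<close> outside the failure event \<open>F q\<close>, and on \<open>F q\<close> the fourth root of the pair energy.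
  The excess of its square over \<open>64 R\<^sup>2\<close> is at most \<open>h q\<close>, which by independence has expectation of order
  \<open>n R\<^sup>2 exp (- N / 1024)\<close>. Markov's inequality for the sum \<open>H\<close> over the groups costs only the
  probability that is stated, although the groups may be far too many for a union bound.
\<close>

lemma means_are_central_in_groups:
  fixes n :: nat and \<epsilon> :: real
  assumes U: "U = Rd d" and d: "0 < d" and nd: "nondegenerate_mat d (cov_mat M (Y 0))"
    and n: "0 < n" "10000 * (2 * n + 1) \<le> N"
    and \<epsilon>: "8 * \<epsilon> * real N \<le> real N" and cont: "contaminated M d N \<epsilon> Y X"
  shows "\<exists>A\<in>events. 1 - 18 * n * exp (- (N / 1024)) \<le> prob A \<and>
    (\<forall>\<omega>\<in>A. \<exists>\<eta>. (\<Sum>q\<le>d div n. 9 * (\<eta> q)\<^sup>2) \<le> 585 * real (d div n + 1) * R\<^sup>2 \<and>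
      central_in_groups d n N (\<lambda>k. coord (sample N X \<omega> k)) (coord \<mu>) \<eta>)"
proof -
  have Rpos: "0 < R" by (rule weak_sd_pos[OF U d nd])
  have N8: "8 \<le> N" and N0: "0 < N" using n by auto
  define G where "G = d div n"
  define g where "g q = group d n q" for q
  have gd: "g q \<subseteq> {..<d}" for q by (auto simp: g_def group_def)
  have cg: "card (g q) \<le> n" for q unfolding g_def by (rule card_group_le[OF n(1)])
  obtain S where S: "\<forall>\<omega>\<in>space M. S \<omega> \<subseteq> {..<N} \<and> 8 * card (S \<omega>) \<le> N \<and> (\<forall>i\<in>{..<N} - S \<omega>. X i \<omega> = Y i \<omega>)"
    using contaminated_bound[OF cont \<epsilon>] by blast
  have "\<forall>q. \<exists>F. F \<in> events \<and> prob F \<le> 4 * exp (- (N / 512)) \<and>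
    (\<forall>\<omega>\<in>space M - F. \<forall>v\<in>lin_ball (g q). 4 * card {k\<in>{..<N}. 8 * R < \<bar>lin (g q) v (W k \<omega>)\<bar>} \<le> N)"
  proof
    fix q
    have "10000 * (2 * card (g q) + 1) \<le> 10000 * (2 * n + 1)" using cg[of q] by simp
    then have "10000 * (2 * card (g q) + 1) \<le> N" using n(2) by (rule order_trans)
    from group_failure[OF U gd this] show "\<exists>F. F \<in> events \<and> prob F \<le> 4 * exp (- (N / 512)) \<and>
    (\<forall>\<omega>\<in>space M - F. \<forall>v\<in>lin_ball (g q). 4 * card {k\<in>{..<N}. 8 * R < \<bar>lin (g q) v (W k \<omega>)\<bar>} \<le> N)"
      by blast
  qed
  from choice[OF this] obtain F where F0: "\<forall>q. F q \<in> events \<and> prob (F q) \<le> 4 * exp (- (N / 512)) \<and>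
    (\<forall>\<omega>\<in>space M - F q. \<forall>v\<in>lin_ball (g q). 4 * card {k\<in>{..<N}. 8 * R < \<bar>lin (g q) v (W k \<omega>)\<bar>} \<le> N)" ..
  have Fe: "F q \<in> events" and Fp: "prob (F q) \<le> 4 * exp (- (N / 512))"
    and Fc: "\<And>\<omega> v. \<omega> \<in> space M - F q \<Longrightarrow> v \<in> lin_ball (g q) \<Longrightarrow>
      4 * card {k\<in>{..<N}. 8 * R < \<bar>lin (g q) v (W k \<omega>)\<bar>} \<le> N" for q
    using F0 by blast+
  \<comment> \<open>balances the two terms of \<open>sqrt w \<le> (t + w / t) / 2\<close>: the indicator of \<open>F q\<close> has expectation at most \<open>4 exp (- N / 512)\<close>, and \<open>w\<close> at most \<open>32 (n R\<^sup>2)\<^sup>2\<close>\<close>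
  define t where "t = n * R\<^sup>2 * exp (N / 1024)"
  have t: "0 < t" using n(1) Rpos by (simp add: t_def)
  define h where "h q \<omega> = (t * indicator (F q) \<omega> + pair_energy (g q) \<omega> / t) / 2" for q \<omega>
  define H where "H \<omega> = (\<Sum>q\<le>G. h q \<omega>)" for \<omega>
  have h0: "0 \<le> h q \<omega>" for q \<omega>
    using t pair_energy_nonneg[of "g q" \<omega>] by (simp add: h_def)
  have hint: "integrable M (h q)" for q
    unfolding h_def[abs_def]
    by (intro integrable_divide Bochner_Integration.integrable_add integrable_mult_right
        pair_energy_expectation(1)[OF U gd] integrable_real_indicator Fe) (simp add: emeasure_eq_measure)
  have hex: "expectation (h q) \<le> 18 * n * exp (- (N / 1024)) * R\<^sup>2" for q
  proof -
    have "expectation (h q) = (t * prob (F q) + expectation (pair_energy (g q)) / t) / 2"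
      unfolding h_def[abs_def] using Fe[of q] pair_energy_expectation(1)[OF U gd, of q]
      by (simp add: emeasure_eq_measure)
    also have "\<dots> \<le> (t * (4 * exp (- (N / 512))) + 32 * (n * R\<^sup>2)\<^sup>2 / t) / 2"
    proof -
      have "expectation (pair_energy (g q)) \<le> 32 * (card (g q) * R\<^sup>2)\<^sup>2"
        by (rule pair_energy_expectation(2)[OF U gd])
      also have "\<dots> \<le> 32 * (n * R\<^sup>2)\<^sup>2"
        using cg[of q] by (intro mult_left_mono power_mono mult_right_mono) auto
      finally show ?thesis using t Fp[of q]
        by (intro divide_right_mono add_mono mult_left_mono) auto
    qed
    also have "32 * (n * R\<^sup>2)\<^sup>2 / t = 32 * n * R\<^sup>2 * exp (- (N / 1024))"
      using n(1) Rpos by (simp add: t_def exp_minus power2_eq_square field_simps)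
    also have "t * (4 * exp (- (N / 512))) = 4 * n * R\<^sup>2 * exp (- (N / 1024))"
      by (simp add: t_def flip: exp_add)
    finally show ?thesis by (simp add: algebra_simps)
  qed
  have Hint: "integrable M H" unfolding H_def[abs_def] by (intro Bochner_Integration.integrable_sum hint)
  have Hex: "expectation H \<le> (G + 1) * (18 * n * exp (- (N / 1024)) * R\<^sup>2)"
  proof -
    have "expectation H = (\<Sum>q\<le>G. expectation (h q))"
      unfolding H_def[abs_def] by (rule Bochner_Integration.integral_sum) (rule hint)
    also have "\<dots> \<le> (\<Sum>q\<le>G. 18 * n * exp (- (N / 1024)) * R\<^sup>2)" by (intro sum_mono hex)
    finally show ?thesis by simp
  qed
  define b where "b = (G + 1) * R\<^sup>2"
  have b: "0 < b" using Rpos by (simp add: b_def)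
  let ?A = "{\<omega>\<in>space M. b \<le> H \<omega>}"
  have Am: "?A \<in> events"
  proof -
    note [measurable] = borel_measurable_integrable[OF Hint]
    show ?thesis by measurable
  qed
  have "prob ?A \<le> expectation H / b"
    by (rule integral_Markov_inequality_measure[OF Hint, where A = "{}"])
       (use b in \<open>auto simp: H_def intro!: sum_nonneg h0\<close>)
  also have "\<dots> \<le> ((G + 1) * (18 * n * exp (- (N / 1024)) * R\<^sup>2)) / b"
    using Hex b by (intro divide_right_mono) auto
  also have "\<dots> = 18 * n * exp (- (N / 1024))" 
  proof -
    have "x * (c * r) / (x * r) = c" if "x \<noteq> 0" "r \<noteq> 0" for x c r :: real using that by simp
    from this[of "real (G + 1)" "R\<^sup>2"] show ?thesis unfolding b_def using Rpos by simp
  qed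
  finally have PA: "prob ?A \<le> 18 * n * exp (- (N / 1024))" .
  have "\<exists>\<eta>. (\<Sum>q\<le>G. 9 * (\<eta> q)\<^sup>2) \<le> 585 * real (G + 1) * R\<^sup>2 \<and>
      (\<forall>q\<le>G. \<forall>v\<in>lin_ball (g q).
         2 * card (far_points N (g q) (\<lambda>k. coord (sample N X \<omega> k)) (coord \<mu>) v (\<eta> q)) < N)"
    if \<omega>: "\<omega> \<in> space M - ?A" for \<omega>
  proof -
    have \<omega>': "\<omega> \<in> space M" using \<omega> by simp
    have Hb: "H \<omega> < b" using \<omega> by auto
    from S[rule_format, OF \<omega>'] have S\<omega>: "S \<omega> \<subseteq> {..<N}" "8 * card (S \<omega>) \<le> N"
      "\<And>i. i \<in> {..<N} - S \<omega> \<Longrightarrow> X i \<omega> = Y i \<omega>" by auto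
    have fS: "finite (S \<omega>)" using S\<omega>(1) finite_lessThan by (rule finite_subset)
    define \<eta> where "\<eta> q = (if \<omega> \<in> F q then sqrt (sqrt (pair_energy (g q) \<omega>)) else 8 * R)" for q
    have \<eta>c: "4 * card {k\<in>{..<N}. \<eta> q < \<bar>lin (g q) v (W k \<omega>)\<bar>} \<le> N" if "v \<in> lin_ball (g q)" for q v
      using pair_energy_tail[OF N8 that, of \<omega>] Fc[of \<omega> q v] that \<omega>' by (auto simp: \<eta>_def)
    have \<eta>s: "(\<eta> q)\<^sup>2 \<le> 64 * R\<^sup>2 + h q \<omega>" for q
    proof (cases "\<omega> \<in> F q")
      case True
      let ?w = "pair_energy (g q) \<omega>"
      \<comment> \<open>the inequality between the arithmetic and the geometric mean\<close>
      have "0 \<le> (sqrt t - sqrt (?w / t))\<^sup>2" by simp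
      also have "\<dots> = t + ?w / t - 2 * (sqrt t * sqrt (?w / t))"
        using t pair_energy_nonneg[of "g q" \<omega>] by (simp add: power2_diff)
      also have "sqrt t * sqrt (?w / t) = sqrt ?w" using t by (simp flip: real_sqrt_mult)
      finally have "sqrt ?w \<le> h q \<omega>" using True by (simp add: h_def)
      moreover have "(\<eta> q)\<^sup>2 = sqrt ?w" using True pair_energy_nonneg[of "g q" \<omega>] by (simp add: \<eta>_def)
      moreover have "0 \<le> 64 * R\<^sup>2" by simp
      ultimately show ?thesis by linarith
    next
      case False
      then show ?thesis using h0[of q \<omega>] by (simp add: \<eta>_def power_mult_distrib)
    qed
    have "(\<Sum>q\<le>G. 9 * (\<eta> q)\<^sup>2) \<le> (\<Sum>q\<le>G. 9 * (64 * R\<^sup>2 + h q \<omega>))"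
      by (intro sum_mono mult_left_mono \<eta>s) auto
    also have "\<dots> = 576 * real (G + 1) * R\<^sup>2 + 9 * H \<omega>"
      by (simp add: H_def sum.distrib sum_distrib_left algebra_simps)
    also have "\<dots> \<le> 585 * real (G + 1) * R\<^sup>2" using Hb by (simp add: b_def algebra_simps)
    finally have sum: "(\<Sum>q\<le>G. 9 * (\<eta> q)\<^sup>2) \<le> 585 * real (G + 1) * R\<^sup>2" .
    let ?far = "\<lambda>q v. far_points N (g q) (\<lambda>k. coord (sample N X \<omega> k)) (coord \<mu>) v (\<eta> q)"
    have "2 * card (?far q v) < N"
      if v: "v \<in> lin_ball (g q)" for q v
    proof -
      let ?L = "{k\<in>{..<N}. \<eta> q < \<bar>lin (g q) v (W k \<omega>)\<bar>}"
      have "?far q v \<subseteq> ?L \<union> S \<omega>"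
      proof
        fix k assume k: "k \<in> ?far q v"
        show "k \<in> ?L \<union> S \<omega>"
        proof (cases "k \<in> S \<omega>")
          case False
          have kN: "k < N" using k by (simp add: far_points_def)
          have "X k \<omega> = Y k \<omega>" using S\<omega>(3)[of k] False kN by simp
          then show ?thesis using k kN lin_W[OF kN \<omega>' gd, of q v] by (simp add: far_points_def)
        qed simp
      qed
      then have "card (?far q v) \<le> card (?L \<union> S \<omega>)"
        using fS by (intro card_mono) auto
      also have "\<dots> \<le> card ?L + card (S \<omega>)" by (rule card_Un_le)
      finally show ?thesis using \<eta>c[OF v] S\<omega>(2) N0 by linarith
    qed
    then show ?thesis using sum by blast
  qed
  moreover have "1 - 18 * n * exp (- (N / 1024)) \<le> prob (space M - ?A)"
    using prob_compl[OF Am] PA by simp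
  ultimately show ?thesis using Am unfolding G_def g_def
    by (intro bexI[of _ "space M - ?A"] conjI ballI) auto
qed

end

section \<open>The two regimes of the dimension\<close>

abbreviation error_rate ::
  "nat \<Rightarrow> nat \<Rightarrow> ((nat \<Rightarrow> real) \<Rightarrow> (nat \<Rightarrow> real) \<Rightarrow> real) \<Rightarrow> (nat \<Rightarrow> real) set \<Rightarrow> real \<Rightarrow> real \<Rightarrow> real" where
  "error_rate d N ip B \<epsilon> \<delta> \<equiv>
     sqrt (VC_real d ip B / real N) + sqrt (ln (1 / \<delta>) / real N) + sqrt \<epsilon>"

lemma with_prob_at_leastI:
  assumes "A \<in> sets M" "p \<le> measure M A" "\<And>\<omega>. \<omega> \<in> A \<Longrightarrow> P \<omega>"
  shows "with_prob_at_least M p P"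
  using assms unfolding with_prob_at_least_def by blast

lemma sqrt_le_mult_sum:
  assumes "0 \<le> a" "0 \<le> b" "0 \<le> (c::real)"
  shows "sqrt (a + b + c) \<le> sqrt a + sqrt b + sqrt c"
  using sqrt_add_le_add_sqrt[of "a + b" c] sqrt_add_le_add_sqrt[of a b] assms by linarith

text \<open>
  Since \<open>exp (- c N) \<le> \<delta> \<le> 1/2\<close>, the sample size is at least of order \<open>1 / c\<close>; the tiny value \<open>c = 1 / 10 ^ 8\<close>
  thus also provides all the lower bounds on \<open>N\<close> that are needed.
\<close>

locale accuracy_params =
  fixes N :: nat and \<epsilon> \<delta> :: real
  assumes \<epsilon>: "0 \<le> \<epsilon>" "\<epsilon> \<le> 1 / 100000000" and \<delta>: "exp (- (1 / 100000000) * real N) \<le> \<delta>" "\<delta> \<le> 1/2"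
begin

lemma \<delta>_pos: "0 < \<delta>" using \<delta>(1) by (rule less_le_trans[rotated]) simp

lemma ln_inverse_le: "ln (1 / \<delta>) \<le> N / 100000000"
proof -
  have "ln (exp (- (1 / 100000000) * real N)) \<le> ln \<delta>"
    using \<delta>(1) \<delta>_pos by (subst ln_le_cancel_iff) auto
  then show ?thesis using \<delta>_pos by (simp add: ln_div)
qed

lemma exp_ln_inverse: "exp (- ln (1 / \<delta>)) = \<delta>"
  using \<delta>_pos by (simp add: ln_div)

lemma ln_inverse_ge: "ln 2 \<le> ln (1 / \<delta>)"
  using \<delta>_pos \<delta>(2) by (subst ln_le_cancel_iff) (auto simp: field_simps)

lemma half_le_ln_inverse: "1/2 \<le> ln (1 / \<delta>)"
  using ln_inverse_ge ln2_ge_two_thirds by linarith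

lemma N_large: "50000000 \<le> real N"
  using half_le_ln_inverse ln_inverse_le by simp

end

text \<open>
  \<open>K\<close> is proportional to \<open>\<Lambda> = VC + log (1/\<delta>) + \<epsilon> N\<close>. This is large enough for the tail bound, the confidence
  level and the contamination, and at most \<open>N\<close> since each summand is at most \<open>c N\<close>. The error \<open>24 R / sqrt m\<close>
  is then of order \<open>R sqrt (K / N)\<close>.
\<close>

lemma (in dual_pair) small_dimension:
  assumes "accuracy_params N \<epsilon> \<delta>" and V: "VC_real d ip B \<le> (1 / 100000000) * real N"
  shows "\<exists>muhat \<in> ({..<N} \<rightarrow>\<^sub>E Rd d) \<rightarrow> Rd d.
      \<forall>(M :: 'w measure) Y X.
        prob_space M \<longrightarrow> iid_vectors M d N Y \<longrightarrow> finite_second_moments M d (Y 0) \<longrightarrow>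
        mean_vec M (Y 0) \<in> U \<longrightarrow> contaminated M d N \<epsilon> Y X \<longrightarrow>
        with_prob_at_least M (1 - \<delta>) (\<lambda>\<omega>.
          ip_norm ip (vminus (muhat (sample N X \<omega>)) (mean_vec M (Y 0)))
          \<le> 300000 * weak_sd M ip B (Y 0) * error_rate d N ip B \<epsilon> \<delta>)"
proof -
  interpret accuracy_params N \<epsilon> \<delta> by fact
  define v where "v = the_enat (VC_vectors d ip B)"
  have Vv: "VC_real d ip B = real v" by (simp add: VC_real_def v_def)
  define L where "L = ln (1 / \<delta>)"
  define \<Lambda> where "\<Lambda> = real v + L + \<epsilon> * N"
  define K where "K = nat \<lceil>40000 * \<Lambda>\<rceil>"
  define m where "m = N div K"
  have L: "1/2 \<le> L" "L \<le> N / 100000000" using half_le_ln_inverse ln_inverse_le by (auto simp: L_def)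
  have eN: "0 \<le> \<epsilon> * N" "\<epsilon> * N \<le> N / 100000000" using \<epsilon> mult_right_mono[OF \<epsilon>(2), of "real N"] by auto
  have \<Lambda>: "1/2 \<le> \<Lambda>" "\<Lambda> \<le> 3 * N / 100000000"
    using L eN V unfolding \<Lambda>_def Vv by linarith+
  have K1: "40000 * \<Lambda> \<le> K" using \<Lambda> by (simp add: K_def)
  have K2: "K \<le> 50000 * \<Lambda>" using \<Lambda> unfolding K_def by linarith
  have KN: "K \<le> N" using K2 \<Lambda> N_large by linarith
  have K0: "0 < K" using K1 \<Lambda> by linarith
  have m: "0 < m" "m * K \<le> N" using KN K0 by (auto simp: m_def div_greater_zero_iff)
  have mN: "real N \<le> 2 * m * K"
  proof -
    have "N < (m + 1) * K" unfolding m_def using K0 by (simp add: dividend_less_div_times add.commute)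
    also have "\<dots> \<le> (m + m) * K" using m(1) by (intro mult_right_mono) auto
    finally have "N \<le> 2 * m * K" by (simp add: mult_2)
    then show ?thesis by (metis of_nat_le_iff of_nat_mult of_nat_numeral)
  qed
  have KV: "10000 * (2 * v + 1) \<le> K"
  proof -
    have "real (10000 * (2 * v + 1)) \<le> real K" using K1 L eN unfolding \<Lambda>_def by simp
    then show ?thesis by (simp only: of_nat_le_iff)
  qed
  have K\<epsilon>: "8 * \<epsilon> * real N \<le> real K" using K1 L eN unfolding \<Lambda>_def by simp
  have fail: "4 * exp (- (K / 512)) \<le> \<delta>"
  proof -
    \<comment> \<open>the factor \<open>4\<close> is absorbed by \<open>1 / \<delta>\<^sup>2 \<ge> 4\<close>\<close>
    have "exp (ln 2) \<le> exp L" unfolding L_def exp_le_cancel_iff by (rule ln_inverse_ge)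
    then have "2 \<le> exp L" by simp
    then have "2 * 2 \<le> exp L * exp L" by (intro mult_mono) auto
    then have "4 \<le> exp (2 * L)" by (simp flip: exp_add)
    then have "4 * exp (- (K / 512)) \<le> exp (2 * L) * exp (- (K / 512))" by (intro mult_right_mono) auto
    also have "\<dots> = exp (2 * L - K / 512)" by (simp flip: exp_add)
    also have "\<dots> \<le> exp (- L)" using K1 L eN unfolding \<Lambda>_def by simp
    finally show ?thesis using exp_ln_inverse by (simp add: L_def)
  qed
  have rate: "3 * (8 * (r / sqrt m)) \<le> 300000 * r * error_rate d N ip B \<epsilon> \<delta>" if r: "0 \<le> r" for r
  proof -
    have "1 / real m \<le> 2 * K / N" using mN m N_large by (simp add: field_simps)
    also have "\<dots> \<le> 100000 * \<Lambda> / N" using K2 by (intro divide_right_mono) auto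
    also have "\<dots> \<le> 400\<^sup>2 * (\<Lambda> / N)" using \<Lambda> by (simp add: divide_right_mono)
    finally have "sqrt (1 / real m) \<le> sqrt (400\<^sup>2 * (\<Lambda> / N))" by (rule real_sqrt_le_mono)
    also have "\<dots> = 400 * sqrt (\<Lambda> / N)" unfolding real_sqrt_mult real_sqrt_abs by simp
    also have "\<Lambda> / N = real v / N + L / N + \<epsilon>" using N_large by (simp add: \<Lambda>_def add_divide_distrib)
    also have "400 * sqrt \<dots> \<le> 400 * (sqrt (real v / N) + sqrt (L / N) + sqrt \<epsilon>)"
      using L \<epsilon> by (intro mult_left_mono sqrt_le_mult_sum) auto
    finally have s: "sqrt (1 / real m) \<le> 400 * (sqrt (real v / N) + sqrt (L / N) + sqrt \<epsilon>)" .
    have "3 * (8 * (r / sqrt m)) = 24 * r * sqrt (1 / real m)" by (simp add: real_sqrt_divide)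
    also have "\<dots> \<le> 24 * r * (400 * (sqrt (real v / N) + sqrt (L / N) + sqrt \<epsilon>))"
      using r s by (intro mult_left_mono) auto
    also have "\<dots> = 9600 * (r * (sqrt (real v / N) + sqrt (L / N) + sqrt \<epsilon>))" by simp
    also have "\<dots> \<le> 300000 * (r * (sqrt (real v / N) + sqrt (L / N) + sqrt \<epsilon>))"
      using r L \<epsilon> by (intro mult_right_mono mult_nonneg_nonneg add_nonneg_nonneg) auto
    finally show ?thesis by (simp add: Vv L_def mult.assoc)
  qed
  from median_of_means_estimator[OF m(2)] obtain muhat where
    muhat: "muhat \<in> ({..<N} \<rightarrow>\<^sub>E Rd d) \<rightarrow> Rd d"
    and est: "\<forall>x\<in>{..<N} \<rightarrow>\<^sub>E Rd d. \<forall>u\<in>U. \<forall>\<eta>.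
      (\<forall>v\<in>B. 2 * card (far_blocks K m x u v \<eta>) < K) \<longrightarrow> ip_norm ip (vminus (muhat x) u) \<le> 3 * \<eta>" by blast
  show ?thesis
  proof (intro bexI[OF _ muhat] allI impI)
    fix M :: "'w measure" and Y X
    assume M: "prob_space M" and iid: "iid_vectors M d N Y" and sm: "finite_second_moments M d (Y 0)"
      and mean: "mean_vec M (Y 0) \<in> U" and cont: "contaminated M d N \<epsilon> Y X"
    have "mean_problem d ip U B M N Y"
      using M iid sm mean N_large dual_pair_axioms
      by (simp add: mean_problem_def mean_problem_axioms_def)
    then interpret mean_problem d ip U B M N Y .
    obtain A where A: "A \<in> events" "1 - 4 * exp (- (K / 512)) \<le> prob A"
      "\<forall>\<omega>\<in>A. \<forall>v\<in>B. 2 * card (far_blocks K m (sample N X \<omega>) \<mu> v (8 * (R / sqrt m))) < K"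
      using mean_is_central[OF KV[unfolded v_def] m K\<epsilon> cont] by blast
    show "with_prob_at_least M (1 - \<delta>) (\<lambda>\<omega>. ip_norm ip (vminus (muhat (sample N X \<omega>)) \<mu>)
          \<le> 300000 * R * error_rate d N ip B \<epsilon> \<delta>)"
    proof (rule with_prob_at_leastI[OF A(1)])
      show "1 - \<delta> \<le> prob A" using A(2) fail by linarith
      fix \<omega> assume \<omega>: "\<omega> \<in> A"
      then have "\<omega> \<in> space M" using A(1) sets.sets_into_space by blast
      then have x: "(sample N X \<omega>) \<in> {..<N} \<rightarrow>\<^sub>E Rd d"
        using cont unfolding contaminated_def by auto
      have "ip_norm ip (vminus (muhat (sample N X \<omega>)) \<mu>) \<le> 3 * (8 * (R / sqrt m))"
        by (rule est[rule_format, OF x mean]) (use A(3) \<omega> in blast)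
      also have "\<dots> \<le> 300000 * R * error_rate d N ip B \<epsilon> \<delta>"
        by (rule rate[OF R_nonneg])
      finally show "ip_norm ip (vminus (muhat (sample N X \<omega>)) \<mu>)
          \<le> 300000 * R * error_rate d N ip B \<epsilon> \<delta>" .
    qed
  qed
qed

text \<open>
  With groups of size \<open>n\<close> proportional to \<open>N\<close>, the number of groups is at most \<open>d / n + 1\<close>, where both
  summands are of order \<open>VC / N\<close>: the first because \<open>d \<le> VC\<close>, the second because \<open>c N < VC\<close>.
\<close>

lemma (in dual_pair) large_dimension:
  assumes "accuracy_params N \<epsilon> \<delta>" and V: "(1 / 100000000) * real N < VC_real d ip B" and U: "U = Rd d"
  shows "\<exists>muhat \<in> ({..<N} \<rightarrow>\<^sub>E Rd d) \<rightarrow> Rd d.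
      \<forall>(M :: 'w measure) Y X.
        prob_space M \<longrightarrow> iid_vectors M d N Y \<longrightarrow> finite_second_moments M d (Y 0) \<longrightarrow>
        mean_vec M (Y 0) \<in> U \<longrightarrow> nondegenerate_mat d (cov_mat M (Y 0)) \<longrightarrow> contaminated M d N \<epsilon> Y X \<longrightarrow>
        with_prob_at_least M (1 - \<delta>) (\<lambda>\<omega>.
          ip_norm ip (vminus (muhat (sample N X \<omega>)) (mean_vec M (Y 0)))
          \<le> 300000 * weak_sd M ip B (Y 0) * error_rate d N ip B \<epsilon> \<delta>)"
proof -
  interpret accuracy_params N \<epsilon> \<delta> by fact
  define n where "n = N div 40000"
  define V where "V = VC_real d ip B"
  have Vd: "real d \<le> V" unfolding V_def by (rule VC_real_ge_dim[OF U])
  have N': "50000000 \<le> real N" "0 < real N" using N_large by auto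
  have n1: "40000 * n \<le> N" by (simp add: n_def)
  have Nn: "50000000 \<le> N" using N'(1) by simp
  then have n2: "N \<le> 80000 * n" unfolding n_def by linarith
  have n0: "0 < n" using n2 N' by (cases n) auto
  have nN: "10000 * (2 * n + 1) \<le> N" using n1 Nn by simp
  have d0: "0 < d"
    using VC_real_le_dim assms(2) N' by (cases d) auto
  have \<epsilon>N: "8 * \<epsilon> * real N \<le> real N"
    using \<epsilon> N' mult_right_mono[of "8 * \<epsilon>" 1 "real N"] by simp
  have fail: "18 * n * exp (- (N / 1024)) \<le> \<delta>"
  proof -
    have "1 + N / 2048 + (N / 2048)\<^sup>2 / 2 \<le> exp (N / 2048)"
      by (rule exp_lower_Taylor_quadratic) simp
    moreover have "real N \<le> (N / 2048)\<^sup>2 / 2"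
    proof -
      have "(2 * 2048\<^sup>2) * real N \<le> real N * real N" using N' by (intro mult_right_mono) auto
      then show ?thesis by (simp add: power2_eq_square field_simps)
    qed
    ultimately have e: "real N \<le> exp (N / 2048)" using N' by (smt (verit) divide_nonneg_nonneg of_nat_0_le_iff)
    have "18 * n * exp (- (N / 1024)) \<le> real N * exp (- (N / 1024))"
      using n1 by (intro mult_right_mono) auto
    also have "\<dots> \<le> exp (N / 2048) * exp (- (N / 1024))" using e by (intro mult_right_mono) auto
    also have "\<dots> = exp (- (N / 2048))" by (simp flip: exp_add)
    also have "\<dots> \<le> exp (- (1 / 100000000) * real N)" by simp
    also have "\<dots> \<le> \<delta>" by (rule \<delta>(1))
    finally show ?thesis .
  qed
  have rate: "x \<le> 300000 * r * (sqrt (V / real N) + sqrt (ln (1 / \<delta>) / real N) + sqrt \<epsilon>)"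
    if r: "0 \<le> r" and x: "x\<^sup>2 \<le> 585 * real (d div n + 1) * r\<^sup>2" for x r :: real
  proof -
    have "real (d div n) \<le> real d / real n" by (rule of_nat_div_le_of_nat)
    also have "\<dots> \<le> V / real n" using Vd by (intro divide_right_mono) auto
    also have "\<dots> \<le> 80000 * (V / N)"
      using n2 n0 N' Vd by (simp add: field_simps) (metis mult_left_mono of_nat_0_le_iff of_nat_le_iff of_nat_mult of_nat_numeral order_trans)
    finally have 1: "real (d div n) \<le> 80000 * (V / N)" .
    have 2: "1 \<le> 100000000 * (V / N)" using assms(2) N' by (simp add: V_def field_simps)
    have "x\<^sup>2 \<le> 585 * (100080000 * (V / N)) * r\<^sup>2"
      using 1 2 by (intro order_trans[OF x] mult_right_mono mult_left_mono) auto
    also have "\<dots> \<le> (300000 * r)\<^sup>2 * (V / N)"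
    proof -
      define z where "z = (V / N) * r\<^sup>2"
      have z: "0 \<le> z" unfolding z_def using Vd N' by (intro mult_nonneg_nonneg) auto
      have "585 * (100080000 * (V / N)) * r\<^sup>2 = 58546800000 * z" by (simp add: z_def)
      moreover have "(300000 * r)\<^sup>2 * (V / N) = 90000000000 * z" by (simp add: z_def power_mult_distrib)
      ultimately show ?thesis using z by simp
    qed
    finally have "sqrt (x\<^sup>2) \<le> sqrt ((300000 * r)\<^sup>2 * (V / N))" by (rule real_sqrt_le_mono)
    then have "\<bar>x\<bar> \<le> \<bar>300000 * r\<bar> * sqrt (V / N)" unfolding real_sqrt_mult real_sqrt_abs .
    then have "x \<le> 300000 * r * sqrt (V / N)" using r by simp
    also have "\<dots> \<le> 300000 * r * (sqrt (V / N) + sqrt (ln (1 / \<delta>) / N) + sqrt \<epsilon>)"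
      using r \<epsilon> half_le_ln_inverse by (intro mult_left_mono) auto
    finally show ?thesis .
  qed
  from groupwise_estimator[of N n] obtain muhat where
    muhat: "muhat \<in> ({..<N} \<rightarrow>\<^sub>E Rd d) \<rightarrow> Rd d"
    and est: "\<forall>x. \<forall>u\<in>Rd d. \<forall>\<eta>. central_in_groups d n N (\<lambda>k. coord (x k)) (coord u) \<eta> \<longrightarrow>
    (ip_norm ip (vminus (muhat x) u))\<^sup>2 \<le> (\<Sum>q\<le>d div n. 9 * (\<eta> q)\<^sup>2)" by blast
  show ?thesis
  proof (intro bexI[OF _ muhat] allI impI)
    fix M :: "'w measure" and Y X
    assume M: "prob_space M" and iid: "iid_vectors M d N Y" and sm: "finite_second_moments M d (Y 0)"
      and mean: "mean_vec M (Y 0) \<in> U" and nd: "nondegenerate_mat d (cov_mat M (Y 0))"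
      and cont: "contaminated M d N \<epsilon> Y X"
    have "mean_problem d ip U B M N Y"
      using M iid sm mean N_large dual_pair_axioms
      by (simp add: mean_problem_def mean_problem_axioms_def)
    then interpret mean_problem d ip U B M N Y .
    obtain A where A: "A \<in> events" "1 - 18 * n * exp (- (N / 1024)) \<le> prob A"
      "\<forall>\<omega>\<in>A. \<exists>\<eta>. (\<Sum>q\<le>d div n. 9 * (\<eta> q)\<^sup>2) \<le> 585 * real (d div n + 1) * R\<^sup>2 \<and>
      central_in_groups d n N (\<lambda>k. coord (sample N X \<omega> k)) (coord \<mu>) \<eta>"
      using means_are_central_in_groups[OF U d0 nd n0 nN \<epsilon>N cont] by blast
    show "with_prob_at_least M (1 - \<delta>) (\<lambda>\<omega>. ip_norm ip (vminus (muhat (sample N X \<omega>)) \<mu>)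
          \<le> 300000 * R * error_rate d N ip B \<epsilon> \<delta>)"
    proof (rule with_prob_at_leastI[OF A(1)])
      show "1 - \<delta> \<le> prob A" using A(2) fail by linarith
      fix \<omega> assume \<omega>: "\<omega> \<in> A"
      obtain \<eta> where \<eta>: "(\<Sum>q\<le>d div n. 9 * (\<eta> q)\<^sup>2) \<le> 585 * real (d div n + 1) * R\<^sup>2"
        "central_in_groups d n N (\<lambda>k. coord (sample N X \<omega> k)) (coord \<mu>) \<eta>"
        using A(3) \<omega> by blast
      have "(ip_norm ip (vminus (muhat (sample N X \<omega>)) \<mu>))\<^sup>2 \<le> (\<Sum>q\<le>d div n. 9 * (\<eta> q)\<^sup>2)"
        using est \<mu>_Rd \<eta>(2) by blast
      then have "(ip_norm ip (vminus (muhat (sample N X \<omega>)) \<mu>))\<^sup>2 \<le> 585 * real (d div n + 1) * R\<^sup>2"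
        using \<eta>(1) by linarith
      then show "ip_norm ip (vminus (muhat (sample N X \<omega>)) \<mu>)
          \<le> 300000 * R * error_rate d N ip B \<epsilon> \<delta>"
        unfolding V_def[symmetric] by (rule rate[OF R_nonneg])
    qed
  qed
qed

theorem theorem1:
  shows "\<exists>c>0. \<exists>C>0. \<forall>(d::nat) (N::nat) ip U B \<epsilon> \<delta>.
    inner_product_on d ip \<longrightarrow> U \<subseteq> Rd d \<longrightarrow> is_dual_set d ip U B \<longrightarrow>
    0 \<le> \<epsilon> \<longrightarrow> \<epsilon> \<le> c \<longrightarrow> (U = Rd d \<or> VC_real d ip B \<le> c * real N) \<longrightarrow>
    exp (- c * real N) \<le> \<delta> \<longrightarrow> \<delta> \<le> 1/2 \<longrightarrow>
    (\<exists>muhat \<in> ({..<N} \<rightarrow>\<^sub>E Rd d) \<rightarrow> Rd d.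
      \<forall>(M :: 'w measure) Y X.
        prob_space M \<longrightarrow> iid_vectors M d N Y \<longrightarrow> finite_second_moments M d (Y 0) \<longrightarrow>
        mean_vec M (Y 0) \<in> U \<longrightarrow> nondegenerate_mat d (cov_mat M (Y 0)) \<longrightarrow>
        contaminated M d N \<epsilon> Y X \<longrightarrow>
        with_prob_at_least M (1 - \<delta>) (\<lambda>\<omega>.
          ip_norm ip (vminus (muhat (\<lambda>i\<in>{..<N}. X i \<omega>)) (mean_vec M (Y 0)))
          \<le> C * weak_sd M ip B (Y 0) *
            (sqrt (VC_real d ip B / real N) + sqrt (ln (1 / \<delta>) / real N) + sqrt \<epsilon>)))"
proof (rule exI[of _ "1 / 100000000"], rule conjI, simp, rule exI[of _ "300000"], rule conjI, simp,
    intro allI impI)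
  fix d N :: nat and ip U B and \<epsilon> \<delta> :: real
  assume ip: "inner_product_on d ip" and U: "U \<subseteq> Rd d" and B: "is_dual_set d ip U B"
    and \<epsilon>: "0 \<le> \<epsilon>" "\<epsilon> \<le> 1 / 100000000" and V: "U = Rd d \<or> VC_real d ip B \<le> 1 / 100000000 * real N"
    and \<delta>: "exp (- (1 / 100000000) * real N) \<le> \<delta>" "\<delta> \<le> 1/2"
  have acc: "accuracy_params N \<epsilon> \<delta>" using \<epsilon> \<delta> by unfold_locales
  interpret dual_pair d ip U B using ip U B by unfold_locales
  show "\<exists>muhat \<in> ({..<N} \<rightarrow>\<^sub>E Rd d) \<rightarrow> Rd d.
      \<forall>(M :: 'w measure) Y X.
        prob_space M \<longrightarrow> iid_vectors M d N Y \<longrightarrow> finite_second_moments M d (Y 0) \<longrightarrow>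
        mean_vec M (Y 0) \<in> U \<longrightarrow> nondegenerate_mat d (cov_mat M (Y 0)) \<longrightarrow>
        contaminated M d N \<epsilon> Y X \<longrightarrow>
        with_prob_at_least M (1 - \<delta>) (\<lambda>\<omega>.
          ip_norm ip (vminus (muhat (\<lambda>i\<in>{..<N}. X i \<omega>)) (mean_vec M (Y 0)))
          \<le> 300000 * weak_sd M ip B (Y 0) *
            (sqrt (VC_real d ip B / real N) + sqrt (ln (1 / \<delta>) / real N) + sqrt \<epsilon>))"
  proof (cases "VC_real d ip B \<le> 1 / 100000000 * real N")
    case True
    from small_dimension[OF acc this, where ?'w = 'w] show ?thesis by blast
  next
    case False
    then have "1 / 100000000 * real N < VC_real d ip B" "U = Rd d" using V by auto
    from large_dimension[OF acc this, where ?'w = 'w] show ?thesis .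
  qed
qed

end
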